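(* Let $p>1$, $\beta<0$, let $N\ge2$ be even, and set $$d_\omega^{\frac N2}=\inf\{S_\omega(v):\ v\in H^1_{\frac N2}(\Gamma)\setminus\{0\},\ I_\omega(v)=0\}.$$ Then: (i) for $\frac{N^2}{\beta^2}<\omega\le\frac{p+1}{p-1}\frac{N^2}{\beta^2}$ the solution (minimizer) of this problem is given by $\phi_\beta$; (ii) for $\omega>\frac{p+1}{p-1}\frac{N^2}{\beta^2}$ the solution (minimizer) of this problem is given by $\phi_{\frac N2}$.
   Context: $\Gamma$ is the star graph with $N$ half-lines $(0,\infty)$ joined at the vertex $0$. A function on $\Gamma$ is $v=(v_j)_{j=1}^N$ with $v_j:(0,\infty)\to\mathbb{C}$. $L^q(\Gamma)=\bigoplus_{j=1}^N L^q(\mathbb{R}^+)$ with norm $\|\cdot\|_q$, $H^1(\Gamma)=\bigoplus_{j=1}^N H^1(\mathbb{R}^+)$ (no continuity condition at the vertex), and $H^1_{\frac N2}(\Gamma)=\{v\in H^1(\Gamma):v_1=\dots=v_{N/2},\ v_{N/2+1}=\dots=v_N\}$. For $v\in H^1(\Gamma)$, $$F_\beta(v)=\|v'\|_2^2+\frac1\beta\Big|\sum_{j=1}^Nv_j(0)\Big|^2,\quad S_\omega(v)=\tfrac12F_\beta(v)+\tfrac\omega2\|v\|_2^2-\tfrac1{p+1}\|v\|_{p+1}^{p+1},\quad I_\omega(v)=F_\beta(v)+\omega\|v\|_2^2-\|v\|_{p+1}^{p+1}.$$ For $a\in\mathbb{R}$, $\phi_a(x)=\big\{\frac{(p+1)\omega}2\mathrm{sech}^2\big(\frac{(p-1)\sqrt\omega}2(x+a)\big)\big\}^{\frac1{p-1}}$.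 The symmetric profile $\phi_\beta$ has all $N$ components equal to $\phi_a$ with $a=-\frac{2}{(p-1)\sqrt\omega}\tanh^{-1}\big(\frac{N}{\beta\sqrt\omega}\big)$. The profile $\phi_{\frac N2}$ (for $\omega>\frac{p+1}{p-1}\frac{N^2}{\beta^2}$) has its first $N/2$ components equal to $\phi_{x_1}$ and its last $N/2$ components equal to $\phi_{x_N}$, where, for $\beta<0$, $x_1=\frac{2}{(p-1)\sqrt\omega}\tanh^{-1}(t_1)$, $x_N=\frac{2}{(p-1)\sqrt\omega}\tanh^{-1}(t_N)$, and $0<t_1<t_N<1$ is the (unique) solution of $$t_1^{p-1}-t_1^{p+1}=t_N^{p-1}-t_N^{p+1},\qquad \tfrac N2t_1^{-1}+\tfrac N2t_N^{-1}=|\beta|\sqrt\omega.$$ The minimizer is understood up to multiplication by $e^{i\theta}$, $\theta\in\mathbb{R}$, and interchange of the two blocks of $N/2$ edges. *)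

theory Defs
  imports "HOL-Analysis.Analysis"
begin

text \<open>
  A function on the star graph with \<open>N\<close> half-lines is a family \<open>v :: nat \<Rightarrow> real \<Rightarrow> complex\<close>; only the
  edges \<open>j \<in> {1..N}\<close> and the arguments \<open>x > 0\<close> matter, and functions on an edge are identified when
  they agree almost everywhere.
\<close>

abbreviation half_line :: "real measure" where
  "half_line \<equiv> lebesgue_on {0<..}"

definition eq_ae :: "(real \<Rightarrow> complex) \<Rightarrow> (real \<Rightarrow> complex) \<Rightarrow> bool" where
  "eq_ae u w \<longleftrightarrow> (AE x in half_line. u x = w x)"

definition graph_eq :: "nat \<Rightarrow> (nat \<Rightarrow> real \<Rightarrow> complex) \<Rightarrow> (nat \<Rightarrow> real \<Rightarrow> complex) \<Rightarrow> bool" where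
  "graph_eq N v w \<longleftrightarrow> (\<forall>j\<in>{1..N}. eq_ae (v j) (w j))"

subsection \<open>Lebesgue and Sobolev spaces\<close>

definition in_Lq :: "real \<Rightarrow> (real \<Rightarrow> complex) \<Rightarrow> bool" where
  "in_Lq q u \<longleftrightarrow> u \<in> borel_measurable half_line \<and> integrable half_line (\<lambda>x. cmod (u x) powr q)"

definition test_function :: "(real \<Rightarrow> real) \<Rightarrow> bool" where
  "test_function f \<longleftrightarrow>
     (\<forall>n x. (deriv ^^ n) f differentiable (at x)) \<and>
     (\<exists>a b. 0 < a \<and> a < b \<and> (\<forall>x. x \<notin> {a..b} \<longrightarrow> f x = 0))"

definition is_weak_deriv :: "(real \<Rightarrow> complex) \<Rightarrow> (real \<Rightarrow> complex) \<Rightarrow> bool" where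
  "is_weak_deriv u g \<longleftrightarrow>
     (\<forall>f. test_function f \<longrightarrow>
        (LINT x|half_line. deriv f x *\<^sub>R u x) = - (LINT x|half_line. f x *\<^sub>R g x))"

definition in_H1 :: "(real \<Rightarrow> complex) \<Rightarrow> bool" where
  "in_H1 u \<longleftrightarrow> in_Lq 2 u \<and> (\<exists>g. in_Lq 2 g \<and> is_weak_deriv u g)"

definition weak_deriv :: "(real \<Rightarrow> complex) \<Rightarrow> real \<Rightarrow> complex" where
  "weak_deriv u = (SOME g. in_Lq 2 g \<and> is_weak_deriv u g)"

text \<open>The value \<open>u(0)\<close> of \<open>u \<in> H\<^sup>1\<close> is the one taken by its representative that is continuous up to \<open>0\<close>.\<close>

definition trace0 :: "(real \<Rightarrow> complex) \<Rightarrow> complex" where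
  "trace0 u = (THE z. \<exists>w. continuous_on {0..} w \<and> eq_ae u w \<and> w 0 = z)"

definition graph_norm :: "nat \<Rightarrow> real \<Rightarrow> (nat \<Rightarrow> real \<Rightarrow> complex) \<Rightarrow> real" where
  "graph_norm N q v = (\<Sum>j=1..N. LINT x|half_line. cmod (v j x) powr q) powr (1 / q)"

definition H1_graph :: "nat \<Rightarrow> (nat \<Rightarrow> real \<Rightarrow> complex) set" where
  "H1_graph N = {v. \<forall>j\<in>{1..N}. in_H1 (v j)}"

definition H1_half_graph :: "nat \<Rightarrow> (nat \<Rightarrow> real \<Rightarrow> complex) set" where
  "H1_half_graph N = {v \<in> H1_graph N.
     (\<forall>i\<in>{1..N div 2}. \<forall>j\<in>{1..N div 2}. eq_ae (v i) (v j)) \<and>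
     (\<forall>i\<in>{N div 2 + 1..N}. \<forall>j\<in>{N div 2 + 1..N}. eq_ae (v i) (v j))}"

subsection \<open>The variational problem\<close>

definition F_form :: "nat \<Rightarrow> real \<Rightarrow> (nat \<Rightarrow> real \<Rightarrow> complex) \<Rightarrow> real" where
  "F_form N \<beta> v =
     (graph_norm N 2 (\<lambda>j. weak_deriv (v j)))\<^sup>2 + 1 / \<beta> * (cmod (\<Sum>j=1..N. trace0 (v j)))\<^sup>2"

definition S_action :: "nat \<Rightarrow> real \<Rightarrow> real \<Rightarrow> real \<Rightarrow> (nat \<Rightarrow> real \<Rightarrow> complex) \<Rightarrow> real" where
  "S_action N p \<beta> \<omega> v =
     1 / 2 * F_form N \<beta> v + \<omega> / 2 * (graph_norm N 2 v)\<^sup>2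
       - 1 / (p + 1) * graph_norm N (p + 1) v powr (p + 1)"

definition I_nehari :: "nat \<Rightarrow> real \<Rightarrow> real \<Rightarrow> real \<Rightarrow> (nat \<Rightarrow> real \<Rightarrow> complex) \<Rightarrow> real" where
  "I_nehari N p \<beta> \<omega> v =
     F_form N \<beta> v + \<omega> * (graph_norm N 2 v)\<^sup>2 - graph_norm N (p + 1) v powr (p + 1)"

definition admissible :: "nat \<Rightarrow> real \<Rightarrow> real \<Rightarrow> real \<Rightarrow> (nat \<Rightarrow> real \<Rightarrow> complex) set" where
  "admissible N p \<beta> \<omega> =
     {v \<in> H1_half_graph N. \<not> graph_eq N v (\<lambda>j x. 0) \<and> I_nehari N p \<beta> \<omega> v = 0}"

text \<open>The infimum is taken in \<open>ereal\<close>, where it needs no boundedness or nonemptiness assumption.\<close>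

definition d_half :: "nat \<Rightarrow> real \<Rightarrow> real \<Rightarrow> real \<Rightarrow> ereal" where
  "d_half N p \<beta> \<omega> = (INF v\<in>admissible N p \<beta> \<omega>. ereal (S_action N p \<beta> \<omega> v))"

definition minimizers :: "nat \<Rightarrow> real \<Rightarrow> real \<Rightarrow> real \<Rightarrow> (nat \<Rightarrow> real \<Rightarrow> complex) set" where
  "minimizers N p \<beta> \<omega> =
     {v \<in> admissible N p \<beta> \<omega>. ereal (S_action N p \<beta> \<omega> v) = d_half N p \<beta> \<omega>}"

text \<open>All functions obtained from \<open>w\<close> by a constant phase and an interchange of the two edge blocks.\<close>

definition swap_blocks :: "nat \<Rightarrow> (nat \<Rightarrow> real \<Rightarrow> complex) \<Rightarrow> nat \<Rightarrow> real \<Rightarrow> complex" where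
  "swap_blocks N w = (\<lambda>j. if j \<le> N div 2 then w (j + N div 2) else w (j - N div 2))"

definition symmetry_orbit :: "nat \<Rightarrow> (nat \<Rightarrow> real \<Rightarrow> complex) \<Rightarrow> (nat \<Rightarrow> real \<Rightarrow> complex) set" where
  "symmetry_orbit N w = {v. \<exists>\<theta>::real.
     graph_eq N v (\<lambda>j x. cis \<theta> * w j x) \<or> graph_eq N v (\<lambda>j x. cis \<theta> * swap_blocks N w j x)}"

subsection \<open>The profiles\<close>

definition phi :: "real \<Rightarrow> real \<Rightarrow> real \<Rightarrow> real \<Rightarrow> real" where
  "phi p \<omega> a x =
     ((p + 1) * \<omega> / 2 * (1 / cosh ((p - 1) * sqrt \<omega> / 2 * (x + a)))\<^sup>2) powr (1 / (p - 1))"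

definition phi_sym :: "real \<Rightarrow> real \<Rightarrow> real \<Rightarrow> nat \<Rightarrow> nat \<Rightarrow> real \<Rightarrow> complex" where
  "phi_sym p \<beta> \<omega> N = (\<lambda>j x.
     of_real (phi p \<omega> (- 2 / ((p - 1) * sqrt \<omega>) * artanh (real N / (\<beta> * sqrt \<omega>))) x))"

definition asym_system :: "real \<Rightarrow> real \<Rightarrow> real \<Rightarrow> nat \<Rightarrow> real \<Rightarrow> real \<Rightarrow> bool" where
  "asym_system p \<beta> \<omega> N t1 tN \<longleftrightarrow>
     0 < t1 \<and> t1 < tN \<and> tN < 1 \<and>
     t1 powr (p - 1) - t1 powr (p + 1) = tN powr (p - 1) - tN powr (p + 1) \<and>
     real N / 2 * inverse t1 + real N / 2 * inverse tN = \<bar>\<beta>\<bar> * sqrt \<omega>"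

definition phi_asym :: "real \<Rightarrow> real \<Rightarrow> nat \<Rightarrow> real \<Rightarrow> real \<Rightarrow> nat \<Rightarrow> real \<Rightarrow> complex" where
  "phi_asym p \<omega> N t1 tN = (\<lambda>j x.
     of_real (phi p \<omega> (2 / ((p - 1) * sqrt \<omega>) * artanh (if j \<le> N div 2 then t1 else tN)) x))"

end

theory Submission
  imports Defs "HOL-Computational_Algebra.Polynomial"
begin

text \<open>
  Everything rests on a lower bound of the action that can be computed exactly. A function of
  \<open>H1_half_graph N\<close> is a pair \<open>(f, g)\<close> of functions on the half-line, each one repeated on \<open>N div 2\<close>
  edges. Put \<open>S = peak p \<omega>\<close>, the largest amplitude of a soliton, and \<open>\<tau> = N / (2 * \<bar>\<beta>\<bar> * sqrt \<omega>)\<close>.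

  Calibration. As long as \<open>\<bar>f\<bar> \<le> S\<close>, the density \<open>\<bar>f'\<bar>^2 + \<omega> * \<bar>f\<bar>^2 - 2 / (p + 1) * \<bar>f\<bar>^(p + 1)\<close> equals
  \<open>\<bar>f' + V f\<bar>^2 - 2 * (V f \<bullet> f')\<close>, where \<open>V\<close> (\<open>flow\<close>) is the gradient of a radial potential. Its integral
  is therefore at least twice the potential at \<open>f x\<close>, for every \<open>x\<close>, hence at least twice the potential
  at the supremum of \<open>\<bar>f\<bar>\<close>. Equality forces \<open>\<bar>f\<bar>\<close> to be largest at the vertex and \<open>f' = - V f\<close>, which is
  solved by a phase times a soliton tail only. If \<open>S * a\<close> and \<open>S * b\<close> are the suprema of \<open>\<bar>f\<bar>\<close> and \<open>\<bar>g\<bar>\<close>,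
  twice the action divided by \<open>N div 2\<close> is thus bounded below by \<open>sqrt \<omega> * S^2 * pair_energy p \<tau> a b\<close>.

  Mountain pass. The action itself has no minimum, but a function with \<open>I = 0\<close> is the strict maximum
  point of the action on the ray through it. So it is enough that every ray from
  the origin of the quadrant \<open>a, b \<ge> 0\<close> contains a point of the unit square where \<open>pair_energy\<close> is at
  least its value at the amplitudes of the claimed minimizer, with equality at those amplitudes only
  (\<open>nehari_lower_bound\<close>).

  The two regimes. The points with \<open>0 < a \<le> b\<close> at which the flow has the same strength at both amplitudes
  form a curve \<open>(\<rho> y * exp (- y), \<rho> y * exp y)\<close>, \<open>y \<ge> 0\<close>, that meets every ray with \<open>0 < a \<le> b\<close> once. Its
  coordinate sum decreases in \<open>y\<close>, and the derivative of \<open>pair_energy\<close> along it has the sign opposite to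
  that of \<open>\<kappa> y - 2 * \<tau> * cosh y\<close>, where \<open>\<kappa> y / cosh y\<close> decreases from \<open>sqrt ((p - 1) / (p + 1))\<close> to \<open>0\<close>. Above the
  threshold for \<open>\<omega>\<close> there is one zero, at which the energy on the curve is least; the hyperbolic
  tangents \<open>\<kappa> * exp (- y)\<close> and \<open>\<kappa> * exp y\<close> are then the solution of the algebraic system
  (\<open>asymmetric_minmax\<close>, \<open>asym_system_iff\<close>). Up to the threshold the energy grows along the whole curve, and
  the least value is the one at the critical point on the diagonal (\<open>symmetric_minmax\<close>).

  The calibration needs the chain rule along \<open>H1\<close> functions. They are only absolutely continuous, and
  the weak derivative comes from smooth test functions; \<open>primitive_on_chain\<close> and
  \<open>H1_rep_of_in_H1\<close> supply what is needed.
\<close>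

section \<open>Quotients of hyperbolic sines\<close>

text \<open>
  The value at \<open>0\<close> is the limit, so that the curve built from this function below extends continuously
  to the diagonal.
\<close>

definition sinh_ratio :: "real \<Rightarrow> real \<Rightarrow> real \<Rightarrow> real" where
  "sinh_ratio \<alpha> \<beta> y = (if y = 0 then \<alpha> / \<beta> else sinh (\<alpha> * y) / sinh (\<beta> * y))"

lemma sinh_cosh_cross_less:
  fixes \<alpha> \<beta> y :: real
  assumes "0 < \<alpha>" "\<alpha> < \<beta>" "0 < y"
  shows "\<alpha> * cosh (\<alpha> * y) * sinh (\<beta> * y) < \<beta> * sinh (\<alpha> * y) * cosh (\<beta> * y)"
proof -
  define D where "D z = \<alpha> * cosh (\<alpha> * z) * sinh (\<beta> * z) - \<beta> * sinh (\<alpha> * z) * cosh (\<beta> * z)" for z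
  have "D y < D 0"
  proof (rule DERIV_neg_imp_decreasing_open[OF assms(3)])
    fix z :: real assume z: "0 < z" "z < y"
    have "DERIV D z :> (\<alpha>\<^sup>2 - \<beta>\<^sup>2) * (sinh (\<alpha> * z) * sinh (\<beta> * z))"
      unfolding D_def
      by (auto intro!: derivative_eq_intros simp: algebra_simps power2_eq_square)
    moreover have "(\<alpha>\<^sup>2 - \<beta>\<^sup>2) * (sinh (\<alpha> * z) * sinh (\<beta> * z)) < 0"
      using assms z by (intro mult_neg_pos mult_pos_pos) (auto simp: power_strict_mono)
    ultimately show "\<exists>l. DERIV D z :> l \<and> l < 0" by blast
  qed (auto simp: D_def intro!: continuous_intros)
  then show ?thesis by (simp add: D_def)
qed

lemma sinh_ratio_pos:
  assumes "0 < \<alpha>" "0 < \<beta>" "0 \<le> y"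
  shows "0 < sinh_ratio \<alpha> \<beta> y"
  using assms by (auto simp: sinh_ratio_def)

lemma has_real_derivative_sinh_ratio:
  assumes "0 < \<beta>" "0 < y"
  shows "(sinh_ratio \<alpha> \<beta> has_real_derivative
    (\<alpha> * cosh (\<alpha> * y) * sinh (\<beta> * y) - \<beta> * sinh (\<alpha> * y) * cosh (\<beta> * y)) / (sinh (\<beta> * y))\<^sup>2) (at y)"
proof (rule has_field_derivative_transform_within_open[where S="{0<..}"])
  show "((\<lambda>y. sinh (\<alpha> * y) / sinh (\<beta> * y)) has_real_derivative
    (\<alpha> * cosh (\<alpha> * y) * sinh (\<beta> * y) - \<beta> * sinh (\<alpha> * y) * cosh (\<beta> * y)) / (sinh (\<beta> * y))\<^sup>2) (at y)"
    using assms by (auto intro!: derivative_eq_intros simp: field_simps power2_eq_square)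
qed (use assms in \<open>auto simp: sinh_ratio_def\<close>)

lemma isCont_sinh_ratio:
  assumes "0 < \<beta>"
  shows "isCont (sinh_ratio \<alpha> \<beta>) y"
proof (cases "y = 0")
  case True
  have q: "((\<lambda>h. sinh (\<gamma> * h) / h) \<longlongrightarrow> \<gamma>) (at 0)" for \<gamma> :: real
  proof -
    have "((\<lambda>x. sinh (\<gamma> * x)) has_real_derivative \<gamma>) (at 0)"
      by (auto intro!: derivative_eq_intros)
    then show ?thesis by (simp add: DERIV_def)
  qed
  have "((\<lambda>h. (sinh (\<alpha> * h) / h) / (sinh (\<beta> * h) / h)) \<longlongrightarrow> \<alpha> / \<beta>) (at 0)"
    using assms by (intro tendsto_divide q) auto
  then have "(sinh_ratio \<alpha> \<beta> \<longlongrightarrow> \<alpha> / \<beta>) (at 0)"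
    by (rule Lim_transform_eventually)
      (auto simp: sinh_ratio_def eventually_at intro!: exI[of _ 1])
  then show ?thesis using True by (simp add: isCont_def sinh_ratio_def)
next
  case False
  have "isCont (\<lambda>y. sinh (\<alpha> * y) / sinh (\<beta> * y)) y"
    using False assms by (intro continuous_intros) auto
  moreover have "\<forall>\<^sub>F x in nhds y. sinh_ratio \<alpha> \<beta> x = sinh (\<alpha> * x) / sinh (\<beta> * x)"
    using t1_space_nhds[OF False] by eventually_elim (auto simp: sinh_ratio_def)
  ultimately show ?thesis by (simp add: isCont_cong)
qed

lemma continuous_on_sinh_ratio [continuous_intros]:
  "0 < \<beta> \<Longrightarrow> continuous_on A f \<Longrightarrow> continuous_on A (\<lambda>x. sinh_ratio \<alpha> \<beta> (f x))"
  by (metis continuous_on_compose2 continuous_at_imp_continuous_on isCont_sinh_ratio subset_UNIV)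

lemma sinh_ratio_strict_decreasing:
  assumes "0 < \<alpha>" "\<alpha> < \<beta>" "0 \<le> y" "y < z"
  shows "sinh_ratio \<alpha> \<beta> z < sinh_ratio \<alpha> \<beta> y"
proof (rule DERIV_neg_imp_decreasing_open[OF assms(4)])
  fix x assume "y < x" "x < z"
  then have x: "0 < x" using assms by simp
  show "\<exists>l. DERIV (sinh_ratio \<alpha> \<beta>) x :> l \<and> l < 0"
    using has_real_derivative_sinh_ratio[of \<beta> x \<alpha>] sinh_cosh_cross_less[OF assms(1,2) x] assms x
    by (intro exI conjI) (auto simp: divide_less_0_iff)
qed (use assms in \<open>auto intro!: continuous_intros\<close>)

section \<open>The reduced energy of two amplitudes\<close>

text \<open>
  In units in which \<open>\<omega> = 1\<close> and the largest amplitude is \<open>1\<close>, a decreasing soliton solves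
  \<open>y' = - decay p y\<close>. The function is extended as an odd function, and by \<open>0\<close> beyond the largest amplitude.
\<close>

definition decay :: "real \<Rightarrow> real \<Rightarrow> real" where
  "decay p s = s * sqrt (max 0 (1 - \<bar>s\<bar> powr (p - 1)))"

definition decay_int :: "real \<Rightarrow> real \<Rightarrow> real" where
  "decay_int p s = integral {0..s} (decay p)"

lemma continuous_on_decay [continuous_intros]:
  assumes "1 < p"
  shows "continuous_on A (decay p)"
  unfolding decay_def using assms by (intro continuous_intros continuous_on_powr') auto

lemma decay_nonneg: "0 \<le> s \<Longrightarrow> 0 \<le> decay p s" by (simp add: decay_def)

lemma decay_le: "0 \<le> s \<Longrightarrow> decay p s \<le> s"
  by (auto simp: decay_def intro!: mult_left_le)

lemma decay_int_0 [simp]: "decay_int p 0 = 0" by (simp add: decay_int_def)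

lemma continuous_on_decay_int:
  assumes "1 < p"
  shows "continuous_on {0..} (decay_int p)"
proof -
  have "continuous_on {0..X} (decay_int p)" for X
    unfolding decay_int_def
    by (intro indefinite_integral_continuous_1 integrable_continuous_real continuous_on_decay assms)
  moreover have "\<exists>X. x \<in> {0..X} \<and> at x within {0..X} = at x within {0..}" if "0 \<le> x" for x :: real
    using that at_within_Icc_at_right[of 0 1]
    by (intro exI[of _ "x + 1"] conjI at_within_nhd[of _ "{..<x+1}"]) auto
  ultimately show ?thesis
    by (metis atLeast_iff continuous_on_eq_continuous_within)
qed

lemma has_real_derivative_decay_int:
  assumes "1 < p" "0 < s"
  shows "(decay_int p has_real_derivative decay p s) (at s)"
proof -
  have "(decay_int p has_real_derivative decay p s) (at s within {0..s+1})"
    unfolding decay_int_def using assms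
    by (intro integral_has_real_derivative continuous_on_decay) auto
  then show ?thesis using assms by (simp add: at_within_Icc_at)
qed

lemma decay_int_nonneg:
  assumes "1 < p" "0 \<le> s"
  shows "0 \<le> decay_int p s"
  unfolding decay_int_def
  by (intro integral_nonneg integrable_continuous_real continuous_on_decay assms) (auto simp: decay_nonneg)

lemma decay_int_le:
  assumes "1 < p" "0 \<le> s"
  shows "decay_int p s \<le> s\<^sup>2 / 2"
proof (cases "s = 0")
  case False
  define h where "h x = decay_int p x - x\<^sup>2 / 2" for x
  have "h s \<le> h 0"
  proof (rule DERIV_nonpos_imp_decreasing_open[where f = h])
    fix x assume x: "0 < x" "x < s"
    have "DERIV h x :> decay p x - x"
      unfolding h_def
      by (rule derivative_eq_intros has_real_derivative_decay_int assms x refl | simp)+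
    then show "\<exists>l. DERIV h x :> l \<and> l \<le> 0" using decay_le[of x p] x by force
  qed (use assms in \<open>auto simp: h_def intro!: continuous_intros continuous_on_subset[OF continuous_on_decay_int[OF assms(1)]]\<close>)
  then show ?thesis by (simp add: h_def)
qed simp

text \<open>
  The arguments \<open>a\<close> and \<open>b\<close> are the amplitudes of the two components relative to the soliton
  maximum, and the last term is the attractive coupling at the vertex.
\<close>

definition pair_energy :: "real \<Rightarrow> real \<Rightarrow> real \<Rightarrow> real \<Rightarrow> real" where
  "pair_energy p \<tau> a b = 2 * decay_int p a + 2 * decay_int p b - \<tau> * (a + b)\<^sup>2"

lemma pair_energy_commute: "pair_energy p \<tau> a b = pair_energy p \<tau> b a"
  by (simp add: pair_energy_def add.commute)

text \<open>
  Removing a coordinate that is small compared with the other one does not lower the energy: the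
  loss is quadratic in \<open>a\<close>, the gain from the coupling is linear. This reduces the rays along the axes to rays
  close to them.
\<close>

lemma pair_energy_axis:
  assumes "1 < p" "0 \<le> a" "0 \<le> b" "0 < \<tau>" "a * (1 - \<tau>) \<le> 2 * \<tau> * b"
  shows "pair_energy p \<tau> a b \<le> pair_energy p \<tau> 0 b"
proof -
  have "a * (a * (1 - \<tau>)) \<le> a * (2 * \<tau> * b)" using assms by (intro mult_left_mono) auto
  then show ?thesis using decay_int_le[OF assms(1,2)]
    by (simp add: pair_energy_def power2_eq_square algebra_simps)
qed

section \<open>The curve of equal decay\<close>

text \<open>
  Solving \<open>decay p (q * exp (- y)) = decay p (q * exp y)\<close> for \<open>q\<close> gives this formula, the parameter
  \<open>y\<close> being half the logarithm of the ratio of the coordinates.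
\<close>

definition curve_radius :: "real \<Rightarrow> real \<Rightarrow> real" where
  "curve_radius p y = sinh_ratio 2 (p + 1) y powr (1 / (p - 1))"

text \<open>
  At the point with parameter \<open>y\<close> the ratio \<open>decay p s / s\<close>, which is the hyperbolic tangent of the
  soliton phase, equals \<open>exp y * curve_slope p y\<close> at the smaller coordinate and \<open>exp (- y) * curve_slope p y\<close> at
  the larger one.
\<close>

definition curve_slope :: "real \<Rightarrow> real \<Rightarrow> real" where
  "curve_slope p y = sqrt (sinh_ratio (p - 1) (p + 1) y)"

definition curve_sum :: "real \<Rightarrow> real \<Rightarrow> real" where
  "curve_sum p y = 2 * curve_radius p y * cosh y"

lemma curve_radius_pos: "1 < p \<Longrightarrow> 0 \<le> y \<Longrightarrow> 0 < curve_radius p y"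
  using sinh_ratio_pos[of 2 "p + 1" y] by (auto simp: curve_radius_def)

lemma curve_radius_powr:
  assumes "1 < p" "0 \<le> y"
  shows "curve_radius p y powr (p - 1) = sinh_ratio 2 (p + 1) y"
  using assms sinh_ratio_pos[of 2 "p + 1" y] by (simp add: curve_radius_def powr_powr)

lemma continuous_on_curve_radius [continuous_intros]:
  assumes "1 < p"
  shows "continuous_on {0..} (curve_radius p)"
  unfolding curve_radius_def
  using assms sinh_ratio_pos[of 2 "p + 1"]
  by (intro continuous_intros) (auto simp: order_less_imp_not_eq2)

lemma continuous_on_curve_sum [continuous_intros]:
  assumes "1 < p"
  shows "continuous_on {0..} (curve_sum p)"
  unfolding curve_sum_def
  using assms by (intro continuous_intros)

lemma curve_slope_pos: "1 < p \<Longrightarrow> 0 \<le> y \<Longrightarrow> 0 < curve_slope p y"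
  using sinh_ratio_pos[of "p - 1" "p + 1" y] by (auto simp: curve_slope_def)

lemma sinh_ratio_exp_identity:
  assumes "1 < p" "0 < y" "e \<in> {-1, 1}"
  shows "1 - sinh_ratio 2 (p + 1) y * exp (e * ((p - 1) * y)) = exp (- (2 * e * y)) * sinh_ratio (p - 1) (p + 1) y"
proof -
  have n: "(p + 1) * y \<noteq> 0" using assms by auto
  have "sinh ((p + 1) * y) - sinh (2 * y) * exp (e * ((p - 1) * y)) = exp (- (2 * e * y)) * sinh ((p - 1) * y)"
    using assms(3) unfolding sinh_field_def
    by (auto simp: field_simps simp flip: exp_add)
  moreover have "sinh ((p + 1) * y) \<noteq> 0" using n by simp
  ultimately show ?thesis
    using assms by (simp add: sinh_ratio_def diff_eq_eq add_divide_distrib[symmetric] divide_simps)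
qed

lemma curve_exp_powr:
  assumes "1 < p" "0 < y"
  shows "(curve_radius p y * exp (e * y)) powr (p - 1) = sinh_ratio 2 (p + 1) y * exp (e * ((p - 1) * y))"
  using assms curve_radius_pos[of p y] curve_radius_powr[of p y]
  by (simp add: powr_mult powr_def[of "exp _"] mult_ac)

lemma curve_height:
  assumes "1 < p" "0 < y" "e \<in> {-1, 1}"
  shows "(curve_radius p y * exp (e * y)) powr (p - 1) = 1 - (exp (- (e * y)) * curve_slope p y)\<^sup>2"
proof -
  have "(exp (- (e * y)))\<^sup>2 = exp (- (2 * e * y))"
    by (simp add: power2_eq_square flip: exp_add)
  then show ?thesis
    using sinh_ratio_exp_identity[OF assms] curve_exp_powr[OF assms(1,2), of e] assms
      sinh_ratio_pos[of "p - 1" "p + 1" y]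
    by (simp add: power_mult_distrib curve_slope_def)
qed

lemma curve_le_1:
  assumes "1 < p" "0 < y" "e \<in> {-1, 1}"
  shows "curve_radius p y * exp (e * y) < 1"
proof -
  have "(exp (- (e * y)) * curve_slope p y)\<^sup>2 > 0" using curve_slope_pos[of p y] assms by auto
  then have "(curve_radius p y * exp (e * y)) powr (p - 1) < 1 powr (p - 1)"
    using curve_height[OF assms] by simp
  then show ?thesis
    using powr_less_cancel2[of "p - 1" _ 1] assms by (simp add: curve_radius_pos)
qed

lemma decay_curve:
  assumes "1 < p" "0 < y" "e \<in> {-1, 1}"
  shows "decay p (curve_radius p y * exp (e * y)) = curve_radius p y * curve_slope p y"
proof -
  have "exp (e * y) * exp (- (e * y)) = 1" by (simp flip: exp_add)
  then show ?thesis
    using curve_height[OF assms] curve_radius_pos[of p y] curve_slope_pos[of p y] assms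
    by (simp add: decay_def real_sqrt_mult abs_mult)
qed

text \<open>
  The difference of the squares of the two sides is
  \<open>2 * q^2 * (sinh (2 * y) - q powr (p - 1) * sinh ((p + 1) * y))\<close>, which is positive exactly for \<open>q\<close> below
  \<open>curve_radius p y\<close>.
\<close>

lemma decay_below_curve:
  assumes "1 < p" "0 < y" "0 < q" "q < curve_radius p y"
  shows "decay p (q * exp (- y)) < decay p (q * exp y)"
proof -
  have q: "q powr (p - 1) < sinh_ratio 2 (p + 1) y"
    using powr_less_mono2[of "p - 1" q "curve_radius p y"] assms curve_radius_powr[of p y] by simp
  have lt1: "q * exp (e * y) < 1" if "e \<in> {-1, 1}" for e
    using mult_strict_right_mono[OF assms(4), of "exp (e * y)"] curve_le_1[OF assms(1,2) that]
    by (meson exp_gt_zero less_trans)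
  have le1: "(q * exp (e * y)) powr (p - 1) \<le> 1" if "e \<in> {-1, 1}" for e
    using lt1[OF that] powr_mono2[of "p - 1" "q * exp (e * y)" 1] assms by simp
  have sq: "(decay p (q * exp (e * y)))\<^sup>2 = q\<^sup>2 * (exp (2 * e * y) - q powr (p - 1) * exp (e * (p + 1) * y))"
    if "e \<in> {-1, 1}" for e
  proof -
    have 1: "(q * exp (e * y)) powr (p - 1) = q powr (p - 1) * exp (e * ((p - 1) * y))"
      using assms by (simp add: powr_mult powr_def[of "exp _"] mult_ac)
    have 2: "(exp (e * y))\<^sup>2 = exp (2 * e * y)" by (simp add: power2_eq_square flip: exp_add)
    have 3: "exp (2 * e * y) * exp (e * ((p - 1) * y)) = exp (e * (p + 1) * y)"
      by (simp add: algebra_simps flip: exp_add)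
    have "(decay p (q * exp (e * y)))\<^sup>2 = q\<^sup>2 * exp (2 * e * y) * (1 - q powr (p - 1) * exp (e * ((p - 1) * y)))"
      using le1[OF that] assms 1 2 by (simp add: decay_def power_mult_distrib abs_mult)
    then show ?thesis using 3 by (simp add: algebra_simps)
  qed
  have "(decay p (q * exp y))\<^sup>2 - (decay p (q * exp (- y)))\<^sup>2
      = 2 * q\<^sup>2 * (sinh (2 * y) - q powr (p - 1) * sinh ((p + 1) * y))"
    using sq[of 1] sq[of "-1"] by (simp add: sinh_field_def) (simp add: field_simps)
  moreover have "q powr (p - 1) * sinh ((p + 1) * y) < sinh (2 * y)"
    using q assms by (simp add: sinh_ratio_def pos_less_divide_eq)
  ultimately have "0 < (decay p (q * exp y))\<^sup>2 - (decay p (q * exp (- y)))\<^sup>2"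
    using assms by simp
  then have "(decay p (q * exp (- y)))\<^sup>2 < (decay p (q * exp y))\<^sup>2" by simp
  then show ?thesis by (rule power2_less_imp_less) (use assms in \<open>simp add: decay_nonneg\<close>)
qed

lemma has_real_derivative_curve_radius:
  assumes "1 < p" "0 < y"
  shows "(curve_radius p has_real_derivative
    curve_radius p y / (p - 1) * (2 * cosh (2 * y) / sinh (2 * y) - (p + 1) * cosh ((p + 1) * y) / sinh ((p + 1) * y))) (at y)"
proof -
  have r: "0 < sinh_ratio 2 (p + 1) y" using sinh_ratio_pos assms by simp
  have s: "0 < sinh ((p + 1) * y)" "0 < sinh (2 * y)" using assms by auto
  have e: "sinh_ratio 2 (p + 1) y = sinh (2 * y) / sinh ((p + 1) * y)" using assms by (simp add: sinh_ratio_def)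
  let ?D = "(2 * cosh (2 * y) * sinh ((p + 1) * y) - (p + 1) * sinh (2 * y) * cosh ((p + 1) * y)) / (sinh ((p + 1) * y))\<^sup>2"
  let ?d = "2 * cosh (2 * y) / sinh (2 * y) - (p + 1) * cosh ((p + 1) * y) / sinh ((p + 1) * y)"
  have "(curve_radius p has_real_derivative
     1 / (p - 1) * sinh_ratio 2 (p + 1) y powr (1 / (p - 1) - of_nat 1) * ?D) (at y)"
    unfolding curve_radius_def[abs_def]
    by (rule DERIV_fun_powr[OF has_real_derivative_sinh_ratio r]) (use assms in auto)
  moreover have "?D = sinh_ratio 2 (p + 1) y * ?d"
    unfolding e using s by (simp add: field_simps power2_eq_square)
  ultimately show ?thesis
    using r by (simp add: curve_radius_def powr_diff)
qed

text \<open>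
  After the addition theorems the logarithmic derivative has the sign of
  \<open>tanh (p * y) - p * tanh y\<close>.
\<close>

lemma curve_sum_deriv_neg:
  assumes "1 < p" "0 < y"
  shows "\<exists>l<0. (curve_sum p has_real_derivative l) (at y)"
proof -
  let ?d = "2 * cosh (2 * y) / sinh (2 * y) - (p + 1) * cosh ((p + 1) * y) / sinh ((p + 1) * y)"
  define C S c s where "C = cosh y" and "S = sinh y" and "c = cosh (p * y)" and "s = sinh (p * y)"
  have pos: "0 < C" "0 < S" "0 < c" "0 < s" using assms by (auto simp: C_def S_def c_def s_def)
  have CS: "C\<^sup>2 = S\<^sup>2 + 1" by (simp add: C_def S_def cosh_square_eq)
  have e: "(p + 1) * y = p * y + y" by (simp add: algebra_simps)
  have h: "sinh ((p + 1) * y) = s * C + c * S" "cosh ((p + 1) * y) = c * C + s * S"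
    unfolding e by (simp_all add: sinh_add cosh_add C_def S_def c_def s_def)
  have h2: "sinh (2 * y) = 2 * S * C" "cosh (2 * y) = C\<^sup>2 + S\<^sup>2"
    by (simp_all add: sinh_double cosh_double C_def S_def)
  have cross: "s * C - p * c * S < 0"
    using sinh_cosh_cross_less[of 1 p y] assms by (simp add: C_def S_def c_def s_def mult_ac)
  have "(p - 1) * S * (2 * S * C) * (s * C + c * S)
      + C * (2 * (C\<^sup>2 + S\<^sup>2) * (s * C + c * S) - (p + 1) * (c * C + s * S) * (2 * S * C))
      = 2 * C * (C\<^sup>2 - S\<^sup>2) * (s * C - p * c * S)"
    by algebra
  then have E: "(p - 1) * S * (2 * S * C) * (s * C + c * S)
      + C * (2 * (C\<^sup>2 + S\<^sup>2) * (s * C + c * S) - (p + 1) * (c * C + s * S) * (2 * S * C))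
      = 2 * C * (s * C - p * c * S)"
    using CS by simp
  have den: "0 < 2 * S * C * (s * C + c * S)" using pos by (simp add: add_pos_pos)
  have "(p - 1) * S + C * (2 * N / D - (p + 1) * N' / D')
      = ((p - 1) * S * D * D' + C * (2 * N * D' - (p + 1) * N' * D)) / (D * D')"
    if "D \<noteq> 0" "D' \<noteq> 0" for N N' D D' :: real
    using that by (simp add: field_simps)
  from this[of "2 * S * C" "s * C + c * S" "C\<^sup>2 + S\<^sup>2" "c * C + s * S"]
  have "(p - 1) * S + C * ?d = 2 * C * (s * C - p * c * S) / (2 * S * C * (s * C + c * S))"
    unfolding h h2 E using den by fastforce
  moreover have "\<dots> < 0" using pos den cross by (intro divide_neg_pos mult_pos_neg) auto
  ultimately have neg: "(p - 1) * S + C * ?d < 0" by simp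
  have d: "(curve_sum p has_real_derivative
      2 * (curve_radius p y / (p - 1) * ?d) * cosh y + sinh y * (2 * curve_radius p y)) (at y)"
    unfolding curve_sum_def
    by (rule derivative_eq_intros has_real_derivative_curve_radius assms refl | simp)+
  have alg: "2 * (R / (p - 1) * d) * C + S * (2 * R) = 2 * R / (p - 1) * ((p - 1) * S + C * d)" for R d
    using assms by (simp add: field_simps)
  have eq: "2 * (curve_radius p y / (p - 1) * ?d) * cosh y + sinh y * (2 * curve_radius p y)
      = 2 * curve_radius p y / (p - 1) * ((p - 1) * S + C * ?d)"
    unfolding C_def[symmetric] S_def[symmetric] using alg .
  have "2 * curve_radius p y / (p - 1) * ((p - 1) * S + C * ?d) < 0"
    using neg assms curve_radius_pos[of p y] by (intro mult_pos_neg) auto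
  then show ?thesis using d unfolding eq by blast
qed

lemma curve_sum_strict_decreasing:
  assumes "1 < p" "0 \<le> y" "y < z"
  shows "curve_sum p z < curve_sum p y"
proof (rule DERIV_neg_imp_decreasing_open[OF assms(3)])
  fix x assume "y < x" "x < z"
  then have "0 < x" using assms by simp
  then show "\<exists>l. DERIV (curve_sum p) x :> l \<and> l < 0"
    using curve_sum_deriv_neg[OF assms(1), of x] by blast
next
  show "continuous_on {y..z} (curve_sum p)"
    by (rule continuous_on_subset[OF continuous_on_curve_sum]) (use assms in auto)
qed

definition curve_energy :: "real \<Rightarrow> real \<Rightarrow> real \<Rightarrow> real" where
  "curve_energy p \<tau> y = pair_energy p \<tau> (curve_radius p y * exp (- y)) (curve_radius p y * exp y)"

lemma curve_sum_eq: "curve_sum p y = curve_radius p y * exp (- y) + curve_radius p y * exp y"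
  by (simp add: curve_sum_def cosh_field_def field_simps)

lemma continuous_on_pair_energy:
  assumes "1 < p" "continuous_on A f" "continuous_on A g" "\<And>x. x \<in> A \<Longrightarrow> 0 \<le> f x" "\<And>x. x \<in> A \<Longrightarrow> 0 \<le> g x"
  shows "continuous_on A (\<lambda>x. pair_energy p \<tau> (f x) (g x))"
  unfolding pair_energy_def using assms
  by (intro continuous_intros continuous_on_compose2[OF continuous_on_decay_int[OF assms(1)]]) auto

lemma continuous_on_curve_energy:
  assumes "1 < p"
  shows "continuous_on {0..} (curve_energy p \<tau>)"
  unfolding curve_energy_def
  using assms curve_radius_pos[OF assms] by (intro continuous_on_pair_energy continuous_intros) (auto intro: less_imp_le)

text \<open>
  Both partial derivatives of \<open>pair_energy\<close> coincide on the curve, so only the derivative of the sum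
  of the coordinates enters.
\<close>

lemma has_real_derivative_curve_energy:
  assumes "1 < p" "0 < y" "(curve_sum p has_real_derivative l) (at y)"
  shows "(curve_energy p \<tau> has_real_derivative
    2 * l * curve_radius p y * (curve_slope p y - 2 * \<tau> * cosh y)) (at y)"
proof -
  obtain r where r: "(curve_radius p has_real_derivative r) (at y)"
    using has_real_derivative_curve_radius[OF assms(1,2)] by blast
  let ?a = "\<lambda>y. curve_radius p y * exp (- y)" and ?b = "\<lambda>y. curve_radius p y * exp y"
  obtain a b where a: "(?a has_real_derivative a) (at y)" and b: "(?b has_real_derivative b) (at y)"
  proof -
    have "\<exists>a. (?a has_real_derivative a) (at y)" "\<exists>b. (?b has_real_derivative b) (at y)"
      by (rule exI, (rule derivative_eq_intros r refl)+)+
    then show thesis using that by blast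
  qed
  have "(curve_sum p has_real_derivative a + b) (at y)"
    unfolding curve_sum_eq[abs_def] using a b by (rule DERIV_add)
  then have l: "l = a + b" using assms(3) DERIV_unique by blast
  have pos: "0 < ?a y" "0 < ?b y" using curve_radius_pos assms by auto
  have Wa: "decay p (?a y) = curve_radius p y * curve_slope p y"
   and Wb: "decay p (?b y) = curve_radius p y * curve_slope p y"
    using decay_curve[OF assms(1,2), of "-1"] decay_curve[OF assms(1,2), of 1] by simp_all
  have "((\<lambda>y. decay_int p (?a y)) has_real_derivative decay p (?a y) * a) (at y)"
    by (rule DERIV_chain2[OF has_real_derivative_decay_int[OF assms(1) pos(1)] a])
  moreover have "((\<lambda>y. decay_int p (?b y)) has_real_derivative decay p (?b y) * b) (at y)"
    by (rule DERIV_chain2[OF has_real_derivative_decay_int[OF assms(1) pos(2)] b])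
  moreover have "((\<lambda>y. (?a y + ?b y)\<^sup>2) has_real_derivative 2 * (?a y + ?b y) * (a + b)) (at y)"
    by (rule derivative_eq_intros a b refl | simp)+
  ultimately have "(curve_energy p \<tau> has_real_derivative
     2 * (decay p (?a y) * a) + 2 * (decay p (?b y) * b) - \<tau> * (2 * (?a y + ?b y) * (a + b))) (at y)"
    unfolding curve_energy_def[abs_def] pair_energy_def
    by (intro DERIV_diff DERIV_add DERIV_cmult)
  moreover have sum: "?a y + ?b y = 2 * curve_radius p y * cosh y"
    using curve_sum_eq[of p y] by (simp add: curve_sum_def)
  ultimately show ?thesis unfolding Wa Wb l sum by (simp add: algebra_simps)
qed

text \<open>
  Hence \<open>curve_slope p y / cosh y\<close> takes the value \<open>2 * \<tau>\<close> at most once.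
\<close>

lemma curve_slope_cosh_less:
  assumes "1 < p" "0 \<le> y" "y < z"
  shows "curve_slope p z * cosh y < curve_slope p y * cosh z"
proof -
  have "curve_slope p z < curve_slope p y"
    unfolding curve_slope_def using assms sinh_ratio_strict_decreasing[of "p - 1" "p + 1" y z] by simp
  moreover have "cosh y \<le> cosh z" using assms by (simp add: cosh_real_nonneg_le_iff)
  ultimately show ?thesis
    using curve_slope_pos[of p z] assms by (intro mult_less_le_imp_less) auto
qed

lemma curve_energy_less:
  assumes "1 < p" "0 \<le> y" "y < z"
    and "\<And>x. y < x \<Longrightarrow> x < z \<Longrightarrow> curve_slope p x < 2 * \<tau> * cosh x"
  shows "curve_energy p \<tau> y < curve_energy p \<tau> z"
proof (rule DERIV_pos_imp_increasing_open[OF assms(3)])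
  fix x assume x: "y < x" "x < z"
  then have x0: "0 < x" using assms by simp
  then obtain l where l: "l < 0" "(curve_sum p has_real_derivative l) (at x)"
    using curve_sum_deriv_neg[OF assms(1)] by blast
  have "0 < 2 * l * curve_radius p x * (curve_slope p x - 2 * \<tau> * cosh x)"
    using l curve_radius_pos[OF assms(1), of x] x0 assms(4)[OF x]
    by (intro mult_neg_neg) (auto simp: mult_less_0_iff)
  then show "\<exists>k. DERIV (curve_energy p \<tau>) x :> k \<and> k > 0"
    using has_real_derivative_curve_energy[OF assms(1) x0 l(2)] by blast
next
  show "continuous_on {y..z} (curve_energy p \<tau>)"
    by (rule continuous_on_subset[OF continuous_on_curve_energy]) (use assms in auto)
qed

lemma curve_energy_greater:
  assumes "1 < p" "0 \<le> y" "y < z"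
    and "\<And>x. y < x \<Longrightarrow> x < z \<Longrightarrow> 2 * \<tau> * cosh x < curve_slope p x"
  shows "curve_energy p \<tau> z < curve_energy p \<tau> y"
proof (rule DERIV_neg_imp_decreasing_open[OF assms(3)])
  fix x assume x: "y < x" "x < z"
  then have x0: "0 < x" using assms by simp
  then obtain l where l: "l < 0" "(curve_sum p has_real_derivative l) (at x)"
    using curve_sum_deriv_neg[OF assms(1)] by blast
  have "2 * l * curve_radius p x < 0"
    using l curve_radius_pos[OF assms(1), of x] x0 by (simp add: mult_less_0_iff)
  then have "2 * l * curve_radius p x * (curve_slope p x - 2 * \<tau> * cosh x) < 0"
    by (rule mult_neg_pos) (use assms(4)[OF x] in simp)
  then show "\<exists>k. DERIV (curve_energy p \<tau>) x :> k \<and> k < 0"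
    using has_real_derivative_curve_energy[OF assms(1) x0 l(2)] by blast
next
  show "continuous_on {y..z} (curve_energy p \<tau>)"
    by (rule continuous_on_subset[OF continuous_on_curve_energy]) (use assms in auto)
qed

section \<open>Min-max over rays\<close>

text \<open>
  By symmetry a ray with both coordinates positive has the form \<open>(q * exp (- y), q * exp y)\<close> with
  \<open>y \<ge> 0\<close>. A ray on an axis is compared with the ray for a large \<open>y\<close> by means of \<open>pair_energy_axis\<close>.
\<close>

lemma ray_above_level_if_hyperbolic:
  assumes "1 < p" "0 < \<tau>"
    and H: "\<And>y. 0 \<le> y \<Longrightarrow> \<exists>q>0. q * exp y \<le> 1 \<and>
      (E < pair_energy p \<tau> (q * exp (- y)) (q * exp y) \<or> y = y0 \<and> q = q0)"
    and AB: "0 \<le> A" "0 \<le> B" "0 < A + B"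
  shows "\<exists>s>0. s * A \<le> 1 \<and> s * B \<le> 1 \<and> (E < pair_energy p \<tau> (s * A) (s * B) \<or>
     s * A = q0 * exp (- y0) \<and> s * B = q0 * exp y0 \<or> s * A = q0 * exp y0 \<and> s * B = q0 * exp (- y0))"
proof -
  have ordered: "\<exists>s>0. s * A \<le> 1 \<and> s * B \<le> 1 \<and> (E < pair_energy p \<tau> (s * A) (s * B) \<or>
     s * A = q0 * exp (- y0) \<and> s * B = q0 * exp y0)"
    if le: "A \<le> B" "0 \<le> A" "0 < B" for A B
  proof (cases "A = 0")
    case True
    \<comment> \<open>Large enough for \<open>pair_energy_axis\<close>, and different from the exceptional parameter \<open>y0\<close>.\<close>
    define y where "y = max (\<bar>y0\<bar> + 1) (\<bar>ln ((1 - \<tau>) / (2 * \<tau>))\<bar>)"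
    have y: "0 \<le> y" "y \<noteq> y0" by (auto simp: y_def)
    obtain q where q: "0 < q" "q * exp y \<le> 1" "E < pair_energy p \<tau> (q * exp (- y)) (q * exp y)"
      using H[OF y(1)] y(2) by blast
    have "1 - \<tau> \<le> 2 * \<tau> * exp (2 * y)"
    proof (cases "\<tau> < 1")
      case True
      have "\<bar>ln ((1 - \<tau>) / (2 * \<tau>))\<bar> \<le> y" by (simp add: y_def)
      then have "ln ((1 - \<tau>) / (2 * \<tau>)) \<le> 2 * y" using y by linarith
      then have "exp (ln ((1 - \<tau>) / (2 * \<tau>))) \<le> exp (2 * y)" by simp
      then show ?thesis using True assms(2) by (simp add: field_simps)
    next
      case False
      have "0 \<le> 2 * \<tau> * exp (2 * y)" using assms(2) by simp
      then show ?thesis using False by linarith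
    qed
    then have "q * exp (- y) * (1 - \<tau>) \<le> q * exp (- y) * (2 * \<tau> * exp (2 * y))"
      using q(1) by (intro mult_left_mono) auto
    also have "exp (- y) * exp (2 * y) = exp y" by (simp flip: exp_add)
    then have "q * exp (- y) * (2 * \<tau> * exp (2 * y)) = 2 * \<tau> * (q * exp y)" by (simp add: mult_ac)
    finally have "E < pair_energy p \<tau> 0 (q * exp y)"
      using pair_energy_axis[of p "q * exp (- y)" "q * exp y" \<tau>] q assms by simp
    then show ?thesis using q le True
      by (intro exI[of _ "q * exp y / B"]) simp
  next
    case False
    then have A: "0 < A" using le by simp
    define y where "y = ln (B / A) / 2"
    have y: "0 \<le> y" using A le by (simp add: y_def)
    have e: "exp y = sqrt B / sqrt A"
    proof -
      have "(exp y)\<^sup>2 = B / A" using A le by (simp add: y_def power2_eq_square flip: exp_add)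
      then show ?thesis by (simp flip: real_sqrt_divide) (metis exp_ge_zero real_sqrt_unique)
    qed
    obtain q where q: "0 < q" "q * exp y \<le> 1"
      "E < pair_energy p \<tau> (q * exp (- y)) (q * exp y) \<or> y = y0 \<and> q = q0"
      using H[OF y] by blast
    have sA: "q / sqrt (A * B) * A = q * exp (- y)" and sB: "q / sqrt (A * B) * B = q * exp y"
      using A le by (simp_all add: exp_minus e real_sqrt_mult field_simps)
    have "q * exp (- y) \<le> q * exp y" using q y by simp
    then have "q * exp (- y) \<le> 1" using q by linarith
    then show ?thesis using q A le
      by (intro exI[of _ "q / sqrt (A * B)"] conjI; (unfold sA sB)?) auto
  qed
  show ?thesis
  proof (cases "A \<le> B")
    case True then show ?thesis using ordered[of A B] AB by force
  next
    case False
    then obtain s where "s > 0" "s * B \<le> 1" "s * A \<le> 1"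
      "E < pair_energy p \<tau> (s * B) (s * A) \<or> s * B = q0 * exp (- y0) \<and> s * A = q0 * exp y0"
      using ordered[of B A] AB by force
    then show ?thesis by (auto simp: pair_energy_commute[of p \<tau> "s * A"])
  qed
qed

lemma curve_radius_0_le: "1 < p \<Longrightarrow> curve_radius p 0 \<le> 1"
  by (simp add: curve_radius_def sinh_ratio_def powr_le_one_le powr_mono2[of _ _ 1, simplified])

text \<open>
  The curve provides the point on each ray: the energy along it decreases for \<open>y < y0\<close> and increases
  for \<open>y > y0\<close>.
\<close>

theorem asymmetric_minmax:
  assumes "1 < p" "0 < \<tau>" "0 < y0" "curve_slope p y0 = 2 * \<tau> * cosh y0"
    and "0 \<le> A" "0 \<le> B" "0 < A + B"
  defines "a \<equiv> curve_radius p y0 * exp (- y0)" and "b \<equiv> curve_radius p y0 * exp y0"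
  shows "\<exists>s>0. s * A \<le> 1 \<and> s * B \<le> 1 \<and> (pair_energy p \<tau> a b < pair_energy p \<tau> (s * A) (s * B) \<or>
     s * A = a \<and> s * B = b \<or> s * A = b \<and> s * B = a)"
  unfolding a_def b_def
proof (rule ray_above_level_if_hyperbolic[OF assms(1,2) _ assms(5-7)])
  fix y :: real assume y: "0 \<le> y"
  have le1: "curve_radius p y * exp y \<le> 1"
    using curve_le_1[OF assms(1), of y 1] curve_radius_0_le[OF assms(1)] y by (cases "y = 0") auto
  have below: "2 * \<tau> * cosh x < curve_slope p x" if "0 \<le> x" "x < y0" for x
  proof -
    have "2 * \<tau> * cosh x * cosh y0 < curve_slope p x * cosh y0"
      using curve_slope_cosh_less[OF assms(1) that] assms(4) by (simp add: mult_ac)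
    then show ?thesis by simp
  qed
  have above: "curve_slope p x < 2 * \<tau> * cosh x" if "y0 < x" for x
  proof -
    have "curve_slope p x * cosh y0 < 2 * \<tau> * cosh x * cosh y0"
      using curve_slope_cosh_less[OF assms(1) _ that] assms(3,4) by (simp add: mult_ac)
    then show ?thesis by simp
  qed
  have "curve_energy p \<tau> y0 < curve_energy p \<tau> y" if "y \<noteq> y0"
    using curve_energy_less[OF assms(1), of y0 y \<tau>] curve_energy_greater[OF assms(1) y, of y0 \<tau>]
      below above that y assms(3) by (cases y y0 rule: linorder_cases) auto
  then show "\<exists>q>0. q * exp y \<le> 1 \<and>
      (pair_energy p \<tau> (curve_radius p y0 * exp (- y0)) (curve_radius p y0 * exp y0)
        < pair_energy p \<tau> (q * exp (- y)) (q * exp y) \<or> y = y0 \<and> q = curve_radius p y0)"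
    using le1 curve_radius_pos[OF assms(1) y] unfolding curve_energy_def
    by (intro exI[of _ "curve_radius p y"]) auto
qed

text \<open>
  On an antidiagonal the coupling term is constant, and below the curve the larger coordinate has the
  larger decay. So the energy grows when the coordinates move apart.
\<close>

lemma antidiagonal_less:
  assumes "1 < p" "0 < a0" "0 < y" "2 * a0 \<le> curve_sum p y"
  shows "pair_energy p \<tau> a0 a0 < pair_energy p \<tau> (a0 / cosh y * exp (- y)) (a0 / cosh y * exp y)"
proof -
  let ?a = "\<lambda>z. a0 / cosh z * exp (- z)" and ?b = "\<lambda>z. a0 / cosh z * exp z"
  have sum: "?a z + ?b z = 2 * a0" for z
  proof -
    have "?a z + ?b z = a0 / cosh z * (2 * cosh z)"
      unfolding cosh_field_def[of z] by (simp add: algebra_simps)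
    then show ?thesis by simp
  qed
  define h where "h z = decay_int p (?a z) + decay_int p (?b z)" for z
  have "h 0 < h y"
  proof (rule DERIV_pos_imp_increasing_open[OF assms(3)])
    fix z assume z: "0 < z" "z < y"
    have ce: "cosh z + sinh z = exp z" "cosh z - sinh z = exp (- z)"
      by (simp_all add: cosh_plus_sinh cosh_minus_sinh)
    have b: "(?b has_real_derivative a0 / (cosh z)\<^sup>2) (at z)"
    proof -
      have "(?b has_real_derivative a0 * exp z * (cosh z - sinh z) / (cosh z)\<^sup>2) (at z)"
        by (auto intro!: derivative_eq_intros simp: field_simps power2_eq_square)
      then show ?thesis unfolding ce by (simp flip: exp_add add: mult.assoc)
    qed
    have "(\<lambda>z. 2 * a0 - ?b z) = ?a" using sum by (simp add: fun_eq_iff algebra_simps)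
    then have a: "(?a has_real_derivative - (a0 / (cosh z)\<^sup>2)) (at z)"
      using DERIV_diff[OF DERIV_const[of "2 * a0"] b] by simp
    have pos: "0 < ?a z" "0 < ?b z" using assms by auto
    have "(h has_real_derivative decay p (?a z) * (- (a0 / (cosh z)\<^sup>2)) + decay p (?b z) * (a0 / (cosh z)\<^sup>2)) (at z)"
      unfolding h_def
      by (intro DERIV_add DERIV_chain2[OF has_real_derivative_decay_int[OF assms(1) pos(1)] a]
          DERIV_chain2[OF has_real_derivative_decay_int[OF assms(1) pos(2)] b])
    moreover have "decay p (?a z) < decay p (?b z)"
    proof (rule decay_below_curve[OF assms(1) z(1)])
      have "2 * a0 < 2 * curve_radius p z * cosh z"
        using curve_sum_strict_decreasing[OF assms(1), of z y] z assms(4) by (simp add: curve_sum_def)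
      then show "a0 / cosh z < curve_radius p z" by (simp add: pos_divide_less_eq)
    qed (use assms in auto)
    then have "0 < (decay p (?b z) - decay p (?a z)) * (a0 / (cosh z)\<^sup>2)"
      using assms by (intro mult_pos_pos) auto
    then have "0 < decay p (?a z) * (- (a0 / (cosh z)\<^sup>2)) + decay p (?b z) * (a0 / (cosh z)\<^sup>2)"
      unfolding left_diff_distrib by linarith
    ultimately show "\<exists>k. DERIV h z :> k \<and> k > 0" by blast
  next
    show "continuous_on {0..y} h"
      unfolding h_def using assms
      by (intro continuous_intros continuous_on_compose2[OF continuous_on_decay_int[OF assms(1)]]) auto
  qed
  then show ?thesis using sum[of y] by (simp add: pair_energy_def h_def)
qed

text \<open>
  In this regime the energy grows along the whole curve away from the diagonal, but the critical point
  \<open>(a, a)\<close> does not lie beyond the curve on the diagonal. Starting at \<open>(a, a)\<close>, the points are chosen on the antidiagonal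
  as long as it stays below the curve, and on the curve afterwards; the energy grows all the way.
\<close>

theorem symmetric_minmax:
  assumes "1 < p" "0 < \<tau>" "\<tau> < 1/2" "(p - 1) / (p + 1) \<le> 4 * \<tau>\<^sup>2"
    and "0 \<le> A" "0 \<le> B" "0 < A + B"
  defines "a \<equiv> (1 - 4 * \<tau>\<^sup>2) powr (1 / (p - 1))"
  shows "\<exists>s>0. s * A \<le> 1 \<and> s * B \<le> 1 \<and> (pair_energy p \<tau> a a < pair_energy p \<tau> (s * A) (s * B) \<or>
     s * A = a \<and> s * B = a)"
proof -
  have "(2 * \<tau>)\<^sup>2 < 1\<^sup>2" using assms(2,3) by (intro power_strict_mono) auto
  then have t: "0 < 1 - 4 * \<tau>\<^sup>2" by (simp add: power_mult_distrib)
  have a: "0 < a" "a \<le> 1"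
    using t assms(1) powr_mono2[of "1 / (p - 1)" "1 - 4 * \<tau>\<^sup>2" 1] by (auto simp: a_def)
  have "1 - 4 * \<tau>\<^sup>2 \<le> 2 / (p + 1)" using assms(1,4) by (simp add: field_simps)
  then have a_le: "a \<le> curve_radius p 0"
    using t assms(1) by (simp add: a_def curve_radius_def sinh_ratio_def powr_mono2)
  have "curve_slope p 0 \<le> 2 * \<tau>"
  proof -
    have "curve_slope p 0 = sqrt ((p - 1) / (p + 1))" by (simp add: curve_slope_def sinh_ratio_def)
    also have "\<dots> \<le> sqrt ((2 * \<tau>)\<^sup>2)" using assms(4) by (intro real_sqrt_le_mono) (simp add: power_mult_distrib)
    also have "\<dots> = 2 * \<tau>" using assms(2) by (subst real_sqrt_abs) simp
    finally show ?thesis .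
  qed
  then have "curve_slope p 0 * cosh x \<le> 2 * \<tau> * cosh x" for x :: real
    by (rule mult_right_mono) simp
  then have above: "curve_slope p x < 2 * \<tau> * cosh x" if "0 < x" for x
    using curve_slope_cosh_less[OF assms(1) _ that] by (simp add: order_less_le_trans)
  have incr: "curve_energy p \<tau> y < curve_energy p \<tau> z" if "0 \<le> y" "y < z" for y z
    using curve_energy_less[OF assms(1) that] above that by simp
  have "\<exists>s>0. s * A \<le> 1 \<and> s * B \<le> 1 \<and> (pair_energy p \<tau> a a < pair_energy p \<tau> (s * A) (s * B) \<or>
     s * A = a * exp (- 0) \<and> s * B = a * exp 0 \<or> s * A = a * exp 0 \<and> s * B = a * exp (- 0))"
  proof (rule ray_above_level_if_hyperbolic[OF assms(1,2) _ assms(5-7)])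
    fix y :: real assume y: "0 \<le> y"
    consider "y = 0" | "0 < y" "2 * a \<le> curve_sum p y" | "0 < y" "curve_sum p y < 2 * a" using y by linarith
    then show "\<exists>q>0. q * exp y \<le> 1 \<and>
      (pair_energy p \<tau> a a < pair_energy p \<tau> (q * exp (- y)) (q * exp y) \<or> y = 0 \<and> q = a)"
    proof cases
      case 1 then show ?thesis using a by auto
    next
      case 2
      have "a / cosh y \<le> curve_radius p y" using 2 by (simp add: curve_sum_def pos_divide_le_eq)
      then have "a / cosh y * exp y \<le> curve_radius p y * exp y" by (intro mult_right_mono) auto
      also have "\<dots> \<le> 1" using curve_le_1[OF assms(1) 2(1), of 1] by simp
      finally show ?thesis
        using antidiagonal_less[OF assms(1) a(1) 2] a by (intro exI[of _ "a / cosh y"]) auto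
    next
      case 3
      have "2 * a \<le> curve_sum p 0" using a_le by (simp add: curve_sum_def)
      moreover have "continuous_on {0..y} (curve_sum p)"
        by (rule continuous_on_subset[OF continuous_on_curve_sum[OF assms(1)]]) auto
      ultimately obtain y1 where y1: "0 \<le> y1" "y1 \<le> y" "curve_sum p y1 = 2 * a"
        using IVT2'[of "curve_sum p" y "2 * a" 0] 3 by auto
      then have "y1 < y" using 3 by (cases "y1 = y") auto
      have r: "curve_radius p y1 = a / cosh y1" using y1 by (simp add: curve_sum_def field_simps)
      have "pair_energy p \<tau> a a \<le> curve_energy p \<tau> y1"
        using antidiagonal_less[OF assms(1) a(1), of y1 \<tau>] y1 unfolding curve_energy_def r
        by (cases "y1 = 0") auto
      also have "\<dots> < curve_energy p \<tau> y" using incr[OF y1(1) \<open>y1 < y\<close>] .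
      finally show ?thesis
        using curve_le_1[OF assms(1) 3(1), of 1] curve_radius_pos[OF assms(1) y] unfolding curve_energy_def
        by (intro exI[of _ "curve_radius p y"]) auto
    qed
  qed
  then show ?thesis by simp
qed

section \<open>The algebraic system for the asymmetric profile\<close>

lemma continuous_on_curve_slope [continuous_intros]:
  assumes "1 < p"
  shows "continuous_on A (curve_slope p)"
  unfolding curve_slope_def using assms by (intro continuous_intros) auto

lemma curve_slope_le_1:
  assumes "1 < p" "0 \<le> y"
  shows "curve_slope p y \<le> 1"
proof -
  have "sinh_ratio (p - 1) (p + 1) y \<le> sinh_ratio (p - 1) (p + 1) 0"
    using sinh_ratio_strict_decreasing[of "p - 1" "p + 1" 0 y] assms by (cases "y = 0") auto
  also have "\<dots> \<le> 1" using assms by (simp add: sinh_ratio_def)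
  finally show ?thesis by (simp add: curve_slope_def)
qed

text \<open>
  The condition says that \<open>2 * \<tau>\<close> lies below the value of \<open>curve_slope p y / cosh y\<close> at \<open>0\<close>, and this
  quotient tends to \<open>0\<close>.
\<close>

lemma bifurcation_parameter_ex1:
  assumes "1 < p" "0 < \<tau>" "4 * \<tau>\<^sup>2 < (p - 1) / (p + 1)"
  shows "\<exists>!y. 0 < y \<and> curve_slope p y = 2 * \<tau> * cosh y"
proof -
  have 0: "2 * \<tau> < curve_slope p 0"
    unfolding curve_slope_def
    by (rule real_less_rsqrt) (use assms(3) in \<open>simp add: power_mult_distrib sinh_ratio_def\<close>)
  define Y where "Y = 1 / (2 * \<tau>)"
  have Y: "0 < Y" using assms by (simp add: Y_def)
  have "Y \<le> cosh Y" using real_le_x_sinh[of Y] Y sinh_le_cosh_real[of Y] by (simp add: sinh_field_def exp_minus)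
  then have "1 \<le> 2 * \<tau> * cosh Y" using assms(2) by (simp add: Y_def field_simps)
  then have 1: "curve_slope p Y \<le> 2 * \<tau> * cosh Y"
    using curve_slope_le_1[OF assms(1), of Y] Y by simp
  have "\<exists>x\<ge>0. x \<le> Y \<and> curve_slope p x - 2 * \<tau> * cosh x = 0"
    using assms Y 0 1 by (intro IVT2' continuous_intros) auto
  then obtain y where y: "0 \<le> y" "curve_slope p y = 2 * \<tau> * cosh y" by auto
  with 0 have "0 < y" by (cases "y = 0") auto
  moreover have False if "0 \<le> x" "x < z" "curve_slope p x = 2 * \<tau> * cosh x" "curve_slope p z = 2 * \<tau> * cosh z" for x z
    using curve_slope_cosh_less[OF assms(1) that(1,2)] that(3,4) by simp
  ultimately show ?thesis using y
    by (intro ex1I[of _ y]) (auto, metis less_eq_real_def linorder_neqE_linordered_idom)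
qed

text \<open>
  Divided by \<open>q powr (p - 1)\<close>, the equation is \<open>sinh ((p - 1) * y) = q^2 * sinh ((p + 1) * y)\<close>.
\<close>

lemma asym_balance_iff:
  assumes "1 < p" "0 < y" "0 < q"
  shows "(q * exp (- y)) powr (p - 1) - (q * exp (- y)) powr (p + 1)
      = (q * exp y) powr (p - 1) - (q * exp y) powr (p + 1) \<longleftrightarrow> q = curve_slope p y"
proof -
  have pe: "exp x powr r = exp (r * x)" for x r :: real by (simp add: powr_def)
  have q2: "q powr (p + 1) = q powr (p - 1) * q\<^sup>2"
  proof -
    have "p + 1 = p - 1 + 2" by simp
    then have "q powr (p + 1) = q powr (p - 1 + 2)" by (rule arg_cong)
    also have "\<dots> = q powr (p - 1) * q powr 2" by (rule powr_add)
    finally show ?thesis using assms(3) by simp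
  qed
  have s: "0 < sinh ((p + 1) * y)" "0 < sinh ((p - 1) * y)" using assms by auto
  have "((q * exp y) powr (p - 1) - (q * exp y) powr (p + 1))
      - ((q * exp (- y)) powr (p - 1) - (q * exp (- y)) powr (p + 1))
      = 2 * q powr (p - 1) * (sinh ((p - 1) * y) - q\<^sup>2 * sinh ((p + 1) * y))"
    using assms by (simp add: powr_mult pe q2 sinh_field_def) (simp add: algebra_simps diff_divide_distrib)
  then have "(q * exp (- y)) powr (p - 1) - (q * exp (- y)) powr (p + 1)
      = (q * exp y) powr (p - 1) - (q * exp y) powr (p + 1) \<longleftrightarrow>
      2 * q powr (p - 1) * (sinh ((p - 1) * y) - q\<^sup>2 * sinh ((p + 1) * y)) = 0" by linarith
  also have "\<dots> \<longleftrightarrow> q\<^sup>2 = sinh_ratio (p - 1) (p + 1) y"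
    using assms s by (auto simp: sinh_ratio_def field_simps)
  also have "\<dots> \<longleftrightarrow> q = curve_slope p y"
    using assms sinh_ratio_pos[of "p - 1" "p + 1" y]
    by (auto simp: curve_slope_def) (metis less_eq_real_def real_sqrt_unique)
  finally show ?thesis .
qed

text \<open>
  With \<open>t1 = q * exp (- y)\<close> and \<open>tN = q * exp y\<close> the first equation of the system determines \<open>q\<close> by
  \<open>asym_balance_iff\<close>, and the second one becomes \<open>q = 2 * \<tau> * cosh y\<close>. That \<open>tN < 1\<close> is then automatic.
\<close>

lemma asym_system_iff:
  fixes N :: nat
  assumes "1 < p" "0 < N" "\<beta> \<noteq> 0" "0 < \<omega>" and \<tau>: "\<tau> = real N / (2 * \<bar>\<beta>\<bar> * sqrt \<omega>)"
  shows "asym_system p \<beta> \<omega> N t1 tN \<longleftrightarrow>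
    (\<exists>y>0. curve_slope p y = 2 * \<tau> * cosh y \<and> t1 = curve_slope p y * exp (- y) \<and> tN = curve_slope p y * exp y)"
proof -
  have sum: "real N / 2 * inverse (q * exp (- y)) + real N / 2 * inverse (q * exp y) = \<bar>\<beta>\<bar> * sqrt \<omega>
    \<longleftrightarrow> q = 2 * \<tau> * cosh y" if "0 < q" for q y :: real
  proof -
    have eq: "real N / 2 * inverse (q * exp (- y)) + real N / 2 * inverse (q * exp y) = real N * cosh y / q"
      using that by (simp add: cosh_field_def field_simps exp_minus)
    have N: "real N = 2 * \<tau> * (\<bar>\<beta>\<bar> * sqrt \<omega>)" using assms by simp
    have B: "2 * \<tau> * B * cosh y / q = B \<longleftrightarrow> q = 2 * \<tau> * cosh y" if "B \<noteq> 0" for B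
      using that \<open>0 < q\<close> by (auto simp: field_simps)
    have "\<bar>\<beta>\<bar> * sqrt \<omega> \<noteq> 0" using assms by simp
    from B[OF this] show ?thesis unfolding eq by (simp only: N)
  qed
  show ?thesis
  proof
    assume L: "asym_system p \<beta> \<omega> N t1 tN"
    then have t: "0 < t1" "t1 < tN" by (auto simp: asym_system_def)
    define y where "y = ln (tN / t1) / 2"
    define q where "q = sqrt (t1 * tN)"
    have y: "0 < y" and q: "0 < q" using t by (auto simp: y_def q_def)
    have "(exp y)\<^sup>2 = tN / t1" using t by (simp add: y_def power2_eq_square flip: exp_add)
    then have e: "exp y = sqrt tN / sqrt t1"
      by (simp flip: real_sqrt_divide) (metis exp_ge_zero real_sqrt_unique)
    have t1: "t1 = q * exp (- y)" and tN: "tN = q * exp y"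
      using t by (simp_all add: q_def exp_minus e real_sqrt_mult)
    have qs: "q = curve_slope p y"
      using L asym_balance_iff[OF assms(1) y q] unfolding asym_system_def t1 tN by blast
    moreover have "q = 2 * \<tau> * cosh y"
      using L sum[OF q] unfolding asym_system_def t1 tN by blast
    ultimately show "\<exists>y>0. curve_slope p y = 2 * \<tau> * cosh y \<and> t1 = curve_slope p y * exp (- y) \<and> tN = curve_slope p y * exp y"
      using y t1 tN by metis
  next
    assume "\<exists>y>0. curve_slope p y = 2 * \<tau> * cosh y \<and> t1 = curve_slope p y * exp (- y) \<and> tN = curve_slope p y * exp y"
    then obtain y where y: "0 < y" "curve_slope p y = 2 * \<tau> * cosh y"
      and t1: "t1 = curve_slope p y * exp (- y)" and tN: "tN = curve_slope p y * exp y" by blast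
    have q: "0 < curve_slope p y" using curve_slope_pos assms y by simp
    have "0 < (curve_radius p y * exp ((- 1) * y)) powr (p - 1)"
      using curve_radius_pos[of p y] assms y by simp
    then have "tN\<^sup>2 < 1"
      using curve_height[OF assms(1) y(1), of "-1"] by (simp add: tN mult.commute del: powr_gt_zero)
    then have "tN < 1" by (simp add: abs_square_less_1 abs_less_iff)
    then show "asym_system p \<beta> \<omega> N t1 tN"
      unfolding asym_system_def using q y(1) y(2)[symmetric] asym_balance_iff[OF assms(1) y(1) q] sum[OF q, of y]
      by (simp add: t1 tN)
  qed
qed

section \<open>The chain rule for absolutely continuous functions\<close>

text \<open>
  Absolute continuity, in the form of an integral of an integrable function.
\<close>

definition primitive_on :: "(real \<Rightarrow> 'a::euclidean_space) \<Rightarrow> (real \<Rightarrow> 'a) \<Rightarrow> real \<Rightarrow> real \<Rightarrow> bool" where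
  "primitive_on w g a b \<longleftrightarrow> g absolutely_integrable_on {a..b} \<and> (\<forall>x\<in>{a..b}. w x = w a + integral {a..x} g)"

text \<open>
  On a fine subdivision the increments of \<open>H\<close> are at most \<open>\<epsilon>\<close> times those of \<open>M\<close>. They add up to
  \<open>\<bar>H b - H a\<bar> \<le> \<epsilon> * (M b - M a)\<close>, and \<open>\<epsilon>\<close> is arbitrary.
\<close>

lemma dominated_increment_eq_0:
  fixes H M :: "real \<Rightarrow> real"
  assumes "a \<le> b"
    and loc: "\<And>\<epsilon>. 0 < \<epsilon> \<Longrightarrow> \<exists>\<delta>>0. \<forall>x y. a \<le> x \<and> x \<le> y \<and> y \<le> b \<and> y - x < \<delta> \<longrightarrow> \<bar>H y - H x\<bar> \<le> \<epsilon> * (M y - M x)"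
  shows "H b = H a"
proof -
  have glob: "\<bar>H b - H a\<bar> \<le> \<epsilon> * (M b - M a)" if "0 < \<epsilon>" for \<epsilon>
  proof -
    obtain \<delta> where \<delta>: "0 < \<delta>" and
      *: "\<And>x y. a \<le> x \<Longrightarrow> x \<le> y \<Longrightarrow> y \<le> b \<Longrightarrow> y - x < \<delta> \<Longrightarrow> \<bar>H y - H x\<bar> \<le> \<epsilon> * (M y - M x)"
      using loc[OF \<open>0 < \<epsilon>\<close>] by blast
    \<comment> \<open>The interval is cut into \<open>n\<close> pieces of length less than \<open>\<delta>\<close>.\<close>
    obtain n :: nat where n: "(b - a) / \<delta> < real n" using reals_Archimedean2 by blast
    have "0 < real n" using n assms(1) \<delta> by (meson diff_ge_0_iff_ge divide_nonneg_pos le_less_trans)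
    define h where "h = (b - a) / real n"
    have h: "0 \<le> h" "h < \<delta>" "a + real n * h = b"
      using n assms(1) \<delta> \<open>0 < real n\<close> by (auto simp: h_def field_simps)
    have "\<bar>H (a + real k * h) - H a\<bar> \<le> \<epsilon> * (M (a + real k * h) - M a)" if "k \<le> n" for k
      using that
    proof (induction k)
      case (Suc k)
      have "real (Suc k) * h \<le> real n * h" using Suc.prems h(1) by (intro mult_right_mono) auto
      then have "a + real (Suc k) * h \<le> b" using h(3) by linarith
      moreover have "0 \<le> real k * h" using h(1) by simp
      ultimately have "\<bar>H (a + real (Suc k) * h) - H (a + real k * h)\<bar>
         \<le> \<epsilon> * (M (a + real (Suc k) * h) - M (a + real k * h))"
        using h by (intro *) (auto simp: algebra_simps)
      then show ?case using Suc by (simp add: algebra_simps)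
    qed simp
    from this[of n] show ?thesis using h(3) by simp
  qed
  show ?thesis
  proof (rule ccontr)
    assume "H b \<noteq> H a"
    then have pos: "0 < \<bar>H b - H a\<bar>" by simp
    then have M: "0 < M b - M a" using glob[of 1] by simp
    then show False using glob[of "\<bar>H b - H a\<bar> / (2 * (M b - M a))"] pos by (simp add: divide_simps)
  qed
qed

lemma primitive_on_increment:
  assumes "primitive_on w g a b" "a \<le> x" "x \<le> y" "y \<le> b"
  shows "w y - w x = integral {x..y} g"
proof -
  have "g integrable_on {a..b}" using assms(1) absolutely_integrable_on_def unfolding primitive_on_def by blast
  then have "g integrable_on {a..y}" by (rule integrable_on_subinterval) (use assms in auto)
  from Henstock_Kurzweil_Integration.integral_combine[OF assms(2,3) this]
  have "integral {a..y} g = integral {a..x} g + integral {x..y} g" by simp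
  moreover have "w x = w a + integral {a..x} g" "w y = w a + integral {a..y} g"
    using assms unfolding primitive_on_def by (meson atLeastAtMost_iff order_trans)+
  ultimately show ?thesis by simp
qed

lemma primitive_on_imp_continuous:
  assumes "primitive_on w g a b"
  shows "continuous_on {a..b} w"
proof -
  have "g integrable_on {a..b}" using assms absolutely_integrable_on_def unfolding primitive_on_def by blast
  then have "continuous_on {a..b} (\<lambda>x. w a + integral {a..x} g)"
    by (intro continuous_intros indefinite_integral_continuous_1)
  moreover have "w a + integral {a..x} g = w x" if "x \<in> {a..b}" for x
    using assms that unfolding primitive_on_def by metis
  ultimately show ?thesis by (rule continuous_on_eq)
qed

lemma primitive_on_subinterval:
  assumes "primitive_on w g a b" "a \<le> c" "d \<le> b"
  shows "primitive_on w g c d"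
  unfolding primitive_on_def
proof
  have "g absolutely_integrable_on {a..b}" using assms by (simp add: primitive_on_def)
  then show "g absolutely_integrable_on {c..d}"
    by (rule absolutely_integrable_on_subinterval) (use assms in auto)
  show "\<forall>x\<in>{c..d}. w x = w c + integral {c..x} g"
    using primitive_on_increment[OF assms(1,2)] assms(3)
    by (metis add.commute atLeastAtMost_iff diff_add_cancel order_trans)
qed

lemma absolutely_integrable_inner_continuous:
  fixes f g :: "real \<Rightarrow> 'a::euclidean_space"
  assumes "continuous_on {a..b} f" "g absolutely_integrable_on {a..b}"
  shows "(\<lambda>x. f x \<bullet> g x) absolutely_integrable_on {a..b}"
proof (rule absolutely_integrable_bounded_measurable_product[where h = "(\<bullet>)"])
  show "bilinear ((\<bullet>) :: 'a \<Rightarrow> 'a \<Rightarrow> real)"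
    by (simp add: bilinear_conv_bounded_bilinear bounded_bilinear_inner)
  show "f \<in> borel_measurable (lebesgue_on {a..b})"
    by (rule continuous_imp_measurable_on_sets_lebesgue[OF assms(1)]) simp
  show "bounded (f ` {a..b})"
    by (rule compact_imp_bounded[OF compact_continuous_image[OF assms(1)]]) simp
qed (use assms in auto)

text \<open>
  On a short interval the increment of \<open>\<Psi> \<circ> w\<close> differs from the integral of \<open>D (w x) \<bullet> g x\<close> by a small
  multiple of the integral of \<open>norm g\<close>, because \<open>D\<close> is uniformly continuous on the bounded range of \<open>w\<close>. So
  \<open>dominated_increment_eq_0\<close> applies; it takes the place of differentiating \<open>w\<close> almost everywhere.
\<close>

theorem primitive_on_chain:
  fixes w g :: "real \<Rightarrow> 'a::euclidean_space" and \<Psi> :: "'a \<Rightarrow> real" and D :: "'a \<Rightarrow> 'a"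
  assumes w: "primitive_on w g a b" and "a \<le> b"
    and \<Psi>: "\<And>z. (\<Psi> has_derivative (\<lambda>h. D z \<bullet> h)) (at z)"
    and D: "continuous_on UNIV D"
  shows "((\<lambda>x. D (w x) \<bullet> g x) has_integral (\<Psi> (w b) - \<Psi> (w a))) {a..b}"
proof -
  have g: "g absolutely_integrable_on {a..b}" using w by (simp add: primitive_on_def)
  have wc: "continuous_on {a..b} w" using primitive_on_imp_continuous[OF w] .
  have Dw: "continuous_on {a..b} (\<lambda>x. D (w x))"
    by (rule continuous_on_compose2[OF D wc]) auto
  have ai: "(\<lambda>x. D (w x) \<bullet> g x) absolutely_integrable_on {a..b}"
    by (rule absolutely_integrable_inner_continuous[OF Dw g])
  have int: "(\<lambda>x. D (w x) \<bullet> g x) integrable_on {a..b}" and gi: "g integrable_on {a..b}"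
    and ni: "(\<lambda>x. norm (g x)) integrable_on {a..b}"
    using ai g absolutely_integrable_on_def by blast+
  define H where "H t = \<Psi> (w t) - integral {a..t} (\<lambda>x. D (w x) \<bullet> g x)" for t
  define M where "M t = integral {a..t} (\<lambda>x. norm (g x))" for t
  have "H b = H a"
  proof (rule dominated_increment_eq_0[where M = M, OF \<open>a \<le> b\<close>])
    fix \<epsilon> :: real assume \<epsilon>: "0 < \<epsilon>"
    have "bounded (w ` {a..b})"
      by (rule compact_imp_bounded[OF compact_continuous_image[OF wc]]) simp
    then obtain R where R: "\<And>x. x \<in> {a..b} \<Longrightarrow> w x \<in> cball 0 R"
      unfolding bounded_iff by (metis imageI mem_cball_0)
    have "uniformly_continuous_on (cball 0 R) D"
      by (intro compact_uniformly_continuous continuous_on_subset[OF D]) auto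
    then obtain \<delta>1 where \<delta>1: "0 < \<delta>1" and
      Du: "\<And>z z'. z \<in> cball 0 R \<Longrightarrow> z' \<in> cball 0 R \<Longrightarrow> dist z' z < \<delta>1 \<Longrightarrow> dist (D z') (D z) < \<epsilon> / 2"
      using \<epsilon> unfolding uniformly_continuous_on_def by (meson half_gt_zero)
    have "uniformly_continuous_on {a..b} w"
      by (intro compact_uniformly_continuous wc) auto
    then obtain \<delta> where \<delta>: "0 < \<delta>" and
      wu: "\<And>x y. x \<in> {a..b} \<Longrightarrow> y \<in> {a..b} \<Longrightarrow> dist y x < \<delta> \<Longrightarrow> dist (w y) (w x) < \<delta>1"
      using \<delta>1 unfolding uniformly_continuous_on_def by meson
    have "\<bar>H y - H x\<bar> \<le> \<epsilon> * (M y - M x)" if xy: "a \<le> x" "x \<le> y" "y \<le> b" "y - x < \<delta>" for x y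
    proof -
      have sub: "{x..y} \<subseteq> {a..b}" using xy by auto
      have i1: "(\<lambda>x. D (w x) \<bullet> g x) integrable_on {x..y}" "g integrable_on {x..y}" "(\<lambda>x. norm (g x)) integrable_on {x..y}"
        using integrable_on_subinterval[OF int sub] integrable_on_subinterval[OF gi sub] integrable_on_subinterval[OF ni sub] by auto
      have Minc: "M y - M x = integral {x..y} (\<lambda>x. norm (g x))"
        using Henstock_Kurzweil_Integration.integral_combine[OF xy(1,2), of "\<lambda>x. norm (g x)"] integrable_on_subinterval[OF ni, of a y] xy
        by (auto simp: M_def)
      have Iinc: "integral {a..y} (\<lambda>x. D (w x) \<bullet> g x) - integral {a..x} (\<lambda>x. D (w x) \<bullet> g x) = integral {x..y} (\<lambda>x. D (w x) \<bullet> g x)"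
        using Henstock_Kurzweil_Integration.integral_combine[OF xy(1,2), of "\<lambda>x. D (w x) \<bullet> g x"] integrable_on_subinterval[OF int, of a y] xy
        by auto
      have winc: "w y - w x = integral {x..y} g" by (rule primitive_on_increment[OF w xy(1-3)])
      have close: "dist (D (w t)) (D (w x)) < \<epsilon> / 2" if "t \<in> {x..y}" for t
        using that xy sub by (intro Du R wu) (auto simp: dist_real_def)
      have "norm (w y - w x) \<le> M y - M x"
        unfolding winc Minc by (rule integral_norm_bound_integral[OF i1(2,3)]) simp
      define T1 where "T1 = \<Psi> (w y) - \<Psi> (w x) - D (w x) \<bullet> (w y - w x)"
      define T2 where "T2 = integral {x..y} (\<lambda>t. D (w x) \<bullet> g t - D (w t) \<bullet> g t)"
      have "norm (\<Psi> (w y) - \<Psi> (w x) - D (w x) \<bullet> (w y - w x)) \<le> norm (w y - w x) * (\<epsilon> / 2)"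
      proof (rule differentiable_bound_linearization[where S = "closed_segment (w x) (w y)" and f' = "\<lambda>z h. D z \<bullet> h"])
        show "w x + t *\<^sub>R (w y - w x) \<in> closed_segment (w x) (w y)" if "t \<in> {0..1}" for t
          using that by (auto simp: in_segment algebra_simps intro!: exI[of _ t])
        show "(\<Psi> has_derivative (\<bullet>) (D z)) (at z within closed_segment (w x) (w y))" for z
          using \<Psi> has_derivative_at_withinI by blast
        show "onorm ((\<lambda>h. D z \<bullet> h) - (\<lambda>h. D (w x) \<bullet> h)) \<le> \<epsilon> / 2" if z: "z \<in> closed_segment (w x) (w y)" for z
        proof -
          have "w x \<in> cball 0 R" "w y \<in> cball 0 R" using R xy by auto
          then have "z \<in> cball 0 R" using z convex_cball by (meson closed_segment_subset subsetD)
          moreover have "dist z (w x) \<le> dist (w y) (w x)"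
            using dist_in_closed_segment[OF z] by (simp add: dist_commute)
          then have "dist z (w x) < \<delta>1" using wu[of x y] xy by (auto simp: dist_real_def)
          ultimately have "dist (D z) (D (w x)) < \<epsilon> / 2" using Du[of "w x" z] R xy by auto
          then have "norm (D z \<bullet> h - D (w x) \<bullet> h) \<le> \<epsilon> / 2 * norm h" for h
            unfolding inner_diff_left[symmetric] dist_norm real_norm_def
            by (intro order_trans[OF Cauchy_Schwarz_ineq2] mult_right_mono) auto
          then show ?thesis unfolding fun_diff_def by (rule onorm_le)
        qed
      qed simp
      moreover have "norm (w y - w x) * (\<epsilon> / 2) \<le> (M y - M x) * (\<epsilon> / 2)"
        using \<open>norm (w y - w x) \<le> M y - M x\<close> \<epsilon> by (intro mult_right_mono) auto
      ultimately have 1: "\<bar>T1\<bar> \<le> (M y - M x) * (\<epsilon> / 2)" unfolding T1_def by simp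
      have 2: "norm (integral {x..y} (\<lambda>t. D (w x) \<bullet> g t - D (w t) \<bullet> g t)) \<le> integral {x..y} (\<lambda>t. \<epsilon> / 2 * norm (g t))"
      proof (rule integral_norm_bound_integral)
        show "(\<lambda>t. D (w x) \<bullet> g t - D (w t) \<bullet> g t) integrable_on {x..y}"
          using i1 integrable_linear[OF i1(2) bounded_linear_inner_right[of "D (w x)"]]
          by (intro integrable_diff) (auto simp: o_def)
        show "(\<lambda>t. \<epsilon> / 2 * norm (g t)) integrable_on {x..y}" using i1 by (intro integrable_on_mult_right)
        show "norm (D (w x) \<bullet> g t - D (w t) \<bullet> g t) \<le> \<epsilon> / 2 * norm (g t)" if "t \<in> {x..y}" for t
        proof -
          have "norm (D (w x) \<bullet> g t - D (w t) \<bullet> g t) \<le> norm (D (w x) - D (w t)) * norm (g t)"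
            by (metis Cauchy_Schwarz_ineq2 inner_diff_left real_norm_def)
          also have "\<dots> \<le> \<epsilon> / 2 * norm (g t)"
            using close[OF that] by (intro mult_right_mono) (auto simp: dist_norm norm_minus_commute)
          finally show ?thesis .
        qed
      qed
      have 3: "integral {x..y} (\<lambda>t. D (w x) \<bullet> g t - D (w t) \<bullet> g t)
        = D (w x) \<bullet> (w y - w x) - integral {x..y} (\<lambda>t. D (w t) \<bullet> g t)"
        using i1 integral_linear[OF i1(2) bounded_linear_inner_right[of "D (w x)"]]
           integrable_linear[OF i1(2) bounded_linear_inner_right[of "D (w x)"]]
        unfolding winc by (subst integral_diff) (auto simp: o_def)
      have 4: "integral {x..y} (\<lambda>t. \<epsilon> / 2 * norm (g t)) = \<epsilon> / 2 * (M y - M x)"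
        unfolding Minc by simp
      have "\<bar>T2\<bar> \<le> \<epsilon> / 2 * (M y - M x)" using 2 unfolding 4 T2_def by simp
      then have "\<bar>T1 + T2\<bar> \<le> (M y - M x) * (\<epsilon> / 2) + \<epsilon> / 2 * (M y - M x)"
        using 1 abs_triangle_ineq[of T1 T2] by linarith
      moreover have "H y - H x = T1 + T2" unfolding T1_def T2_def 3 H_def Iinc[symmetric] by simp
      moreover have "(M y - M x) * (\<epsilon> / 2) + \<epsilon> / 2 * (M y - M x) = \<epsilon> * (M y - M x)" by (simp add: algebra_simps)
      ultimately show ?thesis by simp
    qed
    then show "\<exists>\<delta>>0. \<forall>x y. a \<le> x \<and> x \<le> y \<and> y \<le> b \<and> y - x < \<delta> \<longrightarrow> \<bar>H y - H x\<bar> \<le> \<epsilon> * (M y - M x)"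
      using \<delta> by blast
  qed
  then have "integral {a..b} (\<lambda>x. D (w x) \<bullet> g x) = \<Psi> (w b) - \<Psi> (w a)"
    by (simp add: H_def)
  then show "((\<lambda>x. D (w x) \<bullet> g x) has_integral (\<Psi> (w b) - \<Psi> (w a))) {a..b}"
    using int by (simp add: has_integral_iff)
qed

section \<open>Smooth bump functions\<close>

definition smooth :: "(real \<Rightarrow> real) \<Rightarrow> bool" where
  "smooth f \<longleftrightarrow> (\<forall>n x. (deriv ^^ n) f differentiable (at x))"

lemma smooth_primitive:
  assumes "smooth f'" "\<And>x. (f has_real_derivative f' x) (at x)"
  shows "smooth f"
proof -
  have "deriv f = f'" using assms(2) by (auto intro: DERIV_imp_deriv)
  then have "(deriv ^^ Suc n) f = (deriv ^^ n) f'" for n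
    by (simp only: funpow_Suc_right o_apply)
  moreover have "f differentiable (at x)" for x
    using assms(2) real_differentiable_def by blast
  ultimately have "(deriv ^^ n) f differentiable (at x)" for n x
    using assms(1) by (cases n) (simp_all only: smooth_def funpow_0)
  then show ?thesis by (simp add: smooth_def)
qed

lemma smooth_linear_combination:
  assumes "smooth f" "smooth g"
  shows "smooth (\<lambda>x. c * f x + d * g x)"
proof -
  have eq: "(deriv ^^ n) (\<lambda>x. c * f x + d * g x) = (\<lambda>x. c * (deriv ^^ n) f x + d * (deriv ^^ n) g x)" for n
  proof (induction n)
    case (Suc n)
    have "deriv (\<lambda>x. c * (deriv ^^ n) f x + d * (deriv ^^ n) g x) x
        = c * deriv ((deriv ^^ n) f) x + d * deriv ((deriv ^^ n) g) x" for x
    proof -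
      have "DERIV ((deriv ^^ n) f) x :> deriv ((deriv ^^ n) f) x" "DERIV ((deriv ^^ n) g) x :> deriv ((deriv ^^ n) g) x"
        using assms by (auto simp: smooth_def DERIV_deriv_iff_real_differentiable)
      then show ?thesis
        by (intro DERIV_imp_deriv DERIV_add DERIV_cmult)
    qed
    then show ?case using Suc by auto
  qed simp
  show ?thesis
    unfolding smooth_def eq using assms by (auto simp: smooth_def)
qed

lemma DERIV_0_if_quadratic_bound:
  fixes f :: "real \<Rightarrow> real"
  assumes "\<And>x. \<bar>f x\<bar> \<le> C * (x - a)\<^sup>2"
  shows "(f has_real_derivative 0) (at a)"
proof -
  have fa: "f a = 0" using assms[of a] by simp
  have "((\<lambda>h. C * \<bar>h\<bar>) \<longlongrightarrow> 0) (at 0)"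
    by (auto intro!: tendsto_eq_intros)
  moreover have "\<bar>(f (a + h) - f a) / h\<bar> \<le> C * \<bar>h\<bar>" if "h \<noteq> 0" for h
  proof -
    have "\<bar>f (a + h)\<bar> / \<bar>h\<bar> \<le> C * h\<^sup>2 / \<bar>h\<bar>" using assms[of "a + h"] by (intro divide_right_mono) auto
    also have "C * h\<^sup>2 / \<bar>h\<bar> = C * \<bar>h\<bar>" using that by (simp add: power2_eq_square abs_if)
    finally show ?thesis by (simp add: fa)
  qed
  then have "\<forall>\<^sub>F h in at 0. norm ((f (a + h) - f a) / h) \<le> C * \<bar>h\<bar>"
    unfolding eventually_at by (intro exI[of _ 1]) (simp del: abs_divide)
  ultimately have "((\<lambda>h. (f (a + h) - f a) / h) \<longlongrightarrow> 0) (at 0)"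
    by (rule Lim_null_comparison[rotated])
  then show ?thesis by (simp add: DERIV_def)
qed

text \<open>
  This family is closed under differentiation, so that smoothness of all its members follows from the
  first derivative alone.
\<close>

definition bump :: "real \<Rightarrow> real \<Rightarrow> real \<Rightarrow> real poly \<Rightarrow> nat \<Rightarrow> real \<Rightarrow> real" where
  "bump \<alpha> \<beta> \<delta> q k x = (if \<alpha> < x \<and> x < \<beta>
     then poly q x / ((x - \<alpha>) * (\<beta> - x)) ^ k * exp (- \<delta> / ((x - \<alpha>) * (\<beta> - x))) else 0)"

text \<open>
  The exponential is smaller than every power of \<open>(x - \<alpha>) * (\<beta> - x)\<close>. The power \<open>k + 2\<close> absorbs the
  denominator and leaves a square, which makes the function differentiable at both end points.
\<close>

lemma bump_quadratic_bound:
  assumes "\<alpha> < \<beta>" "0 < \<delta>"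
  obtains C where "\<And>x. \<bar>bump \<alpha> \<beta> \<delta> q k x\<bar> \<le> C * (x - \<alpha>)\<^sup>2" "\<And>x. \<bar>bump \<alpha> \<beta> \<delta> q k x\<bar> \<le> C * (x - \<beta>)\<^sup>2"
proof -
  have "bounded (poly q ` {\<alpha>..\<beta>})"
    by (intro compact_imp_bounded compact_continuous_image continuous_intros) auto
  then obtain K where K: "\<And>x. x \<in> {\<alpha>..\<beta>} \<Longrightarrow> \<bar>poly q x\<bar> \<le> K"
    by (metis bounded_iff imageI real_norm_def)
  \<comment> \<open>Two powers more than the denominator needs.\<close>
  define n where "n = k + 2"
  have n: "0 < n" by (simp add: n_def)
  define c where "c = (real n / \<delta>) ^ n"
  have c: "0 \<le> c" using assms by (simp add: c_def)
  have decay: "exp (- \<delta> / u) / u ^ k \<le> c * u\<^sup>2" if "0 < u" for u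
  proof -
    have "(\<delta> / u / real n) ^ n \<le> (1 + \<delta> / u / real n) ^ n"
      using that assms by (intro power_mono) auto
    also have "\<dots> \<le> exp (\<delta> / u)"
      by (rule exp_ge_one_plus_x_over_n_power_n) (use that assms n in \<open>auto intro: order_trans[of _ 0]\<close>)
    finally have "inverse (exp (\<delta> / u)) \<le> inverse ((\<delta> / u / real n) ^ n)"
      using that assms n by (intro le_imp_inverse_le) auto
    also have "\<dots> = c * u ^ n"
      using that assms n by (simp add: c_def power_divide field_simps)
    finally have "exp (- \<delta> / u) \<le> c * u ^ n" by (simp add: exp_minus)
    then have "exp (- \<delta> / u) / u ^ k \<le> c * u ^ n / u ^ k" using that by (intro divide_right_mono) auto
    also have "\<dots> = c * u\<^sup>2" using that by (simp add: n_def power_add power2_eq_square)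
    finally show ?thesis .
  qed
  define C where "C = K * c * (\<beta> - \<alpha>)\<^sup>2"
  have K0: "0 \<le> K" using K[of \<alpha>] assms by (simp add: order_trans[OF abs_ge_zero])
  have C: "0 \<le> C" using c K0 by (simp add: C_def)
  have main: "\<bar>bump \<alpha> \<beta> \<delta> q k x\<bar> \<le> K * (c * ((x - \<alpha>) * (\<beta> - x))\<^sup>2)" if x: "\<alpha> < x" "x < \<beta>" for x
  proof -
    have u: "0 < (x - \<alpha>) * (\<beta> - x)" using x by simp
    have "\<bar>bump \<alpha> \<beta> \<delta> q k x\<bar> = \<bar>poly q x\<bar> * (exp (- \<delta> / ((x - \<alpha>) * (\<beta> - x))) / ((x - \<alpha>) * (\<beta> - x)) ^ k)"
      using x u by (simp add: bump_def abs_mult power_abs)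
    also have "\<dots> \<le> K * (c * ((x - \<alpha>) * (\<beta> - x))\<^sup>2)"
      by (intro mult_mono K decay u) (use x u K0 in auto)
    finally show ?thesis .
  qed
  have sq: "((x - \<alpha>) * (\<beta> - x))\<^sup>2 \<le> (\<beta> - \<alpha>)\<^sup>2 * (x - \<alpha>)\<^sup>2" "((x - \<alpha>) * (\<beta> - x))\<^sup>2 \<le> (\<beta> - \<alpha>)\<^sup>2 * (x - \<beta>)\<^sup>2"
    if "\<alpha> < x" "x < \<beta>" for x
    using power_mono[of "\<beta> - x" "\<beta> - \<alpha>" 2] power_mono[of "x - \<alpha>" "\<beta> - \<alpha>" 2] that
    by (auto simp: power_mult_distrib power2_commute[of x \<beta>] intro: mult_mono)
  show thesis
  proof (rule that[of C])
    fix x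
    show "\<bar>bump \<alpha> \<beta> \<delta> q k x\<bar> \<le> C * (x - \<alpha>)\<^sup>2"
    proof (cases "\<alpha> < x \<and> x < \<beta>")
      case True
      then show ?thesis using main[of x] mult_left_mono[OF sq(1)[of x], of "K * c"] c K0 by (simp add: C_def mult_ac)
    qed (use C in \<open>auto simp: bump_def\<close>)
    show "\<bar>bump \<alpha> \<beta> \<delta> q k x\<bar> \<le> C * (x - \<beta>)\<^sup>2"
    proof (cases "\<alpha> < x \<and> x < \<beta>")
      case True
      then show ?thesis using main[of x] mult_left_mono[OF sq(2)[of x], of "K * c"] c K0 by (simp add: C_def mult_ac)
    qed (use C in \<open>auto simp: bump_def\<close>)
  qed
qed

lemma has_real_derivative_bump:
  assumes "\<alpha> < \<beta>" "0 < \<delta>"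
  defines "U \<equiv> [:- (\<alpha> * \<beta>), \<alpha> + \<beta>, -1:]"
  shows "(bump \<alpha> \<beta> \<delta> q k has_real_derivative
    bump \<alpha> \<beta> \<delta> (pderiv q * U\<^sup>2 - smult (real k) (q * pderiv U * U) + smult \<delta> (q * pderiv U)) (k + 2) x) (at x)"
proof -
  have U: "poly U x = (x - \<alpha>) * (\<beta> - x)" "poly (pderiv U) x = \<alpha> + \<beta> - 2 * x" for x
    by (auto simp: U_def pderiv_pCons algebra_simps)
  consider "\<alpha> < x" "x < \<beta>" | "x = \<alpha> \<or> x = \<beta>" | "x < \<alpha> \<or> \<beta> < x" by linarith
  then show ?thesis
  proof cases
    case 1
    define u where "u = (x - \<alpha>) * (\<beta> - x)"
    have u: "0 < u" using 1 by (simp add: u_def)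
    have du: "((\<lambda>x. (x - \<alpha>) * (\<beta> - x)) has_real_derivative \<alpha> + \<beta> - 2 * x) (at x)"
      by (auto intro!: derivative_eq_intros simp: algebra_simps)
    let ?u' = "\<alpha> + \<beta> - 2 * x"
    have dh: "((\<lambda>x. - \<delta> / ((x - \<alpha>) * (\<beta> - x))) has_real_derivative \<delta> * ?u' / (u * u)) (at x)"
      using DERIV_divide[OF DERIV_const[of "- \<delta>"] du] u unfolding u_def[symmetric] by simp
    have dp: "((\<lambda>x. ((x - \<alpha>) * (\<beta> - x)) ^ k) has_real_derivative real k * ?u' * u ^ (k - 1)) (at x)"
      using DERIV_power[OF du, of k] by (simp add: u_def mult_ac)
    have dq: "((\<lambda>x. poly q x / ((x - \<alpha>) * (\<beta> - x)) ^ k) has_real_derivative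
        (poly (pderiv q) x * u ^ k - poly q x * (real k * ?u' * u ^ (k - 1))) / (u ^ k * u ^ k)) (at x)"
      using DERIV_divide[OF poly_DERIV dp] u unfolding u_def[symmetric] by simp
    have "((\<lambda>x. poly q x / ((x - \<alpha>) * (\<beta> - x)) ^ k * exp (- \<delta> / ((x - \<alpha>) * (\<beta> - x)))) has_real_derivative
      ((poly (pderiv q) x * u ^ k - poly q x * (real k * ?u' * u ^ (k - 1))) / (u ^ k * u ^ k)) * exp (- \<delta> / u)
       + exp (- \<delta> / u) * (\<delta> * ?u' / (u * u)) * (poly q x / u ^ k)) (at x)"
      using DERIV_mult[OF dq DERIV_chain2[OF DERIV_exp dh]] unfolding u_def[symmetric] .
    moreover have "((poly (pderiv q) x * u ^ k - poly q x * (real k * (\<alpha> + \<beta> - 2 * x) * u ^ (k - 1))) / (u ^ k * u ^ k)) * exp (- \<delta> / u)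
       + exp (- \<delta> / u) * (\<delta> * (\<alpha> + \<beta> - 2 * x) / (u * u)) * (poly q x / u ^ k)
      = bump \<alpha> \<beta> \<delta> (pderiv q * U\<^sup>2 - smult (real k) (q * pderiv U * U) + smult \<delta> (q * pderiv U)) (k + 2) x"
    proof -
      have k1: "real k * u ^ (k - 1) = real k * u ^ k / u" using u by (cases k) auto
      have "(poly (pderiv q) x * u ^ k - poly q x * (real k * (\<alpha> + \<beta> - 2 * x) * u ^ (k - 1))) / (u ^ k * u ^ k)
        = (poly (pderiv q) x * u ^ k - poly q x * (\<alpha> + \<beta> - 2 * x) * (real k * u ^ k / u)) / (u ^ k * u ^ k)"
        unfolding k1[symmetric] by (simp add: mult_ac)
      also have "\<dots> = (poly (pderiv q) x * u\<^sup>2 - real k * (poly q x * (\<alpha> + \<beta> - 2 * x) * u)) / u ^ (k + 2)"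
        using u by (simp add: field_simps power2_eq_square power_add)
      finally show ?thesis
        using 1 u by (simp add: bump_def U flip: u_def) (simp add: field_simps power2_eq_square power_add)
    qed
    ultimately have "((\<lambda>x. poly q x / ((x - \<alpha>) * (\<beta> - x)) ^ k * exp (- \<delta> / ((x - \<alpha>) * (\<beta> - x)))) has_real_derivative
      bump \<alpha> \<beta> \<delta> (pderiv q * U\<^sup>2 - smult (real k) (q * pderiv U * U) + smult \<delta> (q * pderiv U)) (k + 2) x) (at x)"
      by simp
    then show ?thesis
      by (rule has_field_derivative_transform_within_open[where S = "{\<alpha><..<\<beta>}"]) (use 1 in \<open>auto simp: bump_def\<close>)
  next
    case 2
    obtain C where "\<And>x. \<bar>bump \<alpha> \<beta> \<delta> q k x\<bar> \<le> C * (x - \<alpha>)\<^sup>2" "\<And>x. \<bar>bump \<alpha> \<beta> \<delta> q k x\<bar> \<le> C * (x - \<beta>)\<^sup>2"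
      using bump_quadratic_bound[OF assms(1,2)] by blast
    then have "(bump \<alpha> \<beta> \<delta> q k has_real_derivative 0) (at x)"
      using 2 DERIV_0_if_quadratic_bound by blast
    then show ?thesis using 2 by (auto simp: bump_def)
  next
    case 3
    have "((\<lambda>x. 0) has_real_derivative 0) (at x)" by simp
    then have "(bump \<alpha> \<beta> \<delta> q k has_real_derivative 0) (at x)"
      by (rule has_field_derivative_transform_within_open[where S = "- {\<alpha>..\<beta>}"]) (use 3 in \<open>auto simp: bump_def\<close>)
    then show ?thesis using 3 by (auto simp: bump_def)
  qed
qed

lemma smooth_bump:
  assumes "\<alpha> < \<beta>" "0 < \<delta>"
  shows "smooth (bump \<alpha> \<beta> \<delta> q k)"
proof -
  have d: "\<exists>q' k'. deriv (bump \<alpha> \<beta> \<delta> q k) = bump \<alpha> \<beta> \<delta> q' k'" for q k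
    using has_real_derivative_bump[OF assms, of q k] by (metis DERIV_imp_deriv ext)
  have "\<exists>q' k'. (deriv ^^ n) (bump \<alpha> \<beta> \<delta> q k) = bump \<alpha> \<beta> \<delta> q' k'" for n
  proof (induction n)
    case 0 show ?case by auto
  next
    case (Suc n)
    then show ?case using d by (metis funpow.simps(2) o_apply)
  qed
  then show ?thesis
    unfolding smooth_def by (metis has_real_derivative_bump[OF assms] real_differentiable_def)
qed

section \<open>Integration by parts and integrals on the half-line\<close>

lemma test_function_iff_smooth:
  "test_function f \<longleftrightarrow> smooth f \<and> (\<exists>a b. 0 < a \<and> a < b \<and> (\<forall>x. x \<notin> {a..b} \<longrightarrow> f x = 0))"
  by (simp add: test_function_def smooth_def)

lemma smooth_DERIV: "smooth f \<Longrightarrow> (f has_real_derivative deriv f x) (at x)"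
  unfolding smooth_def DERIV_deriv_iff_real_differentiable by (metis funpow_0)

lemma smooth_deriv: "smooth f \<Longrightarrow> smooth (deriv f)"
  unfolding smooth_def by (metis funpow_Suc_right o_apply)

lemma smooth_continuous: "smooth f \<Longrightarrow> continuous_on A f"
  by (meson DERIV_continuous_on has_field_derivative_at_within smooth_DERIV)

lemma primitive_on_Pair:
  assumes "primitive_on f f' a b" "primitive_on w g a b"
  shows "primitive_on (\<lambda>x. (f x, w x)) (\<lambda>x. (f' x, g x)) a b"
proof -
  have l: "bounded_linear (\<lambda>y. (y, 0))" "bounded_linear (\<lambda>z. (0, z))"
    by (auto intro!: bounded_linear_Pair bounded_linear_ident bounded_linear_zero)
  have i: "f' absolutely_integrable_on {a..b}" "g absolutely_integrable_on {a..b}"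
    using assms by (auto simp: primitive_on_def)
  have "(\<lambda>x. (f' x, 0) + (0, g x)) absolutely_integrable_on {a..b}"
    using absolutely_integrable_linear[OF i(1) l(1)] absolutely_integrable_linear[OF i(2) l(2)]
    by (intro set_integral_add) (auto simp: o_def)
  then have "(\<lambda>x. (f' x, g x)) absolutely_integrable_on {a..b}" by simp
  moreover have "(f x, w x) = (f a, w a) + integral {a..x} (\<lambda>x. (f' x, g x))" if x: "x \<in> {a..b}" for x
  proof -
    have "f' integrable_on {a..b}" "g integrable_on {a..b}" using i absolutely_integrable_on_def by blast+
    then have ix: "f' integrable_on {a..x}" "g integrable_on {a..x}"
      using x by (auto intro: integrable_on_subinterval)
    have "((\<lambda>x. (f' x, 0) + (0, g x)) has_integral ((integral {a..x} f', 0) + (0, integral {a..x} g))) {a..x}"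
      using has_integral_linear[OF integrable_integral[OF ix(1)] l(1)] has_integral_linear[OF integrable_integral[OF ix(2)] l(2)]
      by (intro has_integral_add) (auto simp: o_def)
    then have "integral {a..x} (\<lambda>x. (f' x, g x)) = (integral {a..x} f', integral {a..x} g)"
      by (simp add: integral_unique)
    moreover have "f x = f a + integral {a..x} f'" "w x = w a + integral {a..x} g"
      using assms x unfolding primitive_on_def by blast+
    ultimately show ?thesis by simp
  qed
  ultimately show ?thesis unfolding primitive_on_def by blast
qed

lemma primitive_onI_deriv:
  assumes "\<And>x. x \<in> {a..b} \<Longrightarrow> (f has_vector_derivative f' x) (at x within {a..b})" "continuous_on {a..b} f'"
  shows "primitive_on f f' a b"
  unfolding primitive_on_def
proof
  show "f' absolutely_integrable_on {a..b}" by (rule absolutely_integrable_continuous_real[OF assms(2)])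
  show "\<forall>x\<in>{a..b}. f x = f a + integral {a..x} f'"
  proof
    fix x assume x: "x \<in> {a..b}"
    have "(f' has_integral (f x - f a)) {a..x}"
      by (rule fundamental_theorem_of_calculus)
        (use x in \<open>auto intro!: has_vector_derivative_within_subset[OF assms(1)]\<close>)
    then show "f x = f a + integral {a..x} f'" by (simp add: integral_unique)
  qed
qed

lemma absolutely_integrable_scaleR_continuous:
  fixes g :: "real \<Rightarrow> 'a::euclidean_space"
  assumes "continuous_on {a..b} f" "g absolutely_integrable_on {a..b}"
  shows "(\<lambda>x. (f x :: real) *\<^sub>R g x) absolutely_integrable_on {a..b}"
proof (rule absolutely_integrable_bounded_measurable_product[where h = "(*\<^sub>R)"])
  show "bilinear ((*\<^sub>R) :: real \<Rightarrow> 'a \<Rightarrow> 'a)"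
    by (simp add: bilinear_conv_bounded_bilinear bounded_bilinear_scaleR)
  show "f \<in> borel_measurable (lebesgue_on {a..b})"
    by (rule continuous_imp_measurable_on_sets_lebesgue[OF assms(1)]) simp
  show "bounded (f ` {a..b})"
    by (rule compact_imp_bounded[OF compact_continuous_image[OF assms(1)]]) simp
qed (use assms in auto)

text \<open>
  The chain rule for the product, applied to the pair \<open>(f, w)\<close> and to one component of the values at
  a time.
\<close>

lemma integral_by_parts_smooth:
  fixes w g :: "real \<Rightarrow> complex"
  assumes "smooth f" "primitive_on w g a b" "a \<le> b"
  shows "((\<lambda>x. deriv f x *\<^sub>R w x + f x *\<^sub>R g x) has_integral (f b *\<^sub>R w b - f a *\<^sub>R w a)) {a..b}"
proof -
  have "primitive_on f (deriv f) a b"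
    by (intro primitive_onI_deriv smooth_continuous smooth_deriv assms)
      (metis smooth_DERIV[OF assms(1)] has_field_derivative_at_within has_real_derivative_iff_has_vector_derivative)
  then have pr: "primitive_on (\<lambda>x. (f x, w x)) (\<lambda>x. (deriv f x, g x)) a b"
    using assms(2) by (rule primitive_on_Pair)
  have comp: "((\<lambda>x. (deriv f x *\<^sub>R w x + f x *\<^sub>R g x) \<bullet> c) has_integral ((f b *\<^sub>R w b - f a *\<^sub>R w a) \<bullet> c)) {a..b}" for c :: complex
  proof -
    define \<Psi> where "\<Psi> z = fst z * (snd z \<bullet> c)" for z :: "real \<times> complex"
    define D where "D z = (snd z \<bullet> c, fst z *\<^sub>R c)" for z :: "real \<times> complex"
    have "((\<lambda>x. D (f x, w x) \<bullet> (deriv f x, g x)) has_integral (\<Psi> (f b, w b) - \<Psi> (f a, w a))) {a..b}"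
    proof (rule primitive_on_chain[OF pr assms(3)])
      show "(\<Psi> has_derivative (\<lambda>h. D z \<bullet> h)) (at z)" for z
        unfolding \<Psi>_def D_def
        by (auto intro!: derivative_eq_intros simp: fun_eq_iff inner_prod_def inner_commute algebra_simps)
      show "continuous_on UNIV D" unfolding D_def by (intro continuous_intros)
    qed
    then show ?thesis
      by (simp add: D_def \<Psi>_def inner_prod_def inner_add_left inner_diff_left inner_commute[of c] mult_ac)
  qed
  show ?thesis by (subst has_integral_componentwise_iff) (use comp in auto)
qed

text \<open>
  On bounded intervals \<open>\<bar>z\<bar> \<le> 1 + \<bar>z\<bar>^2\<close> gives integrability.
\<close>

lemma in_Lq_2_absolutely_integrable:
  assumes "in_Lq 2 g"
  shows "g absolutely_integrable_on {0..X}"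
proof -
  have "g absolutely_integrable_on {0<..<X}"
  proof (rule measurable_bounded_by_integrable_imp_absolutely_integrable[where g = "\<lambda>x. 1 + cmod (g x) powr 2"])
    show "g \<in> borel_measurable (lebesgue_on {0<..<X})"
      by (rule measurable_restrict_mono[of g lebesgue "{0<..}"]) (use assms in \<open>auto simp: in_Lq_def\<close>)
    have "(\<lambda>x. cmod (g x) powr 2) absolutely_integrable_on {0<..}"
      using assms unfolding in_Lq_def by (simp add: integrable_restrict_space set_integrable_def)
    then have "(\<lambda>x. cmod (g x) powr 2) absolutely_integrable_on {0<..<X}"
      by (rule set_integrable_subset) auto
    then have "(\<lambda>x. cmod (g x) powr 2) integrable_on {0<..<X}"
      using absolutely_integrable_on_def by blast
    then show "(\<lambda>x. 1 + cmod (g x) powr 2) integrable_on {0<..<X}"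
      by (intro integrable_add) (auto simp: integrable_on_const)
    show "cmod (g x) \<le> 1 + cmod (g x) powr 2" for x
    proof -
      have "cmod (g x) \<le> 1 + (cmod (g x))\<^sup>2"
      proof -
        have "2 * cmod (g x) \<le> (cmod (g x))\<^sup>2 + 1" using sum_squares_bound[of "cmod (g x)" 1] by simp
        moreover have "0 \<le> (cmod (g x))\<^sup>2" by simp
        ultimately show ?thesis by linarith
      qed
      then show ?thesis by simp
    qed
  qed auto
  then show ?thesis by (simp add: absolutely_integrable_on_Icc_iff_Ioo)
qed

text \<open>
  Connects the Lebesgue integrals of the definitions with gauge integrals over bounded intervals.
\<close>

lemma half_line_integral_compact_support:
  fixes h :: "real \<Rightarrow> 'a::euclidean_space"
  assumes "h absolutely_integrable_on {0..X}" "0 < a" "b \<le> X" "\<And>x. x \<notin> {a..b} \<Longrightarrow> h x = 0"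
  shows "(LINT x|half_line. h x) = integral {0..X} h"
proof -
  have r: "(if x \<in> {0..X} then h x else 0) = h x" "(if x \<in> {0<..} then h x else 0) = h x" for x
    using assms(2-4) by force+
  have "h absolutely_integrable_on UNIV"
    using assms(1) unfolding absolutely_integrable_restrict_UNIV[of "{0..X}", symmetric] r .
  then have "h absolutely_integrable_on {0<..}"
    unfolding absolutely_integrable_restrict_UNIV[of "{0<..}", symmetric] r .
  then have "(LINT x|half_line. h x) = integral {0<..} h"
    by (intro lebesgue_integral_eq_integral absolutely_integrable_imp_integrable) auto
  also have "\<dots> = integral UNIV h"
    unfolding integral_restrict_UNIV[of "{0<..}", symmetric] r ..
  also have "\<dots> = integral {0..X} h"
    unfolding integral_restrict_UNIV[of "{0..X}", symmetric] r ..
  finally show ?thesis .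
qed

text \<open>
  Almost every point is a limit of averages over small intervals, by
  \<open>integrable_ccontinuous_explicit\<close>.
\<close>

lemma AE_zero_if_integrals_zero:
  fixes h :: "real \<Rightarrow> complex"
  assumes "\<And>X. h absolutely_integrable_on {0..X}"
    and "\<And>\<alpha> \<beta>. 0 < \<alpha> \<Longrightarrow> \<alpha> < \<beta> \<Longrightarrow> integral {\<alpha>..\<beta>} h = 0"
  shows "AE x in half_line. h x = 0"
proof -
  define f where "f x = (if x \<in> {0..} then h x else 0)" for x
  have "f integrable_on cbox a b" for a b
  proof -
    have "h integrable_on {0..b}" using assms(1) absolutely_integrable_on_def by blast
    then have "(\<lambda>x. if x \<in> {0..b} then h x else 0) integrable_on UNIV"
      by (simp only: integrable_restrict_UNIV)
    then have "(\<lambda>x. if x \<in> {0..b} then h x else 0) integrable_on {a..b}"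
      by (rule integrable_on_subinterval) simp
    then show ?thesis
      by (simp, rule integrable_eq) (auto simp: f_def)
  qed
  then obtain N where N: "negligible N" and
    lim: "\<And>x e. x \<notin> N \<Longrightarrow> 0 < e \<Longrightarrow> \<exists>d>0. \<forall>k. 0 < k \<and> k < d \<longrightarrow>
       norm (integral (cbox x (x + k *\<^sub>R One)) f /\<^sub>R k ^ DIM(real) - f x) < e"
    using integrable_ccontinuous_explicit[of f] by blast
  have "h x = 0" if "x \<notin> N" "0 < x" for x
  proof (rule ccontr)
    assume "h x \<noteq> 0"
    then obtain d where d: "0 < d" and *: "\<And>k. 0 < k \<Longrightarrow> k < d \<Longrightarrow>
       norm (integral (cbox x (x + k *\<^sub>R One)) f /\<^sub>R k ^ DIM(real) - f x) < norm (h x)"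
      using lim[OF \<open>x \<notin> N\<close>, of "norm (h x)"] by auto
    have "integral {x..x + d / 2} f = integral {x..x + d / 2} h"
      using \<open>0 < x\<close> by (intro integral_cong) (auto simp: f_def)
    also have "\<dots> = 0" using assms(2) d \<open>0 < x\<close> by simp
    finally show False using *[of "d / 2"] d \<open>0 < x\<close> by (simp add: f_def)
  qed
  then have "{x \<in> space lebesgue. \<not> (x \<in> {0<..} \<longrightarrow> h x = 0)} \<subseteq> N" by auto
  moreover have "N \<in> null_sets lebesgue" using N by (simp add: negligible_iff_null_sets)
  ultimately show ?thesis by (subst AE_restrict_space_iff) (auto intro: AE_I')
qed

section \<open>The lemma of du Bois-Reymond\<close>

text \<open>
  These smooth functions stay between \<open>0\<close> and \<open>1\<close> and tend to the indicator function of the interval,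
  which takes the place of a mollification.
\<close>

definition cutoff :: "real \<Rightarrow> real \<Rightarrow> nat \<Rightarrow> real \<Rightarrow> real" where
  "cutoff \<alpha> \<beta> n = bump \<alpha> \<beta> (1 / real (Suc n)) 1 0"

lemma cutoff_eq: "cutoff \<alpha> \<beta> n x = (if \<alpha> < x \<and> x < \<beta> then exp (- (1 / real (Suc n)) / ((x - \<alpha>) * (\<beta> - x))) else 0)"
  by (simp add: cutoff_def bump_def)

lemma smooth_cutoff: "\<alpha> < \<beta> \<Longrightarrow> smooth (cutoff \<alpha> \<beta> n)"
  unfolding cutoff_def by (rule smooth_bump) auto

lemma cutoff_bounds: "0 \<le> cutoff \<alpha> \<beta> n x" "cutoff \<alpha> \<beta> n x \<le> 1"
  by (auto simp: cutoff_eq)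

lemma cutoff_tendsto: "(\<lambda>n. cutoff \<alpha> \<beta> n x) \<longlonglongrightarrow> (if \<alpha> < x \<and> x < \<beta> then 1 else 0)"
proof (cases "\<alpha> < x \<and> x < \<beta>")
  case True
  have "(\<lambda>n. - (1 / real (Suc n)) / ((x - \<alpha>) * (\<beta> - x))) \<longlonglongrightarrow> - 0 / ((x - \<alpha>) * (\<beta> - x))"
    using True LIMSEQ_inverse_real_of_nat by (intro tendsto_intros) (auto simp: inverse_eq_divide)
  from tendsto_exp[OF this] show ?thesis using True by (simp add: cutoff_eq)
qed (auto simp: cutoff_eq)

lemma cutoff_integral_tendsto:
  fixes k :: "real \<Rightarrow> complex"
  assumes "k absolutely_integrable_on {0..X}" "0 < \<alpha>" "\<alpha> < \<beta>" "\<beta> \<le> X"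
  shows "(\<lambda>n. integral {0..X} (\<lambda>x. cutoff \<alpha> \<beta> n x *\<^sub>R k x)) \<longlonglongrightarrow> integral {\<alpha>..\<beta>} k"
proof -
  have "(\<lambda>n. integral {0..X} (\<lambda>x. cutoff \<alpha> \<beta> n x *\<^sub>R k x)) \<longlonglongrightarrow>
     integral {0..X} (\<lambda>x. (if \<alpha> < x \<and> x < \<beta> then 1 else 0) *\<^sub>R k x)"
  proof (rule dominated_convergence(2)[where h = "\<lambda>x. norm (k x)"])
    show "(\<lambda>x. cutoff \<alpha> \<beta> n x *\<^sub>R k x) integrable_on {0..X}" for n
      using absolutely_integrable_scaleR_continuous[OF smooth_continuous[OF smooth_cutoff[OF assms(3)]] assms(1)]
        absolutely_integrable_on_def by blast
    show "(\<lambda>x. norm (k x)) integrable_on {0..X}" using assms(1) absolutely_integrable_on_def by blast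
    show "norm (cutoff \<alpha> \<beta> n x *\<^sub>R k x) \<le> norm (k x)" for n x
      using cutoff_bounds[of \<alpha> \<beta> n x] by (simp add: mult_left_le_one_le)
    show "(\<lambda>n. cutoff \<alpha> \<beta> n x *\<^sub>R k x) \<longlonglongrightarrow> (if \<alpha> < x \<and> x < \<beta> then 1 else 0) *\<^sub>R k x" for x
      by (intro tendsto_intros cutoff_tendsto)
  qed
  also have "integral {0..X} (\<lambda>x. (if \<alpha> < x \<and> x < \<beta> then 1 else 0) *\<^sub>R k x)
      = integral {0..X} (\<lambda>x. if x \<in> {\<alpha><..<\<beta>} then k x else 0)"
    by (rule integral_cong) auto
  also have "\<dots> = integral ({\<alpha><..<\<beta>} \<inter> {0..X}) k"
    by (rule integral_restrict_Int)
  also have "{\<alpha><..<\<beta>} \<inter> {0..X} = {\<alpha><..<\<beta>}" using assms by auto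
  also have "integral {\<alpha><..<\<beta>} k = integral {\<alpha>..\<beta>} k"
    by (simp add: integral_open_interval_real)
  finally show ?thesis .
qed

lemma cutoff_mass_pos:
  assumes "0 < \<alpha>" "\<alpha> < \<beta>" "\<beta> \<le> X"
  shows "0 < integral {0..X} (cutoff \<alpha> \<beta> n)"
proof -
  have c: "continuous_on {0..X} (cutoff \<alpha> \<beta> n)" by (rule smooth_continuous[OF smooth_cutoff[OF assms(2)]])
  have "integral {0..X} (cutoff \<alpha> \<beta> n) \<noteq> 0"
  proof
    assume "integral {0..X} (cutoff \<alpha> \<beta> n) = 0"
    then have "\<forall>x\<in>{0..X}. cutoff \<alpha> \<beta> n x = 0"
      using integral_eq_0_iff[OF c] cutoff_bounds assms by auto
    then have "cutoff \<alpha> \<beta> n ((\<alpha> + \<beta>) / 2) = 0" using assms by auto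
    then show False using assms by (simp add: cutoff_eq split: if_splits)
  qed
  moreover have "0 \<le> integral {0..X} (cutoff \<alpha> \<beta> n)"
    by (intro integral_nonneg integrable_continuous_real c) (auto simp: cutoff_bounds)
  ultimately show ?thesis by simp
qed

text \<open>
  The difference of two cutoffs of mass one has integral zero; therefore its primitive has compact
  support.
\<close>

lemma cutoff_difference_primitive:
  assumes "0 < \<alpha>" "\<alpha> < \<beta>" "0 < \<gamma>" "\<gamma> < \<delta>" "\<beta> \<le> X" "\<delta> \<le> X"
  obtains f where "test_function f"
    "\<And>x. deriv f x = cutoff \<alpha> \<beta> n x / integral {0..X} (cutoff \<alpha> \<beta> n) - cutoff \<gamma> \<delta> n x / integral {0..X} (cutoff \<gamma> \<delta> n)"
    "\<And>x. x \<notin> {min \<alpha> \<gamma>..X} \<Longrightarrow> f x = 0"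
proof -
  define cI where "cI = integral {0..X} (cutoff \<alpha> \<beta> n)"
  define cJ where "cJ = integral {0..X} (cutoff \<gamma> \<delta> n)"
  have pos: "0 < cI" "0 < cJ" using cutoff_mass_pos assms by (auto simp: cI_def cJ_def)
  define h where "h x = (1 / cI) * cutoff \<alpha> \<beta> n x + (- 1 / cJ) * cutoff \<gamma> \<delta> n x" for x
  have hs: "smooth h" unfolding h_def[abs_def] using assms by (intro smooth_linear_combination smooth_cutoff)
  have hc: "continuous_on A h" for A by (rule smooth_continuous[OF hs])
  define f where "f x = integral {0..x} h" for x
  have h0: "h x = 0" if "x \<notin> {min \<alpha> \<gamma><..<max \<beta> \<delta>}" for x
    using that by (auto simp: h_def cutoff_eq)
  have total: "integral {0..X} h = 0"
  proof -
    have i: "cutoff \<alpha> \<beta> n integrable_on {0..X}" "cutoff \<gamma> \<delta> n integrable_on {0..X}"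
      using assms by (auto intro!: integrable_continuous_real smooth_continuous smooth_cutoff)
    have "integral {0..X} h = (1 / cI) * cI + (- 1 / cJ) * cJ"
      unfolding h_def cI_def cJ_def
      by (subst integral_add) (use i in \<open>auto intro!: integrable_on_mult_right integrable_on_divide integrable_neg\<close>)
    then show ?thesis using pos by simp
  qed
  have f0: "f x = 0" if "x \<notin> {min \<alpha> \<gamma>..X}" for x
  proof (cases "x < min \<alpha> \<gamma>")
    case True
    then have "integral {0..x} h = integral {0..x} (\<lambda>x. 0)" by (intro integral_cong h0) auto
    then show ?thesis by (simp add: f_def)
  next
    case False
    then have x: "X \<le> x" using that by auto
    have "integral {0..X} h + integral {X..x} h = integral {0..x} h"
      by (rule Henstock_Kurzweil_Integration.integral_combine) (use x assms hc in \<open>auto intro!: integrable_continuous_real\<close>)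
    moreover have "integral {X..x} h = integral {X..x} (\<lambda>x. 0)" using assms by (intro integral_cong h0) auto
    ultimately show ?thesis using total by (simp add: f_def)
  qed
  have df: "(f has_real_derivative h x) (at x)" for x
  proof (cases "0 < x")
    case True
    have "(f has_real_derivative h x) (at x within {0..x + 1})"
      unfolding f_def using True by (intro integral_has_real_derivative hc) auto
    then show ?thesis using True by (simp add: at_within_Icc_at)
  next
    case False
    have "((\<lambda>x. 0) has_real_derivative 0) (at x)" by simp
    then have "(f has_real_derivative 0) (at x)"
      by (rule has_field_derivative_transform_within_open[where S = "{..<min \<alpha> \<gamma>}"])
        (use False assms f0 in auto)
    moreover have "h x = 0" using False assms by (intro h0) auto
    ultimately show ?thesis by simp
  qed
  show thesis
  proof (rule that[of f])
    show "deriv f x = cutoff \<alpha> \<beta> n x / integral {0..X} (cutoff \<alpha> \<beta> n) - cutoff \<gamma> \<delta> n x / integral {0..X} (cutoff \<gamma> \<delta> n)" for x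
      using DERIV_imp_deriv[OF df] by (simp add: h_def cI_def cJ_def)
    show "test_function f"
    proof -
      have "0 < min \<alpha> \<gamma>" "min \<alpha> \<gamma> < X" using assms by auto
      moreover have "smooth f" by (rule smooth_primitive[OF hs df])
      ultimately show ?thesis unfolding test_function_iff_smooth using f0 by blast
    qed
  qed (rule f0)
qed

text \<open>
  The lemma of du Bois-Reymond. Tested with \<open>cutoff_difference_primitive\<close>, the hypothesis says that the
  weighted means of \<open>k\<close> for two cutoffs agree; in the limit the means of \<open>k\<close> over any two intervals agree.
\<close>

lemma constant_if_orthogonal_to_test_derivatives:
  fixes k :: "real \<Rightarrow> complex"
  assumes k: "\<And>X. k absolutely_integrable_on {0..X}"
    and orth: "\<And>f X. test_function f \<Longrightarrow> (\<And>x. X < x \<Longrightarrow> f x = 0) \<Longrightarrow> integral {0..X} (\<lambda>x. deriv f x *\<^sub>R k x) = 0"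
  shows "\<exists>C. AE x in half_line. k x = C"
proof -
  define C where "C = integral {1..2} k"
  have avg: "integral {\<alpha>..\<beta>} k = (\<beta> - \<alpha>) *\<^sub>R C" if ab: "0 < \<alpha>" "\<alpha> < \<beta>" for \<alpha> \<beta>
  proof -
    define X where "X = max \<beta> 2"
    have X: "\<beta> \<le> X" "2 \<le> X" by (auto simp: X_def)
    define c where "c \<alpha> \<beta> n = integral {0..X} (cutoff \<alpha> \<beta> n)" for \<alpha> \<beta> n
    define m where "m \<alpha> \<beta> n = integral {0..X} (\<lambda>x. cutoff \<alpha> \<beta> n x *\<^sub>R k x)" for \<alpha> \<beta> n
    have eq: "m \<alpha> \<beta> n /\<^sub>R c \<alpha> \<beta> n = m 1 2 n /\<^sub>R c 1 2 n" for n
    proof -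
      have J: "0 < (1 :: real)" "(1 :: real) < 2" by auto
      obtain f where f: "test_function f" "\<And>x. deriv f x = cutoff \<alpha> \<beta> n x / c \<alpha> \<beta> n - cutoff 1 2 n x / c 1 2 n"
        "\<And>x. x \<notin> {min \<alpha> 1..X} \<Longrightarrow> f x = 0"
        using cutoff_difference_primitive[OF ab J X, of n] unfolding c_def by blast
      have i: "(\<lambda>x. cutoff \<alpha> \<beta> n x *\<^sub>R k x) integrable_on {0..X}" "(\<lambda>x. cutoff 1 2 n x *\<^sub>R k x) integrable_on {0..X}"
        using absolutely_integrable_scaleR_continuous[OF smooth_continuous[OF smooth_cutoff[OF ab(2)]] k]
          absolutely_integrable_scaleR_continuous[OF smooth_continuous[OF smooth_cutoff[OF J(2)]] k]
          absolutely_integrable_on_def by blast+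
      have "0 = integral {0..X} (\<lambda>x. deriv f x *\<^sub>R k x)"
        by (rule sym, rule orth[OF f(1)], rule f(3)) auto
      also have "\<dots> = integral {0..X} (\<lambda>x. (cutoff \<alpha> \<beta> n x *\<^sub>R k x) /\<^sub>R c \<alpha> \<beta> n - (cutoff 1 2 n x *\<^sub>R k x) /\<^sub>R c 1 2 n)"
        by (rule integral_cong) (simp add: f(2) scaleR_diff_left divide_inverse mult.commute)
      also have "\<dots> = m \<alpha> \<beta> n /\<^sub>R c \<alpha> \<beta> n - m 1 2 n /\<^sub>R c 1 2 n"
        unfolding m_def integral_cmul[symmetric] by (rule integral_diff) (intro integrable_cmul i)+
      finally show ?thesis by simp
    qed
    have m_lim: "m \<alpha> \<beta> \<longlonglongrightarrow> integral {\<alpha>..\<beta>} k" if "0 < \<alpha>" "\<alpha> < \<beta>" "\<beta> \<le> X" for \<alpha> \<beta>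
      unfolding m_def using cutoff_integral_tendsto[OF k that] .
    have c_lim: "c \<alpha> \<beta> \<longlonglongrightarrow> \<beta> - \<alpha>" if "0 < \<alpha>" "\<alpha> < \<beta>" "\<beta> \<le> X" for \<alpha> \<beta>
    proof -
      have "(\<lambda>n. integral {0..X} (\<lambda>x. cutoff \<alpha> \<beta> n x *\<^sub>R (1::complex))) \<longlonglongrightarrow> integral {\<alpha>..\<beta>} (\<lambda>x. 1)"
        by (rule cutoff_integral_tendsto[OF absolutely_integrable_continuous_real that]) auto
      moreover have "integral {0..X} (\<lambda>x. cutoff \<alpha> \<beta> n x *\<^sub>R (1::complex)) = complex_of_real (c \<alpha> \<beta> n)" for n
      proof -
        have "(cutoff \<alpha> \<beta> n has_integral c \<alpha> \<beta> n) {0..X}" unfolding c_def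
          by (intro integrable_integral integrable_continuous_real smooth_continuous smooth_cutoff that)
        from has_integral_linear[OF this bounded_linear_of_real[where 'a = complex]]
        show ?thesis by (simp add: o_def scaleR_conv_of_real integral_unique)
      qed
      ultimately have "(\<lambda>n. complex_of_real (c \<alpha> \<beta> n)) \<longlonglongrightarrow> complex_of_real (\<beta> - \<alpha>)"
        using that by (simp add: scaleR_conv_of_real)
      then show ?thesis by (simp only: tendsto_of_real_iff)
    qed
    have "(\<lambda>n. m \<alpha> \<beta> n /\<^sub>R c \<alpha> \<beta> n) \<longlonglongrightarrow> integral {\<alpha>..\<beta>} k /\<^sub>R (\<beta> - \<alpha>)"
      using ab X by (intro tendsto_intros m_lim c_lim) auto
    moreover have "(\<lambda>n. m 1 2 n /\<^sub>R c 1 2 n) \<longlonglongrightarrow> integral {1..2} k /\<^sub>R (2 - 1)"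
      using X by (intro tendsto_intros m_lim c_lim) auto
    ultimately have "integral {\<alpha>..\<beta>} k /\<^sub>R (\<beta> - \<alpha>) = C"
      unfolding eq C_def using LIMSEQ_unique by fastforce
    then show ?thesis using ab by auto
  qed
  have "AE x in half_line. k x - C = 0"
  proof (rule AE_zero_if_integrals_zero)
    show "(\<lambda>x. k x - C) absolutely_integrable_on {0..X}" for X
      by (intro set_integral_diff k absolutely_integrable_continuous_real continuous_intros)
    show "integral {\<alpha>..\<beta>} (\<lambda>x. k x - C) = 0" if "0 < \<alpha>" "\<alpha> < \<beta>" for \<alpha> \<beta>
    proof -
      have "k integrable_on {0..\<beta>}" using k absolutely_integrable_on_def by blast
      then have "k integrable_on {\<alpha>..\<beta>}" by (rule integrable_on_subinterval) (use that in auto)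
      then have "integral {\<alpha>..\<beta>} (\<lambda>x. k x - C) = integral {\<alpha>..\<beta>} k - integral {\<alpha>..\<beta>} (\<lambda>x. C)"
        by (intro integral_diff integrable_const_ivl)
      then show ?thesis using avg[OF that] that by simp
    qed
  qed
  then show ?thesis by auto
qed

section \<open>Continuous representatives of Sobolev functions\<close>

lemma half_line_measurable_cong:
  fixes u w :: "real \<Rightarrow> complex"
  assumes "eq_ae u w" "w \<in> borel_measurable half_line"
  shows "u \<in> borel_measurable half_line"
proof -
  have "(\<lambda>x. if x \<in> {0<..} then w x else 0) \<in> borel_measurable lebesgue"
    using assms(2) by (rule borel_measurable_if_I) simp
  moreover have "AE x in lebesgue. (if x \<in> {0<..} then w x else 0) = (if x \<in> {0<..} then u x else 0)"
    using assms(1) unfolding eq_ae_def by (subst (asm) AE_restrict_space_iff) (auto elim: AE_mp)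
  ultimately have "(\<lambda>x. if x \<in> {0<..} then u x else 0) \<in> borel_measurable lebesgue"
    by (rule borel_measurable_AE)
  then show ?thesis by (rule borel_measurable_if_D)
qed

lemma eq_ae_sym: "eq_ae u w \<Longrightarrow> eq_ae w u"
  unfolding eq_ae_def by (auto elim: AE_mp)

lemma eq_ae_trans: "eq_ae u w \<Longrightarrow> eq_ae w z \<Longrightarrow> eq_ae u z"
  unfolding eq_ae_def by (auto elim!: AE_mp)

lemma half_line_integral_cong:
  fixes F :: "real \<Rightarrow> complex \<Rightarrow> 'b::euclidean_space"
  assumes "eq_ae u w"
    "(\<lambda>x. F x (u x)) \<in> borel_measurable half_line" "(\<lambda>x. F x (w x)) \<in> borel_measurable half_line"
  shows "(LINT x|half_line. F x (u x)) = (LINT x|half_line. F x (w x))"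
  using assms unfolding eq_ae_def by (intro integral_cong_AE) (auto elim: AE_mp)

lemma in_Lq_cong:
  assumes "eq_ae u w" "in_Lq q w"
  shows "in_Lq q u" "(LINT x|half_line. cmod (u x) powr q) = (LINT x|half_line. cmod (w x) powr q)"
proof -
  have u: "u \<in> borel_measurable half_line" and w: "w \<in> borel_measurable half_line"
    using half_line_measurable_cong[OF assms(1)] assms(2) by (auto simp: in_Lq_def)
  have "integrable half_line (\<lambda>x. cmod (u x) powr q)"
    by (rule integrable_cong_AE_imp[of _ "\<lambda>x. cmod (w x) powr q"])
      (use assms u in \<open>auto simp: in_Lq_def eq_ae_def elim: AE_mp\<close>)
  then show "in_Lq q u" using u by (simp add: in_Lq_def)
  show "(LINT x|half_line. cmod (u x) powr q) = (LINT x|half_line. cmod (w x) powr q)"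
    by (rule half_line_integral_cong[OF assms(1), where F = "\<lambda>x z. cmod z powr q"]) (use u w in auto)
qed

text \<open>
  A function of \<open>H1\<close> in terms of its representative that is continuous up to the vertex.
\<close>

definition H1_rep :: "(real \<Rightarrow> complex) \<Rightarrow> (real \<Rightarrow> complex) \<Rightarrow> bool" where
  "H1_rep w g \<longleftrightarrow> in_Lq 2 w \<and> in_Lq 2 g \<and> (\<forall>X. primitive_on w g 0 X)"

lemma continuous_on_half_lineI:
  fixes w :: "real \<Rightarrow> 'a::topological_space"
  assumes "\<And>X. continuous_on {0..X} w"
  shows "continuous_on {0..} w"
proof -
  have "at x within {0..x + 1} = at x within {0..}" if "0 \<le> x" for x :: real
    by (rule at_within_nhd[of _ "{..<x+1}"]) auto
  then show ?thesis
    using assms unfolding continuous_on_eq_continuous_within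
    by (metis add.commute atLeastAtMost_iff atLeast_iff less_add_one less_eq_real_def)
qed

lemma H1_rep_continuous: "H1_rep w g \<Longrightarrow> continuous_on {0..} w"
  unfolding H1_rep_def by (blast intro: continuous_on_half_lineI primitive_on_imp_continuous)

lemma continuous_eq_ae_imp_eq:
  fixes w w' :: "real \<Rightarrow> complex"
  assumes "continuous_on {0..} w" "continuous_on {0..} w'" "eq_ae w w'" "0 \<le> x"
  shows "w x = w' x"
proof -
  have c: "continuous_on {0<..} (\<lambda>x. w x - w' x)"
    using assms(1,2) by (intro continuous_intros) (auto intro: continuous_on_subset)
  define U where "U = {x \<in> {0<..}. w x - w' x \<in> - {0}}"
  have "open U" unfolding U_def by (rule continuous_open_preimage[OF c, unfolded vimage_def Int_def, simplified mem_Collect_eq]) auto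
  moreover have "negligible U"
  proof -
    have "AE x in lebesgue. x \<notin> U"
      using assms(3) unfolding eq_ae_def by (subst (asm) AE_restrict_space_iff) (auto simp: U_def elim: AE_mp)
    moreover have "U \<in> sets lebesgue" using \<open>open U\<close> by simp
    ultimately show ?thesis by (simp add: negligible_iff_null_sets AE_iff_null_sets)
  qed
  ultimately have "U = {}" using open_not_negligible by blast
  then have "\<forall>x\<in>{0<..}. w x - w' x = 0" by (auto simp: U_def)
  moreover have "closure {0<..} = {0::real..}" by simp
  moreover have "continuous_on {0..} (\<lambda>x. w x - w' x)" using assms(1,2) by (intro continuous_intros)
  ultimately have "w x - w' x = 0"
    by (intro continuous_constant_on_closure[of "{0<..}" "\<lambda>x. w x - w' x" 0 x]) (use assms(4) in auto)
  then show ?thesis by simp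
qed

lemma trace0_eq:
  assumes "continuous_on {0..} w" "eq_ae u w"
  shows "trace0 u = w 0"
  unfolding trace0_def
proof (rule the_equality)
  show "\<exists>w'. continuous_on {0..} w' \<and> eq_ae u w' \<and> w' 0 = w 0" using assms by blast
  show "z = w 0" if "\<exists>w. continuous_on {0..} w \<and> eq_ae u w \<and> w 0 = z" for z
    using that continuous_eq_ae_imp_eq[OF _ assms(1)] assms(2) by (metis eq_ae_sym eq_ae_trans order_refl)
qed

lemma test_function_support:
  assumes "test_function f"
  obtains a b where "0 < a" "\<And>x. x \<notin> {a..b} \<Longrightarrow> f x = 0" "\<And>x. x \<notin> {a..b} \<Longrightarrow> deriv f x = 0"
proof -
  obtain a b where ab: "0 < a" "\<And>x. x \<notin> {a..b} \<Longrightarrow> f x = 0" using assms unfolding test_function_def by blast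
  have "deriv f x = 0" if "x \<notin> {a..b}" for x
  proof (rule DERIV_imp_deriv)
    have "((\<lambda>x. 0) has_real_derivative 0) (at x)" by simp
    then show "(f has_real_derivative 0) (at x)"
      by (rule has_field_derivative_transform_within_open[where S = "- {a..b}"]) (use that ab in auto)
  qed
  with ab show thesis by (rule that)
qed

lemma test_function_measurable:
  assumes "test_function f"
  shows "f \<in> borel_measurable half_line" "deriv f \<in> borel_measurable half_line"
proof -
  have "smooth f" using assms by (simp add: test_function_iff_smooth)
  then show "f \<in> borel_measurable half_line" "deriv f \<in> borel_measurable half_line"
    by (auto intro!: continuous_imp_measurable_on_sets_lebesgue smooth_continuous smooth_deriv)
qed

lemma weak_deriv_spec:
  assumes "in_H1 u"
  shows "in_Lq 2 (weak_deriv u)" "is_weak_deriv u (weak_deriv u)"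
  using assms someI_ex[of "\<lambda>g. in_Lq 2 g \<and> is_weak_deriv u g"] unfolding in_H1_def weak_deriv_def by auto

lemma primitive_on_indefinite_integral:
  assumes "g absolutely_integrable_on {0..X}"
  shows "primitive_on (\<lambda>x. C + integral {0..x} g) g 0 X"
  using assms by (simp add: primitive_on_def)

text \<open>
  The difference of \<open>u\<close> and a primitive of its weak derivative is orthogonal to the derivatives of all
  test functions, hence constant almost everywhere.
\<close>

theorem H1_rep_of_in_H1:
  assumes "in_H1 u"
  obtains w where "H1_rep w (weak_deriv u)" "eq_ae u w"
proof -
  define g where "g = weak_deriv u"
  have u: "in_Lq 2 u" and g: "in_Lq 2 g" and wd: "is_weak_deriv u g"
    using weak_deriv_spec[OF assms] assms by (auto simp: g_def in_H1_def)
  define P where "P x = integral {0..x} g" for x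
  have pP: "primitive_on P g 0 X" for X
    using primitive_on_indefinite_integral[OF in_Lq_2_absolutely_integrable[OF g, of X], of 0] by (simp add: P_def[abs_def])
  have P0: "P 0 = 0" by (simp add: P_def)
  have "\<exists>C. AE x in half_line. u x - P x = C"
  proof (rule constant_if_orthogonal_to_test_derivatives)
    show "(\<lambda>x. u x - P x) absolutely_integrable_on {0..X}" for X
      by (intro set_integral_diff in_Lq_2_absolutely_integrable u absolutely_integrable_continuous_real
          primitive_on_imp_continuous[OF pP])
    fix f X assume f: "test_function f" and fX: "\<And>x. X < x \<Longrightarrow> f x = 0"
    show "integral {0..X} (\<lambda>x. deriv f x *\<^sub>R (u x - P x)) = 0"
    proof (cases "0 \<le> X")
      case True
      have sm: "smooth f" using f by (simp add: test_function_iff_smooth)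
      obtain a b where ab: "0 < a" "\<And>x. x \<notin> {a..b} \<Longrightarrow> f x = 0" "\<And>x. x \<notin> {a..b} \<Longrightarrow> deriv f x = 0"
        using test_function_support[OF f] by blast
      have dfX: "deriv f x = 0" if "X < x" for x
      proof (rule DERIV_imp_deriv)
        have "((\<lambda>x. 0) has_real_derivative 0) (at x)" by simp
        then show "(f has_real_derivative 0) (at x)"
          by (rule has_field_derivative_transform_within_open[where S = "{X<..}"]) (use that fX in auto)
      qed
      have fX0: "f X = 0"
      proof -
        have "continuous_on {X..} f" by (rule smooth_continuous[OF sm])
        moreover have "closure {X<..} = {X..}" by simp
        ultimately show ?thesis
          by (intro continuous_constant_on_closure[of "{X<..}" f 0 X]) (use fX in auto)
      qed
      have fu: "(\<lambda>x. deriv f x *\<^sub>R u x) absolutely_integrable_on {0..X}"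
        and fg: "(\<lambda>x. f x *\<^sub>R g x) absolutely_integrable_on {0..X}"
        by (intro absolutely_integrable_scaleR_continuous smooth_continuous smooth_deriv sm in_Lq_2_absolutely_integrable u g)+
      have "(LINT x|half_line. deriv f x *\<^sub>R u x) = integral {0..X} (\<lambda>x. deriv f x *\<^sub>R u x)"
        by (rule half_line_integral_compact_support[OF fu ab(1), of "min b X"]) (use ab(3) dfX in \<open>force+\<close>)
      moreover have "(LINT x|half_line. f x *\<^sub>R g x) = integral {0..X} (\<lambda>x. f x *\<^sub>R g x)"
        by (rule half_line_integral_compact_support[OF fg ab(1), of "min b X"]) (use ab(2) fX in \<open>force+\<close>)
      ultimately have 1: "integral {0..X} (\<lambda>x. deriv f x *\<^sub>R u x) = - integral {0..X} (\<lambda>x. f x *\<^sub>R g x)"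
        using wd f unfolding is_weak_deriv_def by simp
      have fui: "(\<lambda>x. deriv f x *\<^sub>R u x) integrable_on {0..X}" and fgi: "(\<lambda>x. f x *\<^sub>R g x) integrable_on {0..X}"
        using fu fg absolutely_integrable_on_def by blast+
      have "((\<lambda>x. deriv f x *\<^sub>R P x + f x *\<^sub>R g x) has_integral 0) {0..X}"
        using integral_by_parts_smooth[OF sm pP True] fX0 P0 by simp
      from has_integral_diff[OF has_integral_add[OF integrable_integral[OF fui] integrable_integral[OF fgi]] this]
      have "((\<lambda>x. deriv f x *\<^sub>R (u x - P x)) has_integral 0) {0..X}"
        unfolding 1 by (simp add: scaleR_diff_right)
      then show ?thesis by (rule integral_unique)
    qed auto
  qed
  then obtain C where C: "AE x in half_line. u x - P x = C" by blast
  define w where "w x = C + P x" for x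
  have eq: "eq_ae u w" using C unfolding eq_ae_def w_def by (auto elim!: AE_mp)
  have "in_Lq 2 w" by (rule in_Lq_cong(1)[OF eq_ae_sym[OF eq] u])
  moreover have "primitive_on w g 0 X" for X
    unfolding w_def P_def by (rule primitive_on_indefinite_integral[OF in_Lq_2_absolutely_integrable[OF g]])
  ultimately have "H1_rep w g" using g unfolding H1_rep_def by blast
  then show thesis using that eq unfolding g_def by blast
qed

text \<open>
  Integration by parts shows that \<open>g\<close> is a weak derivative. The chosen \<open>weak_deriv u\<close> belongs to another
  continuous representative, which agrees with \<open>w\<close>; so both derivatives have the same integrals.
\<close>

theorem in_H1_of_H1_rep:
  assumes rep: "H1_rep w g" and eq: "eq_ae u w"
  shows "in_H1 u" "eq_ae (weak_deriv u) g" "trace0 u = w 0"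
proof -
  have w: "in_Lq 2 w" and g: "in_Lq 2 g" and pr: "primitive_on w g 0 X" for X
    using rep by (auto simp: H1_rep_def)
  have u: "in_Lq 2 u" by (rule in_Lq_cong(1)[OF eq w])
  have "is_weak_deriv u g"
    unfolding is_weak_deriv_def
  proof (intro allI impI)
    fix f assume f: "test_function f"
    have sm: "smooth f" using f by (simp add: test_function_iff_smooth)
    obtain a b where ab: "0 < a" "\<And>x. x \<notin> {a..b} \<Longrightarrow> f x = 0" "\<And>x. x \<notin> {a..b} \<Longrightarrow> deriv f x = 0"
      using test_function_support[OF f] by blast
    \<comment> \<open>One unit beyond the support, so that the boundary term at \<open>X\<close> vanishes.\<close>
    define X where "X = max 0 b + 1"
    have X: "0 \<le> X" "b \<le> X" "X \<notin> {a..b}" by (auto simp: X_def)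
    have fw: "(\<lambda>x. deriv f x *\<^sub>R w x) absolutely_integrable_on {0..X}"
      and fg: "(\<lambda>x. f x *\<^sub>R g x) absolutely_integrable_on {0..X}"
      by (intro absolutely_integrable_scaleR_continuous smooth_continuous smooth_deriv sm in_Lq_2_absolutely_integrable w g)+
    have "(LINT x|half_line. deriv f x *\<^sub>R u x) = (LINT x|half_line. deriv f x *\<^sub>R w x)"
      by (rule half_line_integral_cong[OF eq, where F = "\<lambda>x z. deriv f x *\<^sub>R z"])
        (use test_function_measurable[OF f] u w in \<open>auto simp: in_Lq_def\<close>)
    also have "\<dots> = integral {0..X} (\<lambda>x. deriv f x *\<^sub>R w x)"
      by (rule half_line_integral_compact_support[OF fw ab(1) X(2)]) (use ab(3) in auto)
    finally have 1: "(LINT x|half_line. deriv f x *\<^sub>R u x) = integral {0..X} (\<lambda>x. deriv f x *\<^sub>R w x)" .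
    have 2: "(LINT x|half_line. f x *\<^sub>R g x) = integral {0..X} (\<lambda>x. f x *\<^sub>R g x)"
      by (rule half_line_integral_compact_support[OF fg ab(1) X(2)]) (use ab(2) in auto)
    have "f X = 0" "f 0 = 0" using ab X by auto
    then have "((\<lambda>x. deriv f x *\<^sub>R w x + f x *\<^sub>R g x) has_integral 0) {0..X}"
      using integral_by_parts_smooth[OF sm pr X(1)] by simp
    then have "integral {0..X} (\<lambda>x. deriv f x *\<^sub>R w x) + integral {0..X} (\<lambda>x. f x *\<^sub>R g x) = 0"
      using fw fg absolutely_integrable_on_def by (subst integral_add[symmetric]) (blast, blast, rule integral_unique)
    then show "(LINT x|half_line. deriv f x *\<^sub>R u x) = - (LINT x|half_line. f x *\<^sub>R g x)"
      unfolding 1 2 by (simp add: eq_neg_iff_add_eq_0)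
  qed
  then show H: "in_H1 u" using u g by (auto simp: in_H1_def)
  show "trace0 u = w 0" by (rule trace0_eq[OF H1_rep_continuous[OF rep] eq])
  obtain w' where w': "H1_rep w' (weak_deriv u)" "eq_ae u w'" using H1_rep_of_in_H1[OF H] .
  have same: "w x = w' x" if "0 \<le> x" for x
    by (rule continuous_eq_ae_imp_eq[OF H1_rep_continuous[OF rep] H1_rep_continuous[OF w'(1)] _ that])
      (rule eq_ae_trans[OF eq_ae_sym[OF eq] w'(2)])
  have "AE x in half_line. weak_deriv u x - g x = 0"
  proof (rule AE_zero_if_integrals_zero)
    have g': "in_Lq 2 (weak_deriv u)" and pr': "primitive_on w' (weak_deriv u) 0 X" for X
      using w'(1) by (auto simp: H1_rep_def)
    show "(\<lambda>x. weak_deriv u x - g x) absolutely_integrable_on {0..X}" for X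
      by (intro set_integral_diff in_Lq_2_absolutely_integrable g g')
    fix \<alpha> \<beta> :: real assume ab: "0 < \<alpha>" "\<alpha> < \<beta>"
    have i: "weak_deriv u integrable_on {\<alpha>..\<beta>}" "g integrable_on {\<alpha>..\<beta>}"
      using in_Lq_2_absolutely_integrable[OF g, of \<beta>] in_Lq_2_absolutely_integrable[OF g', of \<beta>] ab
      by (auto simp: absolutely_integrable_on_def intro: integrable_on_subinterval)
    have "integral {\<alpha>..\<beta>} (weak_deriv u) = integral {\<alpha>..\<beta>} g"
      using primitive_on_increment[OF pr, of \<alpha> \<beta> \<beta>] primitive_on_increment[OF pr', of \<alpha> \<beta> \<beta>] same ab by simp
    then show "integral {\<alpha>..\<beta>} (\<lambda>x. weak_deriv u x - g x) = 0"
      using i by (simp add: integral_diff)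
  qed
  then show "eq_ae (weak_deriv u) g" by (simp add: eq_ae_def)
qed

section \<open>The soliton flow as a calibration\<close>

text \<open>
  The positive zero of \<open>\<omega> * s^2 - 2 / (p + 1) * s powr (p + 1)\<close>, that is, the maximum of a soliton.
\<close>

definition peak :: "real \<Rightarrow> real \<Rightarrow> real" where
  "peak p \<omega> = ((p + 1) * \<omega> / 2) powr (1 / (p - 1))"

text \<open>
  The first order form \<open>w' = - flow p \<omega> w\<close> of the stationary equation, valid for decreasing solitons.
\<close>

definition flow :: "real \<Rightarrow> real \<Rightarrow> complex \<Rightarrow> complex" where
  "flow p \<omega> z = (sqrt \<omega> * sqrt (max 0 (1 - (cmod z / peak p \<omega>) powr (p - 1)))) *\<^sub>R z"

text \<open>
  A primitive of \<open>flow\<close>, see \<open>has_derivative_potential\<close>.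
\<close>

definition potential :: "real \<Rightarrow> real \<Rightarrow> complex \<Rightarrow> real" where
  "potential p \<omega> z = sqrt \<omega> * (peak p \<omega>)\<^sup>2 * decay_int p (cmod z / peak p \<omega>)"

definition energy_density :: "real \<Rightarrow> real \<Rightarrow> complex \<Rightarrow> complex \<Rightarrow> real" where
  "energy_density p \<omega> z h = (cmod h)\<^sup>2 + \<omega> * (cmod z)\<^sup>2 - 2 / (p + 1) * cmod z powr (p + 1)"

definition Lq_mass :: "real \<Rightarrow> (real \<Rightarrow> complex) \<Rightarrow> real" where
  "Lq_mass q u = (LINT x|half_line. cmod (u x) powr q)"

lemma peak_pos: "1 < p \<Longrightarrow> 0 < \<omega> \<Longrightarrow> 0 < peak p \<omega>"
  by (simp add: peak_def)

lemma peak_powr: "1 < p \<Longrightarrow> 0 < \<omega> \<Longrightarrow> peak p \<omega> powr (p - 1) = (p + 1) * \<omega> / 2"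
  by (simp add: peak_def powr_powr)

lemma norm_flow_squared:
  assumes "1 < p" "0 < \<omega>" "cmod z \<le> peak p \<omega>"
  shows "(cmod (flow p \<omega> z))\<^sup>2 = \<omega> * (cmod z)\<^sup>2 - 2 / (p + 1) * cmod z powr (p + 1)"
proof -
  have S: "0 < peak p \<omega>" by (rule peak_pos[OF assms(1,2)])
  have "(cmod z / peak p \<omega>) powr (p - 1) \<le> 1 powr (p - 1)"
    using assms S by (intro powr_mono2) (auto simp: divide_simps)
  then have "(cmod (flow p \<omega> z))\<^sup>2 = \<omega> * (1 - (cmod z / peak p \<omega>) powr (p - 1)) * (cmod z)\<^sup>2"
    using assms by (simp add: flow_def power_mult_distrib)
  also have "(cmod z / peak p \<omega>) powr (p - 1) = cmod z powr (p - 1) / ((p + 1) * \<omega> / 2)"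
    using S by (simp add: powr_divide peak_powr[OF assms(1,2)])
  also have "\<omega> * (1 - cmod z powr (p - 1) / ((p + 1) * \<omega> / 2)) * (cmod z)\<^sup>2
      = \<omega> * (cmod z)\<^sup>2 - 2 / (p + 1) * (cmod z powr (p - 1) * (cmod z)\<^sup>2)"
  proof -
    have nz: "p + 1 \<noteq> 0" "\<omega> \<noteq> 0" using assms(1,2) by auto
    have "\<omega> * (1 - Q / ((p + 1) * \<omega> / 2)) = \<omega> - 2 / (p + 1) * Q" for Q
      using nz by (simp add: divide_simps)
    then show ?thesis by (simp add: left_diff_distrib)
  qed
  also have "cmod z powr (p - 1) * (cmod z)\<^sup>2 = cmod z powr (p + 1)"
  proof (cases "z = 0")
    case False
    then have "cmod z powr (p - 1) * (cmod z)\<^sup>2 = cmod z powr (p - 1 + 2)" by (simp only: powr_add) simp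
    also have "p - 1 + 2 = p + 1" by simp
    finally show ?thesis .
  qed simp
  finally show ?thesis .
qed

text \<open>
  The part of the density without \<open>h\<close> is the square of the norm of the flow, so the square can be
  completed. The correction is the derivative of the potential along the function.
\<close>

lemma energy_density_eq_square:
  assumes "1 < p" "0 < \<omega>" "cmod z \<le> peak p \<omega>"
  shows "energy_density p \<omega> z h = (cmod (h + flow p \<omega> z))\<^sup>2 - 2 * (flow p \<omega> z \<bullet> h)"
proof -
  have "(cmod (h + flow p \<omega> z))\<^sup>2 = (cmod h)\<^sup>2 + (cmod (flow p \<omega> z))\<^sup>2 + 2 * (flow p \<omega> z \<bullet> h)"
    by (simp add: power2_norm_eq_inner inner_add_left inner_add_right inner_commute)
  then show ?thesis using norm_flow_squared[OF assms] by (simp add: energy_density_def)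
qed

lemma energy_density_nonneg:
  assumes "1 < p" "0 < \<omega>" "cmod z \<le> peak p \<omega>"
  shows "0 \<le> energy_density p \<omega> z h"
  using norm_flow_squared[OF assms] zero_le_power2[of "cmod (flow p \<omega> z)"] zero_le_power2[of "cmod h"]
  unfolding energy_density_def by linarith

lemma potential_0 [simp]: "potential p \<omega> 0 = 0"
  by (simp add: potential_def)

lemma continuous_on_flow:
  assumes "1 < p"
  shows "continuous_on A (flow p \<omega>)"
proof (cases "peak p \<omega> = 0")
  case True then show ?thesis unfolding flow_def by (auto intro!: continuous_intros)
next
  case False
  then show ?thesis unfolding flow_def using assms by (intro continuous_intros continuous_on_powr') (auto simp: peak_def)
qed

lemma has_derivative_potential:
  assumes "1 < p" "0 < \<omega>"
  shows "(potential p \<omega> has_derivative (\<lambda>h. flow p \<omega> z \<bullet> h)) (at z)"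
proof (cases "z = 0")
  case True
  have S: "0 < peak p \<omega>" by (rule peak_pos[OF assms])
  have "((\<lambda>y. norm (potential p \<omega> y - potential p \<omega> 0 - 0) / norm (y - 0)) \<longlongrightarrow> 0) (at 0)"
  proof (rule Lim_null_comparison[of _ "\<lambda>y. sqrt \<omega> / 2 * cmod y"])
    have "norm (norm (potential p \<omega> y - potential p \<omega> 0 - 0) / norm (y - 0)) \<le> sqrt \<omega> / 2 * cmod y" for y
    proof (cases "y = 0")
      case False
      have le: "decay_int p (cmod y / peak p \<omega>) \<le> (cmod y / peak p \<omega>)\<^sup>2 / 2"
        by (rule decay_int_le[OF assms(1)]) (use S in simp)
      have ge: "0 \<le> decay_int p (cmod y / peak p \<omega>)"
        by (rule decay_int_nonneg[OF assms(1)]) (use S in simp)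
      have "potential p \<omega> y \<le> sqrt \<omega> * (peak p \<omega>)\<^sup>2 * ((cmod y / peak p \<omega>)\<^sup>2 / 2)"
        unfolding potential_def using le assms by (intro mult_left_mono) auto
      also have "\<dots> = sqrt \<omega> / 2 * cmod y * cmod y" using S by (simp add: field_simps power2_eq_square)
      finally have "potential p \<omega> y / cmod y \<le> sqrt \<omega> / 2 * cmod y" using False by (simp add: divide_le_eq)
      moreover have "0 \<le> potential p \<omega> y" unfolding potential_def using ge assms by simp
      ultimately show ?thesis by simp
    qed simp
    then show "\<forall>\<^sub>F y in at 0. norm (norm (potential p \<omega> y - potential p \<omega> 0 - 0) / norm (y - 0)) \<le> sqrt \<omega> / 2 * cmod y"
      by (intro always_eventually) blast
    show "((\<lambda>y. sqrt \<omega> / 2 * cmod y) \<longlongrightarrow> 0) (at 0)" by (auto intro!: tendsto_eq_intros)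
  qed
  then show ?thesis
    unfolding True has_derivative_iff_norm by (simp add: flow_def bounded_linear_inner_right)
next
  case False
  have S: "0 < peak p \<omega>" by (rule peak_pos[OF assms])
  have n: "((\<lambda>z. cmod z / peak p \<omega>) has_derivative (\<lambda>h. (h \<bullet> sgn z) / peak p \<omega>)) (at z)"
    using has_derivative_divide'[OF has_derivative_norm[OF False]] bounded_linear.has_derivative[OF bounded_linear_divide[of "peak p \<omega>"] has_derivative_norm[OF False]] by simp
  have d: "(decay_int p has_derivative (\<lambda>t. decay p (cmod z / peak p \<omega>) * t)) (at (cmod z / peak p \<omega>))"
    using has_real_derivative_decay_int[OF assms(1), of "cmod z / peak p \<omega>"] False S
    unfolding has_field_derivative_def by simp
  have "(potential p \<omega> has_derivative (\<lambda>h. sqrt \<omega> * (peak p \<omega>)\<^sup>2 * (decay p (cmod z / peak p \<omega>) * ((h \<bullet> sgn z) / peak p \<omega>)))) (at z)"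
    unfolding potential_def[abs_def]
    by (rule has_derivative_mult_right, rule has_derivative_compose[OF n d])
  moreover have "sqrt \<omega> * (peak p \<omega>)\<^sup>2 * (decay p (cmod z / peak p \<omega>) * ((h \<bullet> sgn z) / peak p \<omega>)) = flow p \<omega> z \<bullet> h" for h
    using S False by (simp add: decay_def flow_def sgn_div_norm inner_commute[of h] power2_eq_square field_simps)
  ultimately show ?thesis by simp
qed

text \<open>
  Adding the vertex to the half-line changes nothing.
\<close>

lemma half_line_integral_closed:
  fixes f :: "real \<Rightarrow> real"
  assumes "integrable half_line f"
  shows "f absolutely_integrable_on {0..}" "(LINT x|half_line. f x) = integral {0..} f"
proof -
  have n: "negligible {x \<in> {0..} - {0<..}. f x \<noteq> 0}" "negligible {x \<in> {0<..} - {0..}. f x \<noteq> 0}"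
    by (rule negligible_subset[of "{0}"]; auto)+
  have "f absolutely_integrable_on {0<..}"
    using assms by (simp add: integrable_restrict_space set_integrable_def)
  then show "f absolutely_integrable_on {0..}"
    using absolutely_integrable_spike_set_eq[OF n(2,1)] by blast
  have "(LINT x|half_line. f x) = integral {0<..} f"
    using assms by (intro lebesgue_integral_eq_integral) auto
  also have "\<dots> = integral {0..} f" by (rule integral_spike_set[OF n(2,1)])
  finally show "(LINT x|half_line. f x) = integral {0..} f" .
qed

lemma half_line_integral_ge_subinterval:
  fixes f :: "real \<Rightarrow> real"
  assumes "integrable half_line f" "\<And>x. 0 \<le> x \<Longrightarrow> 0 \<le> f x" "0 \<le> a"
  shows "f integrable_on {a..b}" "integral {a..b} f \<le> (LINT x|half_line. f x)"
proof -
  have i: "f integrable_on {0..}" using half_line_integral_closed(1)[OF assms(1)] absolutely_integrable_on_def by blast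
  have "f absolutely_integrable_on {a..b}"
    by (rule set_integrable_subset[OF half_line_integral_closed(1)[OF assms(1)]]) (use assms(3) in auto)
  then show 1: "f integrable_on {a..b}" using absolutely_integrable_on_def by blast
  show "integral {a..b} f \<le> (LINT x|half_line. f x)"
    unfolding half_line_integral_closed(2)[OF assms(1)]
    by (rule integral_subset_le) (use 1 i assms in auto)
qed

lemma half_line_integral_le:
  fixes f :: "real \<Rightarrow> real"
  assumes "integrable half_line f" "\<And>x. 0 \<le> x \<Longrightarrow> 0 \<le> f x" "\<And>X. 0 \<le> X \<Longrightarrow> integral {0..X} f \<le> K"
  shows "(LINT x|half_line. f x) \<le> K"
proof -
  have i: "f integrable_on {0..}" using half_line_integral_closed(1)[OF assms(1)] absolutely_integrable_on_def by blast
  have r: "integral {0..} (\<lambda>x. if x \<in> {0..real n} then f x else 0) = integral {0..real n} f"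
    "(\<lambda>x. if x \<in> {0..real n} then f x else 0) integrable_on {0..}" for n
  proof -
    have e: "{0..real n} \<inter> {0..} = {0..real n}" by auto
    show "integral {0..} (\<lambda>x. if x \<in> {0..real n} then f x else 0) = integral {0..real n} f"
      using integral_restrict_Int[of "{0..}" "{0..real n}" f] unfolding e .
    show "(\<lambda>x. if x \<in> {0..real n} then f x else 0) integrable_on {0..}"
      using half_line_integral_ge_subinterval(1)[OF assms(1,2), of 0 "real n"]
      by (subst integrable_restrict_Int) (simp add: e)
  qed
  have "(\<lambda>n. integral {0..} (\<lambda>x. if x \<in> {0..real n} then f x else 0)) \<longlonglongrightarrow> integral {0..} f"
  proof (rule dominated_convergence(2)[OF r(2) i])
    show "norm (if x \<in> {0..real n} then f x else 0) \<le> f x" if "x \<in> {0..}" for n x using assms(2)[of x] that by auto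
    show "(\<lambda>n. if x \<in> {0..real n} then f x else 0) \<longlonglongrightarrow> f x" if "x \<in> {0..}" for x
    proof (rule tendsto_eventually)
      obtain m :: nat where "x \<le> real m" using real_arch_simple by blast
      then show "\<forall>\<^sub>F n in sequentially. (if x \<in> {0..real n} then f x else 0) = f x"
        using that by (intro eventually_sequentiallyI[of m]) auto
    qed
  qed
  then have "(\<lambda>n. integral {0..real n} f) \<longlonglongrightarrow> integral {0..} f" unfolding r .
  then have "integral {0..} f \<le> K"
    by (rule LIMSEQ_le_const2) (use assms(3) in auto)
  then show ?thesis by (simp add: half_line_integral_closed(2)[OF assms(1)])
qed

lemma in_Lq_2_square_integrable:
  assumes "in_Lq 2 w"
  shows "integrable half_line (\<lambda>x. (cmod (w x))\<^sup>2)" "Lq_mass 2 w = (LINT x|half_line. (cmod (w x))\<^sup>2)"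
  using assms by (simp_all add: in_Lq_def Lq_mass_def)

text \<open>
  Otherwise the square of the function would not be integrable.
\<close>

lemma H1_rep_small_values:
  assumes "H1_rep w g" "0 < \<epsilon>"
  shows "\<exists>Y\<ge>X. cmod (w Y) < \<epsilon>"
proof (rule ccontr)
  assume "\<not> ?thesis"
  then have big: "\<And>Y. X \<le> Y \<Longrightarrow> \<epsilon> \<le> cmod (w Y)" by force
  have w: "integrable half_line (\<lambda>x. (cmod (w x))\<^sup>2)" using assms in_Lq_2_square_integrable by (simp add: H1_rep_def)
  define K where "K = (LINT x|half_line. (cmod (w x))\<^sup>2)"
  define X0 where "X0 = max 0 X"
  have K: "M * \<epsilon>\<^sup>2 \<le> K" if "0 \<le> M" for M
  proof -
    have "M * \<epsilon>\<^sup>2 = integral {X0..X0 + M} (\<lambda>x. \<epsilon>\<^sup>2)" using that by simp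
    also have "\<dots> \<le> integral {X0..X0 + M} (\<lambda>x. (cmod (w x))\<^sup>2)"
    proof (rule integral_le)
      show "(\<lambda>x. (cmod (w x))\<^sup>2) integrable_on {X0..X0 + M}"
        by (rule half_line_integral_ge_subinterval(1)[OF w]) (auto simp: X0_def)
      show "\<epsilon>\<^sup>2 \<le> (cmod (w x))\<^sup>2" if "x \<in> {X0..X0 + M}" for x
        using big[of x] that assms(2) by (intro power_mono) (auto simp: X0_def)
    qed (rule integrable_const_ivl)
    also have "\<dots> \<le> K" unfolding K_def by (rule half_line_integral_ge_subinterval(2)[OF w]) (auto simp: X0_def)
    finally show ?thesis .
  qed
  have "0 \<le> K" using K[of 0] by simp
  from K[of "(K + 1) / \<epsilon>\<^sup>2"] this assms(2) show False by simp
qed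

text \<open>
  From \<open>x\<close> to a later point with a small value, \<open>\<bar>w\<bar>^2\<close> changes by an integral that is bounded by the
  one of \<open>\<bar>w\<bar>^2 + \<bar>g\<bar>^2\<close>.
\<close>

lemma H1_rep_bounded:
  assumes "H1_rep w g"
  shows "\<exists>B>0. \<forall>x\<ge>0. cmod (w x) \<le> B"
proof -
  have w: "integrable half_line (\<lambda>x. (cmod (w x))\<^sup>2)" and g: "integrable half_line (\<lambda>x. (cmod (g x))\<^sup>2)"
    using assms in_Lq_2_square_integrable by (auto simp: H1_rep_def)
  then have i: "integrable half_line (\<lambda>x. (cmod (w x))\<^sup>2 + (cmod (g x))\<^sup>2)" by simp
  define K where "K = (LINT x|half_line. (cmod (w x))\<^sup>2 + (cmod (g x))\<^sup>2)"
  have "(cmod (w x))\<^sup>2 \<le> 1 + K" if x: "0 \<le> x" for x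
  proof -
    obtain Y where Y: "x \<le> Y" "cmod (w Y) < 1" using H1_rep_small_values[OF assms, of 1] by auto
    have "primitive_on w g x Y"
      using assms x unfolding H1_rep_def by (meson order_refl primitive_on_subinterval)
    then have h: "((\<lambda>t. (2 *\<^sub>R w t) \<bullet> g t) has_integral ((cmod (w Y))\<^sup>2 - (cmod (w x))\<^sup>2)) {x..Y}"
      by (rule primitive_on_chain[where \<Psi> = "\<lambda>z. (cmod z)\<^sup>2" and D = "\<lambda>z. 2 *\<^sub>R z"])
        (use Y in \<open>auto intro!: continuous_intros derivative_eq_intros\<close>)
    have "- ((cmod (w Y))\<^sup>2 - (cmod (w x))\<^sup>2) \<le> integral {x..Y} (\<lambda>t. (cmod (w t))\<^sup>2 + (cmod (g t))\<^sup>2)"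
    proof (rule has_integral_le[OF has_integral_neg[OF h] integrable_integral])
      show "(\<lambda>t. (cmod (w t))\<^sup>2 + (cmod (g t))\<^sup>2) integrable_on {x..Y}"
        by (rule half_line_integral_ge_subinterval(1)[OF i _ x]) simp
      show "- ((2 *\<^sub>R w t) \<bullet> g t) \<le> (cmod (w t))\<^sup>2 + (cmod (g t))\<^sup>2" for t
      proof -
        have "0 \<le> (cmod (w t + g t))\<^sup>2" by simp
        then show ?thesis by (simp add: power2_norm_eq_inner inner_add_left inner_add_right inner_commute)
      qed
    qed
    also have "\<dots> \<le> K" unfolding K_def by (rule half_line_integral_ge_subinterval(2)[OF i _ x]) simp
    finally have "(cmod (w x))\<^sup>2 \<le> (cmod (w Y))\<^sup>2 + K" by simp
    moreover have "(cmod (w Y))\<^sup>2 \<le> 1" using Y by (simp add: power_le_one)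
    ultimately show ?thesis by simp
  qed
  then have "cmod (w x) \<le> sqrt (1 + K)" if "0 \<le> x" for x using that by (simp add: real_le_rsqrt)
  moreover have "0 \<le> K" unfolding K_def by (simp add: integral_nonneg_AE)
  ultimately show ?thesis by (intro exI[of _ "sqrt (1 + K)"]) auto
qed

lemma H1_rep_in_Lq:
  assumes "H1_rep w g" "1 < p"
  shows "in_Lq (p + 1) w"
proof -
  obtain B where B: "0 < B" "\<And>x. 0 \<le> x \<Longrightarrow> cmod (w x) \<le> B" using H1_rep_bounded[OF assms(1)] by auto
  have m: "w \<in> borel_measurable half_line" using assms by (auto simp: H1_rep_def in_Lq_def)
  have "integrable half_line (\<lambda>x. cmod (w x) powr (p + 1))"
  proof (rule measurable_bounded_by_integrable_imp_lebesgue_integrable[where g = "\<lambda>x. B powr (p - 1) * (cmod (w x))\<^sup>2"])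
    show "(\<lambda>x. cmod (w x) powr (p + 1)) \<in> borel_measurable half_line" using m by simp
    show "integrable half_line (\<lambda>x. B powr (p - 1) * (cmod (w x))\<^sup>2)"
      using assms in_Lq_2_square_integrable by (auto simp: H1_rep_def)
    show "norm (cmod (w x) powr (p + 1)) \<le> B powr (p - 1) * (cmod (w x))\<^sup>2" if "x \<in> {0<..}" for x
    proof (cases "w x = 0")
      case False
      \<comment> \<open>Boundedness turns the excess power \<open>p - 1\<close> into a constant.\<close>
      have "cmod (w x) powr (p + 1) = cmod (w x) powr (p - 1 + 2)" by (simp add: add.commute)
      also have "\<dots> = cmod (w x) powr (p - 1) * (cmod (w x))\<^sup>2" using False by (simp only: powr_add) simp
      also have "\<dots> \<le> B powr (p - 1) * (cmod (w x))\<^sup>2"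
        using B(2)[of x] that assms(2) by (intro mult_right_mono powr_mono2) auto
      finally show ?thesis by simp
    qed simp
  qed auto
  then show ?thesis using m by (simp add: in_Lq_def)
qed

section \<open>Lower bounds for the energy of one edge\<close>

definition quad_form :: "real \<Rightarrow> (real \<Rightarrow> complex) \<Rightarrow> (real \<Rightarrow> complex) \<Rightarrow> real" where
  "quad_form \<omega> w g = Lq_mass 2 g + \<omega> * Lq_mass 2 w"

text \<open>
  The contribution of one edge to twice the action.
\<close>

definition free_energy :: "real \<Rightarrow> real \<Rightarrow> (real \<Rightarrow> complex) \<Rightarrow> (real \<Rightarrow> complex) \<Rightarrow> real" where
  "free_energy p \<omega> w g = quad_form \<omega> w g - 2 / (p + 1) * Lq_mass (p + 1) w"

definition sup_norm :: "(real \<Rightarrow> complex) \<Rightarrow> real" where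
  "sup_norm w = (SUP x\<in>{0..}. cmod (w x))"

lemma le_sup_norm:
  assumes "H1_rep w g" "0 \<le> x"
  shows "cmod (w x) \<le> sup_norm w"
proof -
  obtain B where "\<And>x. 0 \<le> x \<Longrightarrow> cmod (w x) \<le> B" using H1_rep_bounded[OF assms(1)] by auto
  then have "bdd_above ((\<lambda>x. cmod (w x)) ` {0..})" by (auto intro!: bdd_aboveI)
  then show ?thesis unfolding sup_norm_def using assms(2) by (intro cSUP_upper) auto
qed

lemma sup_norm_le: "(\<And>x. 0 \<le> x \<Longrightarrow> cmod (w x) \<le> M) \<Longrightarrow> sup_norm w \<le> M"
  unfolding sup_norm_def by (intro cSUP_least) auto

lemma energy_integral:
  assumes "H1_rep w g" "1 < p"
  shows "integrable half_line (\<lambda>x. energy_density p \<omega> (w x) (g x))"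
    and "(LINT x|half_line. energy_density p \<omega> (w x) (g x)) = free_energy p \<omega> w g"
proof -
  have w: "in_Lq 2 w" and g: "in_Lq 2 g" using assms by (auto simp: H1_rep_def)
  note i = in_Lq_2_square_integrable(1)[OF w] in_Lq_2_square_integrable(1)[OF g]
  have ip: "integrable half_line (\<lambda>x. cmod (w x) powr (p + 1))"
    using H1_rep_in_Lq[OF assms] by (simp add: in_Lq_def)
  show "integrable half_line (\<lambda>x. energy_density p \<omega> (w x) (g x))"
    unfolding energy_density_def using i ip by simp
  show "(LINT x|half_line. energy_density p \<omega> (w x) (g x)) = free_energy p \<omega> w g"
    unfolding energy_density_def free_energy_def quad_form_def in_Lq_2_square_integrable(2)[OF w] in_Lq_2_square_integrable(2)[OF g]
    using i ip by (simp add: Lq_mass_def)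
qed

lemma energy_on_interval:
  assumes "H1_rep w g" "1 < p" "0 < \<omega>" "\<And>x. 0 \<le> x \<Longrightarrow> cmod (w x) \<le> peak p \<omega>" "0 \<le> a" "a \<le> b"
  shows "((\<lambda>x. (cmod (g x + flow p \<omega> (w x)))\<^sup>2) has_integral
    integral {a..b} (\<lambda>x. energy_density p \<omega> (w x) (g x)) + 2 * (potential p \<omega> (w b) - potential p \<omega> (w a))) {a..b}"
proof -
  have "primitive_on w g a b"
    using assms(1,5) unfolding H1_rep_def by (meson order_refl primitive_on_subinterval)
  then have f: "((\<lambda>x. flow p \<omega> (w x) \<bullet> g x) has_integral (potential p \<omega> (w b) - potential p \<omega> (w a))) {a..b}"
    by (rule primitive_on_chain) (use assms in \<open>auto intro: has_derivative_potential continuous_on_flow\<close>)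
  have "(\<lambda>x. energy_density p \<omega> (w x) (g x)) integrable_on {a..b}"
    by (rule half_line_integral_ge_subinterval(1)[OF energy_integral(1)[OF assms(1,2)]])
      (use assms energy_density_nonneg in auto)
  from has_integral_add[OF integrable_integral[OF this] has_integral_mult_right[OF f, of 2]]
  show ?thesis
    by (rule has_integral_eq[rotated]) (use assms in \<open>simp add: energy_density_eq_square\<close>)
qed

lemma potential_vanishes:
  assumes "H1_rep w g" "1 < p" "0 < \<omega>" "0 < \<epsilon>"
  shows "\<exists>Y\<ge>X. potential p \<omega> (w Y) < \<epsilon>"
proof -
  have "(potential p \<omega> \<longlongrightarrow> potential p \<omega> 0) (at 0)"
    using has_derivative_continuous[OF has_derivative_potential[OF assms(2,3), of 0]] continuous_within by blast
  then have "\<forall>\<^sub>F z in at 0. dist (potential p \<omega> z) (potential p \<omega> 0) < \<epsilon>" using assms(4) by (rule tendstoD)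
  then obtain d where d: "0 < d" "\<And>z. z \<noteq> 0 \<Longrightarrow> dist z 0 < d \<Longrightarrow> dist (potential p \<omega> z) (potential p \<omega> 0) < \<epsilon>"
    unfolding eventually_at by auto
  obtain Y where Y: "X \<le> Y" "cmod (w Y) < d" using H1_rep_small_values[OF assms(1) d(1)] by blast
  then have "potential p \<omega> (w Y) < \<epsilon>" using d(2)[of "w Y"] assms(4) by (cases "w Y = 0") (auto simp: dist_real_def)
  then show ?thesis using Y by blast
qed

text \<open>
  Dropping the square and the part of the integral before \<open>x\<close> leaves the change of the potential from \<open>x\<close>
  to infinity, where it vanishes.
\<close>

theorem energy_ge_potential:
  assumes "H1_rep w g" "1 < p" "0 < \<omega>" "\<And>x. 0 \<le> x \<Longrightarrow> cmod (w x) \<le> peak p \<omega>" "0 \<le> x"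
  shows "2 * potential p \<omega> (w x) \<le> free_energy p \<omega> w g"
proof (rule field_le_epsilon)
  fix \<epsilon> :: real assume "0 < \<epsilon>"
  then obtain Y where Y: "x \<le> Y" "potential p \<omega> (w Y) < \<epsilon> / 2" using potential_vanishes[OF assms(1-3), of "\<epsilon> / 2" x] by auto
  have "0 \<le> integral {x..Y} (\<lambda>x. energy_density p \<omega> (w x) (g x)) + 2 * (potential p \<omega> (w Y) - potential p \<omega> (w x))"
    by (rule has_integral_nonneg[OF energy_on_interval[OF assms(1-5) Y(1)]]) auto
  moreover have "integral {x..Y} (\<lambda>x. energy_density p \<omega> (w x) (g x)) \<le> free_energy p \<omega> w g"
    unfolding energy_integral(2)[OF assms(1,2), symmetric]
    by (rule half_line_integral_ge_subinterval(2)[OF energy_integral(1)[OF assms(1,2)]])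
      (use assms energy_density_nonneg in auto)
  ultimately show "2 * potential p \<omega> (w x) \<le> free_energy p \<omega> w g + \<epsilon>"
    using Y(2) by argo
qed

text \<open>
  The bound holds at every point, hence at the supremum. A function whose maximum lies inside the edge
  is thereby treated like one with its maximum at the vertex.
\<close>

corollary energy_ge_sup:
  assumes "H1_rep w g" "1 < p" "0 < \<omega>" "sup_norm w \<le> peak p \<omega>"
  shows "2 * (sqrt \<omega> * (peak p \<omega>)\<^sup>2 * decay_int p (sup_norm w / peak p \<omega>)) \<le> free_energy p \<omega> w g"
proof -
  have le: "cmod (w x) \<le> peak p \<omega>" if "0 \<le> x" for x using le_sup_norm[OF assms(1) that] assms(4) by simp
  have S: "0 < peak p \<omega>" by (rule peak_pos[OF assms(2,3)])
  define A where "A = (\<lambda>x. cmod (w x)) ` {0..}"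
  obtain B where B: "\<And>x. 0 \<le> x \<Longrightarrow> cmod (w x) \<le> B" using H1_rep_bounded[OF assms(1)] by auto
  have in_closure: "Sup A \<in> closure A" unfolding A_def by (rule closure_contains_Sup) (use B in \<open>auto intro!: bdd_aboveI\<close>)
  have "closure A \<subseteq> {0..}" by (rule closure_minimal) (auto simp: A_def)
  then have cont: "continuous_on (closure A) (\<lambda>t. 2 * (sqrt \<omega> * (peak p \<omega>)\<^sup>2 * decay_int p (t / peak p \<omega>)))"
    using S by (intro continuous_intros continuous_on_compose2[OF continuous_on_decay_int[OF assms(2)]]) auto
  have "2 * (sqrt \<omega> * (peak p \<omega>)\<^sup>2 * decay_int p (t / peak p \<omega>)) \<le> free_energy p \<omega> w g"
    if "t \<in> A" for t
    using that energy_ge_potential[OF assms(1-3) le] unfolding A_def potential_def by blast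
  from continuous_le_on_closure[OF cont in_closure this]
  have "2 * (sqrt \<omega> * (peak p \<omega>)\<^sup>2 * decay_int p (Sup A / peak p \<omega>)) \<le> free_energy p \<omega> w g" .
  then show ?thesis by (simp add: sup_norm_def A_def)
qed

text \<open>
  In the case of equality the integral of the square in \<open>energy_density_eq_square\<close> vanishes.
\<close>

theorem energy_equality_imp_flow:
  assumes "H1_rep w g" "1 < p" "0 < \<omega>" "\<And>x. 0 \<le> x \<Longrightarrow> cmod (w x) \<le> peak p \<omega>"
    and eq: "free_energy p \<omega> w g \<le> 2 * potential p \<omega> (w 0)"
  shows "eq_ae g (\<lambda>x. - flow p \<omega> (w x))"
proof -
  let ?s = "\<lambda>x. g x + flow p \<omega> (w x)"
  have sq: "(\<lambda>x. (cmod (?s x))\<^sup>2) integrable_on {0..X}" for X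
  proof (cases "0 \<le> X")
    case True then show ?thesis using energy_on_interval[OF assms(1-4), of 0 X] by blast
  qed auto
  have small: "integral {0..X} (\<lambda>x. (cmod (?s x))\<^sup>2) = 0" if X: "0 \<le> X" for X
  proof (rule antisym)
    show "integral {0..X} (\<lambda>x. (cmod (?s x))\<^sup>2) \<le> 0"
    proof (rule field_le_epsilon)
      fix \<epsilon> :: real assume "0 < \<epsilon>"
      then obtain Y where Y: "X \<le> Y" "potential p \<omega> (w Y) < \<epsilon> / 2" using potential_vanishes[OF assms(1-3), of "\<epsilon> / 2" X] by auto
      have "integral {0..X} (\<lambda>x. (cmod (?s x))\<^sup>2) \<le> integral {0..Y} (\<lambda>x. (cmod (?s x))\<^sup>2)"
        by (rule integral_subset_le) (use Y sq in auto)
      also have "\<dots> = integral {0..Y} (\<lambda>x. energy_density p \<omega> (w x) (g x)) + 2 * (potential p \<omega> (w Y) - potential p \<omega> (w 0))"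
        by (rule integral_unique[OF energy_on_interval[OF assms(1-4)]]) (use X Y in auto)
      finally have 1: "integral {0..X} (\<lambda>x. (cmod (?s x))\<^sup>2)
        \<le> integral {0..Y} (\<lambda>x. energy_density p \<omega> (w x) (g x)) + 2 * (potential p \<omega> (w Y) - potential p \<omega> (w 0))" .
      have 2: "integral {0..Y} (\<lambda>x. energy_density p \<omega> (w x) (g x)) \<le> free_energy p \<omega> w g"
        unfolding energy_integral(2)[OF assms(1,2), symmetric]
        by (rule half_line_integral_ge_subinterval(2)[OF energy_integral(1)[OF assms(1,2)]])
          (use assms energy_density_nonneg in auto)
      have "a \<le> 0 + \<epsilon>" if "a \<le> b + 2 * (c - d)" "b \<le> e" "c < \<epsilon> / 2" "e \<le> 2 * d" for a b c d e
        using that by argo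
      from this[OF 1 2 Y(2) eq] show "integral {0..X} (\<lambda>x. (cmod (?s x))\<^sup>2) \<le> 0 + \<epsilon>" .
    qed
    show "0 \<le> integral {0..X} (\<lambda>x. (cmod (?s x))\<^sup>2)" by (rule integral_nonneg[OF sq]) simp
  qed
  define h where "h x = complex_of_real ((cmod (?s x))\<^sup>2)" for x
  have "AE x in half_line. h x = 0"
  proof (rule AE_zero_if_integrals_zero)
    have "(\<lambda>x. (cmod (?s x))\<^sup>2) absolutely_integrable_on {0..X}" for X
      by (rule nonnegative_absolutely_integrable_1[OF sq]) simp
    from absolutely_integrable_linear[OF this bounded_linear_of_real]
    show "h absolutely_integrable_on {0..X}" for X by (simp add: h_def[abs_def] o_def)
    fix a b :: real assume ab: "0 < a" "a < b"
    have i: "(\<lambda>x. (cmod (?s x))\<^sup>2) integrable_on {a..b}"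
      by (rule integrable_on_subinterval[OF sq[of b]]) (use ab in auto)
    have "integral {a..b} (\<lambda>x. (cmod (?s x))\<^sup>2) \<le> integral {0..b} (\<lambda>x. (cmod (?s x))\<^sup>2)"
      by (rule integral_subset_le) (use ab i sq in auto)
    moreover have "0 \<le> integral {a..b} (\<lambda>x. (cmod (?s x))\<^sup>2)" by (rule integral_nonneg[OF i]) simp
    ultimately have "((\<lambda>x. (cmod (?s x))\<^sup>2) has_integral 0) {a..b}"
      using small[of b] ab i by (simp add: has_integral_iff)
    from has_integral_linear[OF this bounded_linear_of_real[where 'a = complex]]
    show "integral {a..b} h = 0" by (simp add: h_def[abs_def] o_def integral_unique)
  qed
  then show ?thesis
    unfolding eq_ae_def h_def by (rule AE_mp) (auto simp: eq_neg_iff_add_eq_0)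
qed

theorem energy_of_flow:
  assumes "H1_rep w g" "1 < p" "0 < \<omega>" "\<And>x. 0 \<le> x \<Longrightarrow> cmod (w x) \<le> peak p \<omega>"
    and flow: "\<And>x. 0 \<le> x \<Longrightarrow> g x = - flow p \<omega> (w x)"
  shows "free_energy p \<omega> w g = 2 * potential p \<omega> (w 0)"
proof (rule antisym)
  show "2 * potential p \<omega> (w 0) \<le> free_energy p \<omega> w g"
    by (rule energy_ge_potential[OF assms(1-4)]) auto
  show "free_energy p \<omega> w g \<le> 2 * potential p \<omega> (w 0)"
    unfolding energy_integral(2)[OF assms(1,2), symmetric]
  proof (rule half_line_integral_le[OF energy_integral(1)[OF assms(1,2)]])
    show "0 \<le> energy_density p \<omega> (w x) (g x)" if "0 \<le> x" for x
      using energy_density_nonneg assms that by blast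
    fix X :: real assume X: "0 \<le> X"
    have "((\<lambda>x. (cmod (g x + flow p \<omega> (w x)))\<^sup>2) has_integral 0) {0..X}"
      by (rule has_integral_is_0) (simp add: flow)
    from has_integral_unique[OF this energy_on_interval[OF assms(1-4) order_refl X]]
    have "integral {0..X} (\<lambda>x. energy_density p \<omega> (w x) (g x)) = 2 * potential p \<omega> (w 0) - 2 * potential p \<omega> (w X)"
      by simp
    moreover have "0 \<le> potential p \<omega> (w X)"
      unfolding potential_def using peak_pos[OF assms(2,3)] assms(2,3)
      by (intro mult_nonneg_nonneg decay_int_nonneg) auto
    ultimately show "integral {0..X} (\<lambda>x. energy_density p \<omega> (w x) (g x)) \<le> 2 * potential p \<omega> (w 0)" by simp
  qed
qed

section \<open>Solitons and uniqueness for the flow\<close>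

lemma phi_eq_cosh:
  assumes "1 < p" "0 < \<omega>"
  shows "phi p \<omega> a x = peak p \<omega> * cosh ((p - 1) * sqrt \<omega> / 2 * (x + a)) powr (- 2 / (p - 1))"
proof -
  define c where "c = cosh ((p - 1) * sqrt \<omega> / 2 * (x + a))"
  have c: "0 < c" by (simp add: c_def)
  have "((1 / c)\<^sup>2) powr (1 / (p - 1)) = (c powr (- 2)) powr (1 / (p - 1))"
    using c by (simp add: powr_minus powr_numeral power_divide inverse_eq_divide)
  also have "\<dots> = c powr (- 2 / (p - 1))" by (simp add: powr_powr)
  finally show ?thesis using assms c unfolding phi_def c_def[symmetric] peak_def
    by (subst powr_mult) auto
qed

lemma phi_pos: "1 < p \<Longrightarrow> 0 < \<omega> \<Longrightarrow> 0 < phi p \<omega> a x"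
  by (simp add: phi_eq_cosh peak_pos)

lemma phi_over_peak_powr:
  assumes "1 < p" "0 < \<omega>"
  shows "(phi p \<omega> a x / peak p \<omega>) powr (p - 1) = 1 - (tanh ((p - 1) * sqrt \<omega> / 2 * (x + a)))\<^sup>2"
proof -
  define z where "z = (p - 1) * sqrt \<omega> / 2 * (x + a)"
  have "(phi p \<omega> a x / peak p \<omega>) powr (p - 1) = (cosh z powr (- 2 / (p - 1))) powr (p - 1)"
    using peak_pos[OF assms] by (simp add: phi_eq_cosh[OF assms] z_def)
  also have "\<dots> = cosh z powr (- 2 / (p - 1) * (p - 1))" by (rule powr_powr)
  also have "- 2 / (p - 1) * (p - 1) = - 2" using assms by (simp add: divide_simps)
  also have "cosh z powr (- 2) = 1 / (cosh z)\<^sup>2" by (simp add: powr_minus powr_numeral inverse_eq_divide)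
  also have "\<dots> = 1 - (tanh z)\<^sup>2"
    using hyperbolic_pythagoras[of z] by (simp add: tanh_def power_divide divide_simps)
  finally show ?thesis by (simp add: z_def)
qed

lemma phi_le_peak:
  assumes "1 < p" "0 < \<omega>"
  shows "phi p \<omega> a x \<le> peak p \<omega>"
proof -
  have "cosh ((p - 1) * sqrt \<omega> / 2 * (x + a)) powr (- 2 / (p - 1)) \<le> cosh ((p - 1) * sqrt \<omega> / 2 * (x + a)) powr 0"
    using assms by (intro powr_mono) (auto simp: cosh_real_ge_1)
  then show ?thesis using peak_pos[OF assms] by (simp add: phi_eq_cosh[OF assms])
qed

lemma has_real_derivative_phi:
  assumes "1 < p" "0 < \<omega>"
  shows "(phi p \<omega> a has_real_derivative - (sqrt \<omega> * tanh ((p - 1) * sqrt \<omega> / 2 * (x + a)) * phi p \<omega> a x)) (at x)"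
proof -
  define k where "k = (p - 1) * sqrt \<omega> / 2"
  have d: "((\<lambda>x. cosh (k * (x + a))) has_real_derivative sinh (k * (x + a)) * k) (at x)"
    by (auto intro!: derivative_eq_intros)
  have d2: "((\<lambda>x. peak p \<omega> * cosh (k * (x + a)) powr (- 2 / (p - 1))) has_real_derivative
     peak p \<omega> * (- 2 / (p - 1) * cosh (k * (x + a)) powr (- 2 / (p - 1) - of_nat 1) * (sinh (k * (x + a)) * k))) (at x)"
    by (intro DERIV_cmult DERIV_fun_powr d) simp
  have eq: "peak p \<omega> * (- 2 / (p - 1) * cosh (k * (x + a)) powr (- 2 / (p - 1) - of_nat 1) * (sinh (k * (x + a)) * k))
      = - (2 * k / (p - 1)) * (sinh (k * (x + a)) / cosh (k * (x + a))) * (peak p \<omega> * cosh (k * (x + a)) powr (- 2 / (p - 1)))"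
    by (simp add: powr_diff)
  have k: "2 * k / (p - 1) = sqrt \<omega>" using assms by (simp add: k_def)
  show ?thesis
    using d2 unfolding eq k phi_eq_cosh[OF assms, abs_def] k_def[symmetric] tanh_def
    by (simp only: mult_minus_left)
qed

text \<open>
  On \<open>x + a \<ge> 0\<close> the hyperbolic tangent is nonnegative, so it is the square root occurring in the flow;
  this is the logarithmic derivative of \<open>phi\<close> up to its sign.
\<close>

lemma flow_phi:
  assumes "1 < p" "0 < \<omega>" "0 \<le> x + a" "cmod u = 1"
  shows "flow p \<omega> (u * of_real (phi p \<omega> a x))
    = (sqrt \<omega> * tanh ((p - 1) * sqrt \<omega> / 2 * (x + a))) *\<^sub>R (u * of_real (phi p \<omega> a x))"
proof -
  have "0 \<le> (p - 1) * sqrt \<omega> / 2 * (x + a)" using assms by (intro mult_nonneg_nonneg) auto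
  then have t: "0 \<le> tanh ((p - 1) * sqrt \<omega> / 2 * (x + a))" by simp
  have "cmod (u * of_real (phi p \<omega> a x)) = phi p \<omega> a x"
    using assms(4) phi_pos[OF assms(1,2), of a x] by (simp add: norm_mult)
  then show ?thesis unfolding flow_def using t by (simp add: phi_over_peak_powr[OF assms(1,2)] del: tanh_real_nonneg_iff)
qed

lemma phi_exponential_decay:
  assumes "1 < p" "0 < \<omega>"
  shows "\<exists>C\<ge>0. \<forall>x. phi p \<omega> a x \<le> C * exp (- sqrt \<omega> * x)"
proof -
  define r where "r = - 2 / (p - 1)"
  define C where "C = peak p \<omega> * exp (- sqrt \<omega> * a) / 2 powr r"
  have "phi p \<omega> a x \<le> C * exp (- sqrt \<omega> * x)" for x
  proof -
    define z where "z = (p - 1) * sqrt \<omega> / 2 * (x + a)"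
    have "exp z / 2 \<le> cosh z" by (simp add: cosh_field_def)
    then have "cosh z powr r \<le> (exp z / 2) powr r"
      using assms by (intro powr_mono2') (auto simp: r_def)
    also have "\<dots> = exp (r * z) / 2 powr r"
      unfolding powr_divide by (simp add: powr_def)
    also have "r * z = - sqrt \<omega> * a + - sqrt \<omega> * x"
      using assms by (simp add: z_def r_def field_simps)
    finally have "peak p \<omega> * cosh z powr r \<le> peak p \<omega> * (exp (- sqrt \<omega> * a) * exp (- sqrt \<omega> * x) / 2 powr r)"
      unfolding exp_add using peak_pos[OF assms] by (intro mult_left_mono) auto
    then show ?thesis
      unfolding phi_eq_cosh[OF assms] z_def[symmetric] r_def[symmetric] C_def by (simp add: mult_ac)
  qed
  moreover have "0 \<le> C" using peak_pos[OF assms] by (simp add: C_def)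
  ultimately show ?thesis by blast
qed

lemma in_Lq_2_exponential_bound:
  assumes "u \<in> borel_measurable half_line" "0 < k" "\<And>x. 0 < x \<Longrightarrow> cmod (u x) \<le> C * exp (- k * x)"
  shows "in_Lq 2 u"
proof -
  have "(\<lambda>x. C\<^sup>2 * exp (- (2 * k) * x)) absolutely_integrable_on {0..}"
    using has_integral_exp_minus_to_infinity[of "2 * k" 0] assms(2)
    by (intro nonnegative_absolutely_integrable_1 integrable_on_mult_right) (auto simp: integrable_on_def)
  then have "(\<lambda>x. C\<^sup>2 * exp (- (2 * k) * x)) absolutely_integrable_on {0<..}"
    by (rule set_integrable_subset) auto
  then have i: "integrable half_line (\<lambda>x. C\<^sup>2 * exp (- (2 * k) * x))"
    by (intro absolutely_integrable_imp_integrable) auto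
  have "integrable half_line (\<lambda>x. (cmod (u x))\<^sup>2)"
  proof (rule measurable_bounded_by_integrable_imp_lebesgue_integrable[OF _ i])
    show "(\<lambda>x. (cmod (u x))\<^sup>2) \<in> borel_measurable half_line" using assms(1) by measurable
    fix x :: real assume "x \<in> {0<..}"
    then have "(cmod (u x))\<^sup>2 \<le> (C * exp (- k * x))\<^sup>2" using assms(3) by (intro power_mono) auto
    also have "\<dots> = C\<^sup>2 * exp (- (2 * k) * x)"
      by (simp add: power_mult_distrib power2_eq_square[of "exp _"] flip: exp_add)
    finally show "norm ((cmod (u x))\<^sup>2) \<le> C\<^sup>2 * exp (- (2 * k) * x)" by simp
  qed auto
  then show ?thesis using assms(1) by (simp add: in_Lq_def)
qed

lemma H1_rep_phi:
  assumes "1 < p" "0 < \<omega>" "0 \<le> a" "cmod u = 1"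
  defines "W \<equiv> (\<lambda>x. u * of_real (phi p \<omega> a x))"
  shows "H1_rep W (\<lambda>x. - flow p \<omega> (W x))"
proof -
  have cphi: "continuous_on A (phi p \<omega> a)" for A
    by (meson DERIV_continuous_on has_field_derivative_at_within has_real_derivative_phi[OF assms(1,2)])
  have cW: "continuous_on A W" for A unfolding W_def by (intro continuous_intros cphi)
  have cF: "continuous_on A (\<lambda>x. - flow p \<omega> (W x))" for A
    by (intro continuous_intros continuous_on_compose2[OF continuous_on_flow[OF assms(1)] cW]) auto
  have mW: "W \<in> borel_measurable half_line" and mF: "(\<lambda>x. - flow p \<omega> (W x)) \<in> borel_measurable half_line"
    by (intro continuous_imp_measurable_on_sets_lebesgue cW cF; simp)+
  obtain C where C: "0 \<le> C" "\<And>x. phi p \<omega> a x \<le> C * exp (- sqrt \<omega> * x)"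
    using phi_exponential_decay[OF assms(1,2)] by blast
  have nW: "cmod (W x) = phi p \<omega> a x" for x
    using assms(4) phi_pos[OF assms(1,2), of a x] by (simp add: W_def norm_mult)
  have nF: "cmod (flow p \<omega> z) \<le> sqrt \<omega> * cmod z" for z
  proof -
    have "sqrt (max 0 (1 - (cmod z / peak p \<omega>) powr (p - 1))) \<le> 1" by simp
    then have "sqrt \<omega> * sqrt (max 0 (1 - (cmod z / peak p \<omega>) powr (p - 1))) * cmod z \<le> sqrt \<omega> * 1 * cmod z"
      using assms by (intro mult_right_mono mult_left_mono) auto
    then show ?thesis using assms by (simp add: flow_def)
  qed
  have "in_Lq 2 W"
    by (rule in_Lq_2_exponential_bound[OF mW, of "sqrt \<omega>" C]) (use C(2) nW assms in auto)
  moreover have "in_Lq 2 (\<lambda>x. - flow p \<omega> (W x))"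
  proof (rule in_Lq_2_exponential_bound[OF mF, of "sqrt \<omega>" "sqrt \<omega> * C"])
    fix x
    have "cmod (flow p \<omega> (W x)) \<le> sqrt \<omega> * phi p \<omega> a x" using nF[of "W x"] nW by simp
    also have "\<dots> \<le> sqrt \<omega> * (C * exp (- sqrt \<omega> * x))" using C(2) assms by (intro mult_left_mono) auto
    finally show "cmod (- flow p \<omega> (W x)) \<le> sqrt \<omega> * C * exp (- sqrt \<omega> * x)" by (simp add: mult.assoc)
  qed (use assms in auto)
  moreover have "primitive_on W (\<lambda>x. - flow p \<omega> (W x)) 0 X" for X
  proof (rule primitive_onI_deriv[OF _ cF])
    fix x :: real assume "x \<in> {0..X}"
    then have "0 \<le> x + a" using assms(3) by simp
    from flow_phi[OF assms(1,2) this assms(4)]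
    have F: "- flow p \<omega> (W x) = u * of_real (- (sqrt \<omega> * tanh ((p - 1) * sqrt \<omega> / 2 * (x + a)) * phi p \<omega> a x))"
      by (simp add: W_def scaleR_conv_of_real mult_ac)
    have "((\<lambda>x. complex_of_real (phi p \<omega> a x)) has_vector_derivative
       of_real (- (sqrt \<omega> * tanh ((p - 1) * sqrt \<omega> / 2 * (x + a)) * phi p \<omega> a x))) (at x)"
      using has_real_derivative_phi[OF assms(1,2), of a x] has_vector_derivative_of_real
        has_real_derivative_iff_has_vector_derivative by blast
    then have "(W has_vector_derivative u * of_real (- (sqrt \<omega> * tanh ((p - 1) * sqrt \<omega> / 2 * (x + a)) * phi p \<omega> a x))) (at x)"
      unfolding W_def by (rule has_vector_derivative_mult_right)
    then have "(W has_vector_derivative - flow p \<omega> (W x)) (at x)" by (simp only: F)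
    then show "(W has_vector_derivative - flow p \<omega> (W x)) (at x within {0..X})"
      by (rule has_vector_derivative_at_within)
  qed
  ultimately show ?thesis by (simp add: H1_rep_def)
qed


lemma tanh_artanh_eq:
  fixes t :: real
  assumes "\<bar>t\<bar> < 1"
  shows "tanh (artanh t) = t"
proof -
  have t: "0 < 1 + t" "0 < 1 - t" using assms by (auto simp: abs_less_iff)
  have "exp (- 2 * artanh t) = inverse ((1 + t) / (1 - t))"
    using t by (simp add: artanh_def exp_minus)
  then have e: "exp (- 2 * artanh t) = (1 - t) / (1 + t)" by simp
  show ?thesis unfolding tanh_real_altdef e using t by (simp add: divide_simps)
qed

lemma powr_inj_pos:
  fixes a b r :: real
  assumes "0 < r" "0 < a" "0 < b" "a powr r = b powr r"
  shows "a = b"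
proof -
  have "(a powr r) powr (1 / r) = (b powr r) powr (1 / r)" using assms(4) by simp
  then show ?thesis using assms(1-3) by (simp add: powr_powr)
qed

text \<open>
  The flow multiplies by a real factor, so the phase of \<open>w\<close> is constant. Its modulus is determined
  because the inverse hyperbolic tangent of \<open>sqrt (1 - (\<bar>w\<bar> / peak p \<omega>) powr (p - 1))\<close> has a constant derivative. The
  hypothesis \<open>0 < t\<close> is essential: at the maximal amplitude solutions are not unique.
\<close>

theorem flow_solution_unique:
  assumes "H1_rep w g" "1 < p" "0 < \<omega>" and ae: "eq_ae g (\<lambda>x. - flow p \<omega> (w x))"
    and t: "0 < t" "t < 1" and w0: "cmod (w 0) = peak p \<omega> * (1 - t\<^sup>2) powr (1 / (p - 1))"
    and x: "0 \<le> x"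
  shows "w x = sgn (w 0) * of_real (phi p \<omega> (2 / ((p - 1) * sqrt \<omega>) * artanh t) x)"
proof -
  have S: "0 < peak p \<omega>" by (rule peak_pos[OF assms(2,3)])
  have t2: "0 < 1 - t\<^sup>2" using t by (simp add: abs_square_less_1)
  have cw: "continuous_on {0..x} w" by (rule continuous_on_subset[OF H1_rep_continuous[OF assms(1)]]) auto
  define k where "k s = sqrt \<omega> * sqrt (max 0 (1 - (cmod (w s) / peak p \<omega>) powr (p - 1)))" for s
  have flow_k: "flow p \<omega> (w s) = k s *\<^sub>R w s" for s by (simp add: flow_def k_def)
  have ck: "continuous_on {0..x} k"
    unfolding k_def using assms(2) S by (intro continuous_intros continuous_on_powr' cw) auto
  have cF: "continuous_on {0..x} (\<lambda>s. - flow p \<omega> (w s))"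
    by (intro continuous_intros continuous_on_compose2[OF continuous_on_flow[OF assms(2)] cw]) auto
  have dw: "(w has_vector_derivative - (k s *\<^sub>R w s)) (at s within {0..x})" if s: "s \<in> {0..x}" for s
  proof -
    obtain N where sub: "{y \<in> space half_line. \<not> g y = - flow p \<omega> (w y)} \<subseteq> N"
      and null: "emeasure half_line N = 0" "N \<in> sets half_line"
      using ae unfolding eq_ae_def by (rule AE_E)
    have N: "N \<in> null_sets half_line" "\<And>y. 0 < y \<Longrightarrow> y \<notin> N \<Longrightarrow> g y = - flow p \<omega> (w y)"
      using null sub by auto
    have "negligible (insert 0 N)"
      using N(1) by (simp add: negligible_iff_null_sets null_sets_restrict_space)
    then have ig: "integral {0..y} g = integral {0..y} (\<lambda>s. - flow p \<omega> (w s))" for y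
    proof (rule integral_spike)
      fix s assume "s \<in> {0..y} - insert 0 N"
      then have "0 < s" "s \<notin> N" by auto
      from N(2)[OF this] show "- flow p \<omega> (w s) = g s" by (rule sym)
    qed
    have "w y = w 0 + integral {0..y} g" if "y \<in> {0..x}" for y
      using assms(1) that unfolding H1_rep_def primitive_on_def by blast
    then have wy: "w 0 + integral {0..y} (\<lambda>s. - flow p \<omega> (w s)) = w y" if "y \<in> {0..x}" for y
      using that unfolding ig by metis
    have "((\<lambda>y. w 0 + integral {0..y} (\<lambda>s. - flow p \<omega> (w s))) has_vector_derivative 0 + - flow p \<omega> (w s)) (at s within {0..x})"
      by (intro has_vector_derivative_add has_vector_derivative_const integral_has_vector_derivative cF s)
    then have "((\<lambda>y. w 0 + integral {0..y} (\<lambda>s. - flow p \<omega> (w s))) has_vector_derivative - (k s *\<^sub>R w s)) (at s within {0..x})"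
      unfolding flow_k by simp
    then show ?thesis
      by (rule has_vector_derivative_transform[OF s, rotated]) (rule wy[symmetric])
  qed
  define K where "K y = integral {0..y} k" for y
  have dK: "(K has_real_derivative k s) (at s within {0..x})" if "s \<in> {0..x}" for s
    unfolding K_def by (rule integral_has_real_derivative[OF ck that])
  have K0: "K 0 = 0" by (simp add: K_def)
  have Kpos: "0 \<le> K s" if "s \<in> {0..x}" for s
    unfolding K_def using that assms(3)
    by (intro integral_nonneg integrable_continuous_real continuous_on_subset[OF ck]) (auto simp: k_def)
  have const: "((\<lambda>s. exp (K s) *\<^sub>R w s) has_vector_derivative 0) (at s within {0..x})" if s: "s \<in> {0..x}" for s
  proof -
    have "((\<lambda>s. exp (K s)) has_real_derivative exp (K s) * k s) (at s within {0..x})"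
      using DERIV_chain2[OF DERIV_exp dK[OF s]] .
    from has_vector_derivative_scaleR[OF this dw[OF s]] show ?thesis by simp
  qed
  obtain c where c: "\<And>s. s \<in> {0..x} \<Longrightarrow> exp (K s) *\<^sub>R w s = c"
    by (rule has_vector_derivative_zero_constant[OF convex_real_interval(5) const]) blast+
  have ws: "w s = exp (- K s) *\<^sub>R w 0" if "s \<in> {0..x}" for s
  proof -
    have "exp (K s) *\<^sub>R w s = w 0" using c[OF that] c[of 0] x K0 by simp
    then have "exp (- K s) *\<^sub>R w 0 = (exp (- K s) * exp (K s)) *\<^sub>R w s" by (metis scaleR_scaleR)
    then show ?thesis by (simp flip: exp_add)
  qed
  define y where "y s = cmod (w s) / peak p \<omega>" for s
  have ypos: "0 < y s" if "s \<in> {0..x}" for s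
    using S t2 by (simp add: y_def ws[OF that] w0)
  have yp: "y s powr (p - 1) = (1 - t\<^sup>2) * exp (- ((p - 1) * K s))" if "s \<in> {0..x}" for s
  proof -
    have "y s = exp (- K s) * (1 - t\<^sup>2) powr (1 / (p - 1))"
      using S by (simp add: y_def ws[OF that] w0)
    then have "y s powr (p - 1) = exp (- K s) powr (p - 1) * (1 - t\<^sup>2)"
      using t2 assms(2) by (simp add: powr_mult powr_powr)
    then show ?thesis by (simp add: powr_def mult_ac)
  qed
  \<comment> \<open>\<open>T\<close> is the hyperbolic tangent of the soliton phase; at \<open>0\<close> it equals \<open>t\<close>, and it never leaves \<open>[t, 1)\<close>.\<close>
  define T where "T s = sqrt (1 - (1 - t\<^sup>2) * exp (- ((p - 1) * K s)))" for s
  have Tin: "t\<^sup>2 \<le> 1 - (1 - t\<^sup>2) * exp (- ((p - 1) * K s))" "1 - (1 - t\<^sup>2) * exp (- ((p - 1) * K s)) < 1" if "s \<in> {0..x}" for s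
  proof -
    have "exp (- ((p - 1) * K s)) \<le> 1" using Kpos[OF that] assms(2) by simp
    then have "(1 - t\<^sup>2) * exp (- ((p - 1) * K s)) \<le> (1 - t\<^sup>2) * 1" using t2 by (intro mult_left_mono) auto
    then show "t\<^sup>2 \<le> 1 - (1 - t\<^sup>2) * exp (- ((p - 1) * K s))" by simp
    show "1 - (1 - t\<^sup>2) * exp (- ((p - 1) * K s)) < 1" using t2 by simp
  qed
  have T2: "(T s)\<^sup>2 = 1 - (1 - t\<^sup>2) * exp (- ((p - 1) * K s))" if "s \<in> {0..x}" for s
    unfolding T_def by (rule real_sqrt_pow2[OF order_trans[OF zero_le_power2 Tin(1)[OF that]]])
  have Tpos: "0 < T s" if "s \<in> {0..x}" for s
  proof -
    have "0 < t\<^sup>2" using t by simp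
    from less_le_trans[OF this Tin(1)[OF that]] show ?thesis unfolding T_def by (simp only: real_sqrt_gt_0_iff)
  qed
  have Tlt: "T s < 1" if "s \<in> {0..x}" for s
    unfolding T_def using Tin(2)[OF that] by simp
  have kT: "k s = sqrt \<omega> * T s" if "s \<in> {0..x}" for s
    unfolding k_def y_def[symmetric] yp[OF that] T_def
    by (subst max_absorb2[OF order_trans[OF zero_le_power2 Tin(1)[OF that]]]) (rule refl)
  have T0: "T 0 = t" unfolding T_def K0 using t by simp
  define z where "z = (p - 1) * sqrt \<omega> / 2"
  have const': "((\<lambda>s. artanh (T s) - z * s) has_real_derivative 0) (at s within {0..x})" if s: "s \<in> {0..x}" for s
  proof -
    have pos: "0 < 1 - (1 - t\<^sup>2) * exp (- ((p - 1) * K s))" using Tpos[OF s] unfolding T_def by simp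
    have e: "((\<lambda>s. exp (- ((p - 1) * K s))) has_real_derivative exp (- ((p - 1) * K s)) * (- ((p - 1) * k s))) (at s within {0..x})"
      by (intro DERIV_chain2[OF DERIV_exp] DERIV_minus DERIV_cmult dK s)
    have "((\<lambda>s. 1 - (1 - t\<^sup>2) * exp (- ((p - 1) * K s))) has_real_derivative
        0 - (1 - t\<^sup>2) * (exp (- ((p - 1) * K s)) * (- ((p - 1) * k s)))) (at s within {0..x})"
      by (intro DERIV_diff DERIV_const DERIV_cmult e)
    from DERIV_chain2[OF DERIV_real_sqrt[OF pos] this]
    have "(T has_real_derivative inverse (T s) / 2 * (0 - (1 - t\<^sup>2) * (exp (- ((p - 1) * K s)) * (- ((p - 1) * k s))))) (at s within {0..x})"
      by (simp add: T_def[abs_def])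
    moreover have "inverse (T s) / 2 * (0 - (1 - t\<^sup>2) * (exp (- ((p - 1) * K s)) * (- ((p - 1) * k s)))) = z * (1 - (T s)\<^sup>2)"
      unfolding T2[OF s] kT[OF s] z_def using Tpos[OF s] by (simp add: field_simps)
    ultimately have dT: "(T has_real_derivative z * (1 - (T s)\<^sup>2)) (at s within {0..x})" by simp
    have "\<bar>T s\<bar> < 1" using Tpos[OF s] Tlt[OF s] by simp
    from DERIV_chain2[OF artanh_real_has_field_derivative[OF this] dT]
    have "((\<lambda>s. artanh (T s)) has_real_derivative 1 / (1 - (T s)\<^sup>2) * (z * (1 - (T s)\<^sup>2))) (at s within {0..x})" .
    moreover have "1 - (T s)\<^sup>2 \<noteq> 0" unfolding T2[OF s] using t2 by simp
    ultimately have "((\<lambda>s. artanh (T s)) has_real_derivative z) (at s within {0..x})" by simp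
    from DERIV_diff[OF this DERIV_cmult_Id[of z]] show ?thesis by simp
  qed
  obtain C where C: "\<And>s. s \<in> {0..x} \<Longrightarrow> artanh (T s) - z * s = C"
    using has_field_derivative_zero_constant[OF convex_real_interval(5) const'] by blast
  have zpos: "0 < z" using assms(2,3) by (simp add: z_def)
  have "artanh (T x) = artanh t + z * x" using C[of x] C[of 0] x T0 by simp
  also have "\<dots> = z * (x + 2 / ((p - 1) * sqrt \<omega>) * artanh t)"
  proof -
    have z1: "z * (2 / ((p - 1) * sqrt \<omega>)) = 1" using assms(2,3) by (simp add: z_def)
    have "z * (x + 2 / ((p - 1) * sqrt \<omega>) * A) = z * x + A" for A
      by (simp only: distrib_left mult.assoc[symmetric] z1 mult_1_left)
    then show ?thesis by simp
  qed
  finally have "T x = tanh (z * (x + 2 / ((p - 1) * sqrt \<omega>) * artanh t))"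
    using tanh_artanh_eq[of "T x"] Tpos[of x] Tlt[of x] x by simp
  then have "(phi p \<omega> (2 / ((p - 1) * sqrt \<omega>) * artanh t) x / peak p \<omega>) powr (p - 1) = 1 - (T x)\<^sup>2"
    unfolding phi_over_peak_powr[OF assms(2,3)] z_def by simp
  also have "\<dots> = y x powr (p - 1)" using T2[of x] yp[of x] x by simp
  finally have powr_eq: "(phi p \<omega> (2 / ((p - 1) * sqrt \<omega>) * artanh t) x / peak p \<omega>) powr (p - 1) = y x powr (p - 1)" .
  have "phi p \<omega> (2 / ((p - 1) * sqrt \<omega>) * artanh t) x / peak p \<omega> = y x"
  proof (rule powr_inj_pos[OF _ _ _ powr_eq])
    show "0 < p - 1" using assms(2) by simp
    show "0 < phi p \<omega> (2 / ((p - 1) * sqrt \<omega>) * artanh t) x / peak p \<omega>"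
      by (rule divide_pos_pos[OF phi_pos[OF assms(2,3)] S])
    show "0 < y x" by (rule ypos) (use x in simp)
  qed
  then have "phi p \<omega> (2 / ((p - 1) * sqrt \<omega>) * artanh t) x = cmod (w x)"
    using S by (simp add: y_def)
  moreover have "w x = sgn (w 0) * of_real (cmod (w x))"
  proof -
    have wx: "w x = exp (- K x) *\<^sub>R w 0" by (rule ws) (use x in simp)
    have "w 0 = sgn (w 0) * of_real (cmod (w 0))" by (cases "w 0 = 0") (simp_all add: sgn_eq)
    then have "w x = exp (- K x) *\<^sub>R (sgn (w 0) * of_real (cmod (w 0)))" using wx by simp
    also have "\<dots> = sgn (w 0) * of_real (exp (- K x) * cmod (w 0))"
      by (simp add: scaleR_conv_of_real mult_ac)
    also have "exp (- K x) * cmod (w 0) = cmod (w x)" by (simp add: wx)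
    finally show ?thesis .
  qed
  ultimately show ?thesis by simp
qed

section \<open>The Nehari problem for pairs\<close>

lemma eq_ae_on_half_line: "(\<And>x. 0 < x \<Longrightarrow> u x = w x) \<Longrightarrow> eq_ae u w"
  unfolding eq_ae_def by (rule AE_I2) simp

lemma Lq_mass_scale:
  assumes "0 < s"
  shows "Lq_mass q (\<lambda>x. of_real s * w x) = s powr q * Lq_mass q w"
  unfolding Lq_mass_def using assms by (simp add: norm_mult powr_mult)

lemma Lq_mass_nonneg: "0 \<le> Lq_mass q w"
  unfolding Lq_mass_def by (simp add: integral_nonneg_AE)

lemma in_Lq_scale:
  assumes "in_Lq q w" "0 < s"
  shows "in_Lq q (\<lambda>x. of_real s * w x)"
proof -
  have "(\<lambda>x. of_real s * w x) \<in> borel_measurable half_line"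
    using assms(1) unfolding in_Lq_def by (intro borel_measurable_times borel_measurable_const) auto
  then show ?thesis using assms by (simp add: in_Lq_def norm_mult powr_mult)
qed

lemma H1_rep_scale:
  assumes "H1_rep w g" "0 < s"
  shows "H1_rep (\<lambda>x. of_real s * w x) (\<lambda>x. of_real s * g x)"
proof -
  have "primitive_on (\<lambda>x. of_real s * w x) (\<lambda>x. of_real s * g x) 0 X" for X
  proof -
    have pr: "primitive_on w g 0 X" using assms(1) by (simp add: H1_rep_def)
    have "(\<lambda>x. s *\<^sub>R g x) absolutely_integrable_on {0..X}"
      using pr by (intro absolutely_integrable_scaleR_left) (simp add: primitive_on_def)
    moreover have "of_real s * w x = of_real s * w 0 + integral {0..x} (\<lambda>x. of_real s * g x)" if "x \<in> {0..X}" for x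
    proof -
      have "w x = w 0 + integral {0..x} g" using pr that unfolding primitive_on_def by blast
      then have "of_real s * w x = of_real s * (w 0 + integral {0..x} g)" by (rule arg_cong)
      then show ?thesis by (simp add: distrib_left)
    qed
    ultimately show ?thesis unfolding primitive_on_def scaleR_conv_of_real by blast
  qed
  then show ?thesis using assms in_Lq_scale unfolding H1_rep_def by blast
qed

lemma quad_form_scale: "0 < s \<Longrightarrow> quad_form \<omega> (\<lambda>x. of_real s * w x) (\<lambda>x. of_real s * g x) = s\<^sup>2 * quad_form \<omega> w g"
  unfolding quad_form_def by (simp add: Lq_mass_scale algebra_simps)

lemma sup_norm_nonneg: "H1_rep w g \<Longrightarrow> 0 \<le> sup_norm w"
  by (rule order_trans[OF norm_ge_zero le_sup_norm[of w g 0]]) auto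

lemma sup_norm_scale:
  assumes "H1_rep w g" "0 < s"
  shows "sup_norm (\<lambda>x. of_real s * w x) = s * sup_norm w"
proof (rule antisym)
  show "sup_norm (\<lambda>x. of_real s * w x) \<le> s * sup_norm w"
    by (rule sup_norm_le) (use le_sup_norm[OF assms(1)] assms(2) in \<open>simp add: norm_mult\<close>)
  have "sup_norm w \<le> sup_norm (\<lambda>x. of_real s * w x) / s"
  proof (rule sup_norm_le)
    fix x :: real assume "0 \<le> x"
    from le_sup_norm[OF H1_rep_scale[OF assms] this] show "cmod (w x) \<le> sup_norm (\<lambda>x. of_real s * w x) / s"
      using assms(2) by (simp add: norm_mult field_simps)
  qed
  then show "s * sup_norm w \<le> sup_norm (\<lambda>x. of_real s * w x)" using assms(2) by (simp add: field_simps)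
qed

lemma H1_rep_zero_if_mass_zero:
  assumes "H1_rep w g" "1 < p" "Lq_mass (p + 1) w = 0" "0 \<le> x"
  shows "w x = 0"
proof -
  have i: "integrable half_line (\<lambda>x. cmod (w x) powr (p + 1))" using H1_rep_in_Lq[OF assms(1,2)] by (simp add: in_Lq_def)
  have "AE x in half_line. cmod (w x) powr (p + 1) = 0"
    using assms(3) integral_nonneg_eq_0_iff_AE[OF i] unfolding Lq_mass_def by simp
  then have "eq_ae w (\<lambda>x. 0)" unfolding eq_ae_def by (rule AE_mp) auto
  from continuous_eq_ae_imp_eq[OF H1_rep_continuous[OF assms(1)] _ this assms(4)] show ?thesis by simp
qed

text \<open>
  If the quadratic part and the mass of order \<open>p + 1\<close> agree, this function of \<open>s\<close> is, up to a
  factor, twice the action of \<open>s\<close> times the function.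
\<close>

lemma nehari_fibre_less:
  fixes p s :: real
  assumes "1 < p" "0 < s" "s \<noteq> 1"
  shows "s\<^sup>2 - 2 / (p + 1) * s powr (p + 1) < 1 - 2 / (p + 1)"
proof -
  define h where "h s = s\<^sup>2 - 2 / (p + 1) * s powr (p + 1)" for s :: real
  have d: "(h has_real_derivative 2 * (x - x powr p)) (at x)" if "0 < x" for x
  proof -
    have "((\<lambda>x. x powr (p + 1)) has_real_derivative (p + 1) * x powr (p + 1 - of_nat 1) * 1) (at x)"
      by (rule DERIV_fun_powr[OF DERIV_ident that])
    then have "((\<lambda>x. x powr (p + 1)) has_real_derivative (p + 1) * x powr p) (at x)" by simp
    from DERIV_diff[OF DERIV_pow[of 2] DERIV_cmult[OF this, of "2 / (p + 1)"]]
    have "(h has_real_derivative 2 * x - 2 / (p + 1) * ((p + 1) * x powr p)) (at x)"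
      unfolding h_def[abs_def] by simp
    moreover have "2 / (p + 1) * ((p + 1) * X) = 2 * X" for X using assms(1) by simp
    ultimately show ?thesis by (simp only: right_diff_distrib)
  qed
  have cont: "continuous_on {l..r} h" if "0 < l" for l r
    unfolding h_def using that by (intro continuous_intros) auto
  have "h s < h 1"
  proof (cases "s < 1")
    case True
    show ?thesis
    proof (rule DERIV_pos_imp_increasing_open[OF True _ cont[OF assms(2)]])
      fix x assume x: "s < x" "x < 1"
      then have "x powr p < x powr 1" using assms by (intro powr_less_mono') auto
      then show "\<exists>l. DERIV h x :> l \<and> l > 0" using d[of x] x assms by force
    qed
  next
    case False
    then have s1: "1 < s" using assms by simp
    have "h s < h 1"
    proof (rule DERIV_neg_imp_decreasing_open[OF s1 _ cont])
      fix x assume x: "1 < x" "x < s"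
      then have "x powr 1 < x powr p" using assms by (intro powr_less_mono) auto
      then show "\<exists>l. DERIV h x :> l \<and> l < 0" using d[of x] x by force
    qed simp
    then show ?thesis .
  qed
  then show ?thesis by (simp add: h_def)
qed

text \<open>
  A mountain pass level: among the rays from the origin, cut off at the boundary of the unit square, the
  smallest maximum of \<open>pair_energy\<close> is the one at \<open>(a, b)\<close>.
\<close>

definition minmax_pair :: "real \<Rightarrow> real \<Rightarrow> real \<Rightarrow> real \<Rightarrow> bool" where
  "minmax_pair p \<tau> a b \<longleftrightarrow> (\<forall>A B. 0 \<le> A \<longrightarrow> 0 \<le> B \<longrightarrow> 0 < A + B \<longrightarrow>
     (\<exists>s>0. s * A \<le> 1 \<and> s * B \<le> 1 \<and> (pair_energy p \<tau> a b < pair_energy p \<tau> (s * A) (s * B) \<or>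
       s * A = a \<and> s * B = b \<or> s * A = b \<and> s * B = a)))"

text \<open>
  The quadratic part of twice the action of a pair. The coupling constant is \<open>\<tau> * sqrt \<omega> = N / (2 * \<bar>\<beta>\<bar>)\<close>.
\<close>

definition pair_form :: "real \<Rightarrow> real \<Rightarrow> (real \<Rightarrow> complex) \<Rightarrow> (real \<Rightarrow> complex) \<Rightarrow> (real \<Rightarrow> complex) \<Rightarrow> (real \<Rightarrow> complex) \<Rightarrow> real" where
  "pair_form \<omega> \<tau> w1 g1 w2 g2 = quad_form \<omega> w1 g1 + quad_form \<omega> w2 g2 - \<tau> * sqrt \<omega> * (cmod (w1 0 + w2 0))\<^sup>2"

lemma pair_form_scale:
  "0 < s \<Longrightarrow> pair_form \<omega> \<tau> (\<lambda>x. of_real s * w1 x) (\<lambda>x. of_real s * g1 x) (\<lambda>x. of_real s * w2 x) (\<lambda>x. of_real s * g2 x)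
    = s\<^sup>2 * pair_form \<omega> \<tau> w1 g1 w2 g2"
  unfolding pair_form_def quad_form_scale distrib_left[symmetric] norm_mult power_mult_distrib
  by (simp add: algebra_simps)

text \<open>
  The sum of the bounds \<open>energy_ge_sup\<close> for both components, together with the triangle inequality in
  the coupling term. Equality makes each of these estimates sharp.
\<close>

lemma pair_energy_lower_bound:
  assumes "H1_rep w1 g1" "H1_rep w2 g2" "1 < p" "0 < \<omega>" "0 < \<tau>"
    and le: "sup_norm w1 \<le> peak p \<omega>" "sup_norm w2 \<le> peak p \<omega>"
  defines "E \<equiv> pair_form \<omega> \<tau> w1 g1 w2 g2 - 2 / (p + 1) * (Lq_mass (p + 1) w1 + Lq_mass (p + 1) w2)"
    and "G \<equiv> sqrt \<omega> * (peak p \<omega>)\<^sup>2 * pair_energy p \<tau> (sup_norm w1 / peak p \<omega>) (sup_norm w2 / peak p \<omega>)"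
  shows "G \<le> E"
    and "E = G \<Longrightarrow> cmod (w1 0) = sup_norm w1 \<and> cmod (w2 0) = sup_norm w2 \<and>
       cmod (w1 0 + w2 0) = cmod (w1 0) + cmod (w2 0) \<and>
       free_energy p \<omega> w1 g1 = 2 * potential p \<omega> (w1 0) \<and>
       free_energy p \<omega> w2 g2 = 2 * potential p \<omega> (w2 0)"
proof -
  define S where "S = peak p \<omega>"
  have S: "0 < S" unfolding S_def by (rule peak_pos[OF assms(3,4)])
  define M1 M2 where "M1 = sup_norm w1" and "M2 = sup_norm w2"
  define P where "P t = 2 * (sqrt \<omega> * S\<^sup>2 * decay_int p (t / S))" for t
  define E1 where "E1 = free_energy p \<omega> w1 g1"
  define E2 where "E2 = free_energy p \<omega> w2 g2"
  define k where "k = \<tau> * sqrt \<omega>"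
  have k: "0 < k" using assms by (simp add: k_def)
  define c where "c = cmod (w1 0 + w2 0)"
  have E: "E = E1 + E2 - k * c\<^sup>2"
    by (simp add: E_def E1_def E2_def free_energy_def pair_form_def k_def c_def algebra_simps)
  have G: "G = P M1 + P M2 - k * (M1 + M2)\<^sup>2"
    using S by (simp add: G_def pair_energy_def P_def k_def M1_def M2_def S_def[symmetric] add_divide_distrib[symmetric] power_divide right_diff_distrib distrib_left)
  have e1: "P M1 \<le> E1" unfolding P_def E1_def M1_def S_def by (rule energy_ge_sup[OF assms(1,3,4) le(1)])
  have e2: "P M2 \<le> E2" unfolding P_def E2_def M2_def S_def by (rule energy_ge_sup[OF assms(2,3,4) le(2)])
  have n: "cmod (w1 0) \<le> M1" "cmod (w2 0) \<le> M2"
    unfolding M1_def M2_def using le_sup_norm[OF assms(1), of 0] le_sup_norm[OF assms(2), of 0] by auto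
  have t: "c \<le> cmod (w1 0) + cmod (w2 0)" unfolding c_def by (rule norm_triangle_ineq)
  have c0: "0 \<le> c" by (simp add: c_def)
  have c2: "c\<^sup>2 \<le> (M1 + M2)\<^sup>2" using t n c0 by (intro power_mono) linarith+
  then have kc: "k * c\<^sup>2 \<le> k * (M1 + M2)\<^sup>2" using k by simp
  show "G \<le> E" unfolding E G using e1 e2 kc by linarith
  assume eq: "E = G"
  then have eqs: "E1 = P M1" "E2 = P M2" "k * c\<^sup>2 = k * (M1 + M2)\<^sup>2"
    unfolding E G using e1 e2 kc by linarith+
  have "0 \<le> M1 + M2" using n norm_ge_zero[of "w1 0"] norm_ge_zero[of "w2 0"] by linarith
  then have "c = M1 + M2" using eqs(3) k c0 by (simp add: power2_eq_iff_nonneg)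
  then have w: "cmod (w1 0) = M1" "cmod (w2 0) = M2" "c = cmod (w1 0) + cmod (w2 0)"
    using t n by linarith+
  have pot: "2 * potential p \<omega> z = P (cmod z)" for z by (simp add: potential_def P_def S_def)
  show "cmod (w1 0) = sup_norm w1 \<and> cmod (w2 0) = sup_norm w2 \<and>
       cmod (w1 0 + w2 0) = cmod (w1 0) + cmod (w2 0) \<and>
       free_energy p \<omega> w1 g1 = 2 * potential p \<omega> (w1 0) \<and>
       free_energy p \<omega> w2 g2 = 2 * potential p \<omega> (w2 0)"
    unfolding pot w(1,2) E1_def[symmetric] E2_def[symmetric] eqs(1,2) M1_def[symmetric] M2_def[symmetric] c_def[symmetric]
    using w by simp
qed

text \<open>
  Let \<open>s\<close> be the factor given by the min-max property for the ray through the two suprema. Then the level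
  is at most the bound \<open>pair_energy_lower_bound\<close> for the functions multiplied by \<open>s\<close>, and this is at most the
  action for \<open>s = 1\<close> because \<open>s = 1\<close> is the strict maximum under the Nehari constraint.
\<close>

theorem nehari_lower_bound:
  assumes "H1_rep w1 g1" "H1_rep w2 g2" "1 < p" "0 < \<omega>" "0 < \<tau>" and mm: "minmax_pair p \<tau> a b"
    and nehari: "pair_form \<omega> \<tau> w1 g1 w2 g2 = Lq_mass (p + 1) w1 + Lq_mass (p + 1) w2"
    and nz: "0 \<le> x0" "w1 x0 \<noteq> 0 \<or> w2 x0 \<noteq> 0"
  defines "B \<equiv> Lq_mass (p + 1) w1 + Lq_mass (p + 1) w2"
    and "E \<equiv> sqrt \<omega> * (peak p \<omega>)\<^sup>2 * pair_energy p \<tau> a b"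
  shows "E \<le> (1 - 2 / (p + 1)) * B"
    and "(1 - 2 / (p + 1)) * B = E \<Longrightarrow>
       (cmod (w1 0) = peak p \<omega> * a \<and> cmod (w2 0) = peak p \<omega> * b \<or> cmod (w1 0) = peak p \<omega> * b \<and> cmod (w2 0) = peak p \<omega> * a) \<and>
       cmod (w1 0 + w2 0) = cmod (w1 0) + cmod (w2 0) \<and>
       sup_norm w1 \<le> peak p \<omega> \<and> sup_norm w2 \<le> peak p \<omega> \<and>
       free_energy p \<omega> w1 g1 = 2 * potential p \<omega> (w1 0) \<and>
       free_energy p \<omega> w2 g2 = 2 * potential p \<omega> (w2 0)"
proof -
  define S where "S = peak p \<omega>"
  have S: "0 < S" unfolding S_def by (rule peak_pos[OF assms(3,4)])
  have B: "0 < B"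
  proof -
    have "Lq_mass (p + 1) w1 \<noteq> 0 \<or> Lq_mass (p + 1) w2 \<noteq> 0"
      using H1_rep_zero_if_mass_zero[OF assms(1,3) _ nz(1)] H1_rep_zero_if_mass_zero[OF assms(2,3) _ nz(1)] nz(2) by blast
    then show ?thesis unfolding B_def using Lq_mass_nonneg[of "p + 1" w1] Lq_mass_nonneg[of "p + 1" w2] by linarith
  qed
  have M: "0 \<le> sup_norm w1 / S" "0 \<le> sup_norm w2 / S" using sup_norm_nonneg assms(1,2) S by auto
  have "0 < sup_norm w1 \<or> 0 < sup_norm w2"
    using nz le_sup_norm[OF assms(1) nz(1)] le_sup_norm[OF assms(2) nz(1)] by (metis less_le_trans zero_less_norm_iff)
  then have "0 < sup_norm w1 + sup_norm w2"
    using sup_norm_nonneg[OF assms(1)] sup_norm_nonneg[OF assms(2)]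
    by (auto intro: add_pos_nonneg add_nonneg_pos)
  then have pos: "0 < sup_norm w1 / S + sup_norm w2 / S"
    using S by (simp add: add_divide_distrib[symmetric])
  obtain s where s: "0 < s" "s * (sup_norm w1 / S) \<le> 1" "s * (sup_norm w2 / S) \<le> 1"
    and alt: "pair_energy p \<tau> a b < pair_energy p \<tau> (s * (sup_norm w1 / S)) (s * (sup_norm w2 / S)) \<or>
       s * (sup_norm w1 / S) = a \<and> s * (sup_norm w2 / S) = b \<or> s * (sup_norm w1 / S) = b \<and> s * (sup_norm w2 / S) = a"
    using mm M pos unfolding minmax_pair_def by meson
  let ?w1 = "\<lambda>x. of_real s * w1 x" and ?g1 = "\<lambda>x. of_real s * g1 x"
  let ?w2 = "\<lambda>x. of_real s * w2 x" and ?g2 = "\<lambda>x. of_real s * g2 x"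
  note r1 = H1_rep_scale[OF assms(1) s(1)] and r2 = H1_rep_scale[OF assms(2) s(1)]
  have sup: "sup_norm ?w1 / S = s * (sup_norm w1 / S)" "sup_norm ?w2 / S = s * (sup_norm w2 / S)"
    using sup_norm_scale[OF assms(1) s(1)] sup_norm_scale[OF assms(2) s(1)] by simp_all
  have le: "sup_norm ?w1 \<le> S" "sup_norm ?w2 \<le> S"
    using s(2,3) S sup by (simp_all add: divide_le_eq)
  define G where "G = pair_energy p \<tau> (s * (sup_norm w1 / S)) (s * (sup_norm w2 / S))"
  define E' where "E' = (s\<^sup>2 - 2 / (p + 1) * s powr (p + 1)) * B"
  have E': "pair_form \<omega> \<tau> ?w1 ?g1 ?w2 ?g2 - 2 / (p + 1) * (Lq_mass (p + 1) ?w1 + Lq_mass (p + 1) ?w2) = E'"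
    unfolding pair_form_scale[OF s(1)] Lq_mass_scale[OF s(1)] nehari E'_def B_def by (simp add: algebra_simps add_divide_distrib)
  note lb = pair_energy_lower_bound[OF r1 r2 assms(3-5) le[unfolded S_def], unfolded E' S_def[symmetric], unfolded sup, folded G_def]
  have GE: "pair_energy p \<tau> a b \<le> G" using alt unfolding G_def by (auto simp: pair_energy_commute)
  have k: "0 < sqrt \<omega> * S\<^sup>2" using S assms(4) by simp
  have 1: "E \<le> sqrt \<omega> * S\<^sup>2 * G" unfolding E_def S_def[symmetric] by (rule mult_left_mono[OF GE less_imp_le[OF k]])
  have fib: "E' \<le> (1 - 2 / (p + 1)) * B"
    unfolding E'_def using B nehari_fibre_less[OF assms(3) s(1)] by (cases "s = 1") (auto intro: mult_right_mono)
  show "E \<le> (1 - 2 / (p + 1)) * B" using 1 lb(1) fib by linarith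
  assume eq: "(1 - 2 / (p + 1)) * B = E"
  have eqs: "E' = sqrt \<omega> * S\<^sup>2 * G" "E' = (1 - 2 / (p + 1)) * B" "E = sqrt \<omega> * S\<^sup>2 * G"
    using 1 lb(1) fib eq by linarith+
  have s1: "s = 1"
  proof (rule ccontr)
    assume "s \<noteq> 1"
    then have "E' < (1 - 2 / (p + 1)) * B"
      unfolding E'_def using B nehari_fibre_less[OF assms(3) s(1)] by (intro mult_strict_right_mono)
    then show False using eqs(2) by simp
  qed
  have "sqrt \<omega> * S\<^sup>2 * pair_energy p \<tau> a b = sqrt \<omega> * S\<^sup>2 * G" using eqs(3) unfolding E_def S_def[symmetric] .
  then have "pair_energy p \<tau> a b = G" using k by (metis mult_left_cancel less_irrefl)
  then have ab: "sup_norm w1 = S * a \<and> sup_norm w2 = S * b \<or> sup_norm w1 = S * b \<and> sup_norm w2 = S * a"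
    using alt s1 S unfolding G_def by (auto simp: field_simps)
  show "(cmod (w1 0) = peak p \<omega> * a \<and> cmod (w2 0) = peak p \<omega> * b \<or> cmod (w1 0) = peak p \<omega> * b \<and> cmod (w2 0) = peak p \<omega> * a) \<and>
       cmod (w1 0 + w2 0) = cmod (w1 0) + cmod (w2 0) \<and>
       sup_norm w1 \<le> peak p \<omega> \<and> sup_norm w2 \<le> peak p \<omega> \<and>
       free_energy p \<omega> w1 g1 = 2 * potential p \<omega> (w1 0) \<and>
       free_energy p \<omega> w2 g2 = 2 * potential p \<omega> (w2 0)"
    using lb(2)[OF eqs(1)] ab le unfolding s1 S_def by auto
qed

section \<open>Pairs of soliton profiles\<close>

definition profile :: "real \<Rightarrow> real \<Rightarrow> real \<Rightarrow> real \<Rightarrow> real" where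
  "profile p \<omega> t x = phi p \<omega> (2 / ((p - 1) * sqrt \<omega>) * artanh t) x"

text \<open>
  The value at the vertex, relative to the maximum, of the soliton whose phase there has hyperbolic
  tangent \<open>t\<close>.
\<close>

definition vertex_value :: "real \<Rightarrow> real \<Rightarrow> real" where
  "vertex_value p t = (1 - t\<^sup>2) powr (1 / (p - 1))"

lemma vertex_value_bounds:
  assumes "1 < p" "0 < t" "t < 1"
  shows "0 < vertex_value p t" "vertex_value p t < 1"
proof -
  have t2: "0 < 1 - t\<^sup>2" using assms by (simp add: abs_square_less_1)
  then show "0 < vertex_value p t" by (simp add: vertex_value_def)
  have "(1 - t\<^sup>2) powr (1 / (p - 1)) < 1 powr (1 / (p - 1))"
    using t2 assms by (intro powr_less_mono2) auto
  then show "vertex_value p t < 1" by (simp add: vertex_value_def)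
qed

lemma decay_vertex_value:
  assumes "1 < p" "0 < t" "t < 1"
  shows "decay p (vertex_value p t) = t * vertex_value p t"
proof -
  have t2: "0 < 1 - t\<^sup>2" using assms by (simp add: abs_square_less_1)
  have "vertex_value p t powr (p - 1) = 1 - t\<^sup>2"
    using t2 assms by (simp add: vertex_value_def powr_powr)
  then show ?thesis using vertex_value_bounds[OF assms] assms by (simp add: decay_def)
qed

lemma shift_nonneg: "1 < p \<Longrightarrow> 0 < \<omega> \<Longrightarrow> 0 < t \<Longrightarrow> t < 1 \<Longrightarrow> 0 \<le> 2 / ((p - 1) * sqrt \<omega>) * artanh t"
  by (intro mult_nonneg_nonneg) (auto simp: artanh_def)

lemma profile_0:
  assumes "1 < p" "0 < \<omega>" "0 < t" "t < 1"
  shows "profile p \<omega> t 0 = peak p \<omega> * vertex_value p t"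
proof -
  have S: "0 < peak p \<omega>" by (rule peak_pos[OF assms(1,2)])
  have t2: "0 < 1 - t\<^sup>2" using assms by (simp add: abs_square_less_1)
  have e: "(p - 1) * sqrt \<omega> / 2 * (0 + 2 / ((p - 1) * sqrt \<omega>) * artanh t) = artanh t" using assms by simp
  have "(profile p \<omega> t 0 / peak p \<omega>) powr (p - 1) = 1 - t\<^sup>2"
    unfolding profile_def phi_over_peak_powr[OF assms(1,2)] e using tanh_artanh_eq[of t] assms by simp
  also have "\<dots> = vertex_value p t powr (p - 1)"
    using t2 assms by (simp add: vertex_value_def powr_powr)
  finally have eq: "(profile p \<omega> t 0 / peak p \<omega>) powr (p - 1) = vertex_value p t powr (p - 1)" .
  have "profile p \<omega> t 0 / peak p \<omega> = vertex_value p t"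
  proof (rule powr_inj_pos[OF _ _ _ eq])
    show "0 < p - 1" using assms by simp
    show "0 < profile p \<omega> t 0 / peak p \<omega>"
      unfolding profile_def by (rule divide_pos_pos[OF phi_pos[OF assms(1,2)] S])
    show "0 < vertex_value p t" by (rule vertex_value_bounds[OF assms(1,3,4)])
  qed
  then show ?thesis using S by (simp add: divide_eq_eq mult.commute)
qed

lemma profile_le:
  assumes "1 < p" "0 < \<omega>" "0 < t" "t < 1" "0 \<le> x"
  shows "profile p \<omega> t x \<le> profile p \<omega> t 0"
proof -
  define a where "a = 2 / ((p - 1) * sqrt \<omega>) * artanh t"
  have a: "0 \<le> a" unfolding a_def by (rule shift_nonneg[OF assms(1-4)])
  have "(p - 1) * sqrt \<omega> / 2 * (0 + a) \<le> (p - 1) * sqrt \<omega> / 2 * (x + a)"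
    using assms by (intro mult_left_mono) auto
  moreover have "0 \<le> (p - 1) * sqrt \<omega> / 2 * (0 + a)" using assms a by (intro mult_nonneg_nonneg) auto
  ultimately have "cosh ((p - 1) * sqrt \<omega> / 2 * (0 + a)) \<le> cosh ((p - 1) * sqrt \<omega> / 2 * (x + a))"
    by (simp only: cosh_real_nonneg_le_iff)
  then have "cosh ((p - 1) * sqrt \<omega> / 2 * (x + a)) powr (- 2 / (p - 1)) \<le> cosh ((p - 1) * sqrt \<omega> / 2 * (0 + a)) powr (- 2 / (p - 1))"
    using assms by (intro powr_mono2') auto
  then show ?thesis
    unfolding profile_def a_def[symmetric] phi_eq_cosh[OF assms(1,2)] using peak_pos[OF assms(1,2)]
    by (intro mult_left_mono) auto
qed

definition edge_profile :: "real \<Rightarrow> real \<Rightarrow> complex \<Rightarrow> real \<Rightarrow> real \<Rightarrow> complex" where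
  "edge_profile p \<omega> u t x = u * of_real (profile p \<omega> t x)"

definition edge_slope :: "real \<Rightarrow> real \<Rightarrow> complex \<Rightarrow> real \<Rightarrow> real \<Rightarrow> complex" where
  "edge_slope p \<omega> u t x = - flow p \<omega> (edge_profile p \<omega> u t x)"

lemma H1_rep_edge_profile:
  assumes "1 < p" "0 < \<omega>" "0 < t" "t < 1" "cmod u = 1"
  shows "H1_rep (edge_profile p \<omega> u t) (edge_slope p \<omega> u t)"
  unfolding edge_slope_def[abs_def] edge_profile_def[abs_def] profile_def
  by (rule H1_rep_phi[OF assms(1,2) shift_nonneg[OF assms(1-4)] assms(5)])

lemma norm_edge_profile:
  assumes "1 < p" "0 < \<omega>" "cmod u = 1"
  shows "cmod (edge_profile p \<omega> u t x) = profile p \<omega> t x"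
  unfolding edge_profile_def norm_mult assms(3) using phi_pos[OF assms(1,2)] by (simp add: profile_def less_imp_le)

lemma norm_edge_profile_0:
  assumes "1 < p" "0 < \<omega>" "0 < t" "t < 1" "cmod u = 1"
  shows "cmod (edge_profile p \<omega> u t 0) = peak p \<omega> * vertex_value p t"
  using norm_edge_profile[OF assms(1,2,5), of t 0] profile_0[OF assms(1-4)] by simp

lemma sup_norm_edge_profile:
  assumes "1 < p" "0 < \<omega>" "0 < t" "t < 1" "cmod u = 1"
  shows "sup_norm (edge_profile p \<omega> u t) = peak p \<omega> * vertex_value p t"
proof (rule antisym)
  show "sup_norm (edge_profile p \<omega> u t) \<le> peak p \<omega> * vertex_value p t"
  proof (rule sup_norm_le)
    fix x :: real assume "0 \<le> x"
    from profile_le[OF assms(1-4) this]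
    show "cmod (edge_profile p \<omega> u t x) \<le> peak p \<omega> * vertex_value p t"
      unfolding norm_edge_profile[OF assms(1,2,5)] profile_0[OF assms(1-4)] .
  qed
  show "peak p \<omega> * vertex_value p t \<le> sup_norm (edge_profile p \<omega> u t)"
    using le_sup_norm[OF H1_rep_edge_profile[OF assms], of 0] norm_edge_profile_0[OF assms] by simp
qed

context
  fixes p \<omega> t1 t2 \<tau> :: real and u :: complex
  assumes p: "1 < p" and \<omega>: "0 < \<omega>" and t1: "0 < t1" "t1 < 1" and t2: "0 < t2" "t2 < 1" and u: "cmod u = 1"
    and \<tau>: "0 < \<tau>"
    and crit: "t1 * vertex_value p t1 = \<tau> * (vertex_value p t1 + vertex_value p t2)"
      "t2 * vertex_value p t2 = \<tau> * (vertex_value p t1 + vertex_value p t2)"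
begin


text \<open>
  Profiles follow the flow and are largest at the vertex; so they attain the lower bound.
\<close>

lemma profile_pair_energy:
  "pair_form \<omega> \<tau> (edge_profile p \<omega> u t1) (edge_slope p \<omega> u t1) (edge_profile p \<omega> u t2) (edge_slope p \<omega> u t2) - 2 / (p + 1) * (Lq_mass (p + 1) (edge_profile p \<omega> u t1) + Lq_mass (p + 1) (edge_profile p \<omega> u t2))
    = sqrt \<omega> * (peak p \<omega>)\<^sup>2 * pair_energy p \<tau> (vertex_value p t1) (vertex_value p t2)"
proof -
  define S where "S = peak p \<omega>"
  have S: "0 < S" unfolding S_def by (rule peak_pos[OF p \<omega>])
  have le: "cmod (edge_profile p \<omega> u t x) \<le> peak p \<omega>" for t x
    unfolding norm_edge_profile[OF p \<omega> u] by (simp add: profile_def phi_le_peak[OF p \<omega>])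
  note r1 = H1_rep_edge_profile[OF p \<omega> t1 u] and r2 = H1_rep_edge_profile[OF p \<omega> t2 u]
  have e: "free_energy p \<omega> (edge_profile p \<omega> u t1) (edge_slope p \<omega> u t1) = 2 * potential p \<omega> (edge_profile p \<omega> u t1 0)"
    "free_energy p \<omega> (edge_profile p \<omega> u t2) (edge_slope p \<omega> u t2) = 2 * potential p \<omega> (edge_profile p \<omega> u t2 0)"
    by (rule energy_of_flow[OF r1 p \<omega> le edge_slope_def], rule energy_of_flow[OF r2 p \<omega> le edge_slope_def])
  have pot: "potential p \<omega> (edge_profile p \<omega> u t 0) = sqrt \<omega> * S\<^sup>2 * decay_int p (vertex_value p t)"
    if "0 < t" "t < 1" for t
    unfolding potential_def norm_edge_profile_0[OF p \<omega> that u] S_def[symmetric] using S by simp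
  have sum: "cmod (edge_profile p \<omega> u t1 0 + edge_profile p \<omega> u t2 0) = S * (vertex_value p t1 + vertex_value p t2)"
  proof -
    have "edge_profile p \<omega> u t1 0 + edge_profile p \<omega> u t2 0 = u * of_real (S * (vertex_value p t1 + vertex_value p t2))"
      unfolding edge_profile_def profile_0[OF p \<omega> t1] profile_0[OF p \<omega> t2] S_def[symmetric] by (simp add: algebra_simps)
    then have "cmod (edge_profile p \<omega> u t1 0 + edge_profile p \<omega> u t2 0) = \<bar>S * (vertex_value p t1 + vertex_value p t2)\<bar>"
      by (simp only: norm_mult u norm_of_real mult_1_left)
    then show ?thesis using S vertex_value_bounds(1)[OF p t1] vertex_value_bounds(1)[OF p t2] by simp
  qed
  have "pair_form \<omega> \<tau> (edge_profile p \<omega> u t1) (edge_slope p \<omega> u t1) (edge_profile p \<omega> u t2) (edge_slope p \<omega> u t2) - 2 / (p + 1) * (Lq_mass (p + 1) (edge_profile p \<omega> u t1) + Lq_mass (p + 1) (edge_profile p \<omega> u t2))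
    = (free_energy p \<omega> (edge_profile p \<omega> u t1) (edge_slope p \<omega> u t1)) + (free_energy p \<omega> (edge_profile p \<omega> u t2) (edge_slope p \<omega> u t2))
      - \<tau> * sqrt \<omega> * (cmod (edge_profile p \<omega> u t1 0 + edge_profile p \<omega> u t2 0))\<^sup>2"
    unfolding pair_form_def free_energy_def distrib_left by simp
  also have "\<dots> = sqrt \<omega> * S\<^sup>2 * pair_energy p \<tau> (vertex_value p t1) (vertex_value p t2)"
    unfolding e sum pot[OF t1] pot[OF t2] pair_energy_def power_mult_distrib by (simp add: algebra_simps)
  finally show ?thesis unfolding S_def .
qed

text \<open>
  The action of \<open>s\<close> times the profile minus its lower bound is nonnegative for \<open>s\<close> near \<open>1\<close> and vanishes at
  \<open>s = 1\<close>; hence its derivative vanishes there. The derivative of the lower bound is zero because the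
  amplitudes form a critical point, and what remains is the Nehari identity.
\<close>

lemma profile_nehari: "pair_form \<omega> \<tau> (edge_profile p \<omega> u t1) (edge_slope p \<omega> u t1) (edge_profile p \<omega> u t2) (edge_slope p \<omega> u t2) = Lq_mass (p + 1) (edge_profile p \<omega> u t1) + Lq_mass (p + 1) (edge_profile p \<omega> u t2)"
proof -
  define S where "S = peak p \<omega>"
  have S: "0 < S" unfolding S_def by (rule peak_pos[OF p \<omega>])
  define a b where "a = vertex_value p t1" and "b = vertex_value p t2"
  have ab: "0 < a" "a < 1" "0 < b" "b < 1"
    using vertex_value_bounds[OF p t1] vertex_value_bounds[OF p t2] by (auto simp: a_def b_def)
  define Q where "Q = pair_form \<omega> \<tau> (edge_profile p \<omega> u t1) (edge_slope p \<omega> u t1) (edge_profile p \<omega> u t2) (edge_slope p \<omega> u t2)"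
  define B where "B = Lq_mass (p + 1) (edge_profile p \<omega> u t1) + Lq_mass (p + 1) (edge_profile p \<omega> u t2)"
  define k where "k = sqrt \<omega> * S\<^sup>2"
  define h where "h s = s\<^sup>2 * Q - 2 / (p + 1) * (s powr (p + 1) * B) - k * pair_energy p \<tau> (s * a) (s * b)" for s
  \<comment> \<open>For \<open>\<bar>1 - s\<bar> < d\<close> the factor \<open>s\<close> is positive and both amplitudes stay in the unit square.\<close>
  define d where "d = min (1 / 2) (min (1 / a - 1) (1 / b - 1))"
  have d: "0 < d" using ab by (simp add: d_def)
  have h1: "h 1 = 0"
    using profile_pair_energy by (simp add: h_def Q_def B_def k_def S_def a_def b_def)
  have hpos: "0 \<le> h s" if s: "\<bar>1 - s\<bar> < d" for s
  proof -
    have "\<bar>1 - s\<bar> < 1 / 2" using s by (simp add: d_def)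
    then have s0: "0 < s" by linarith
    have sa: "s * a \<le> 1" "s * b \<le> 1"
    proof -
      have "s < 1 / a" "s < 1 / b" using s by (auto simp: d_def)
      then show "s * a \<le> 1" "s * b \<le> 1" using ab by (simp_all add: pos_less_divide_eq less_imp_le)
    qed
    note r1 = H1_rep_edge_profile[OF p \<omega> t1 u] and r2 = H1_rep_edge_profile[OF p \<omega> t2 u]
    have s1: "sup_norm (\<lambda>x. of_real s * edge_profile p \<omega> u t1 x) = S * (s * a)"
      unfolding sup_norm_scale[OF r1 s0] sup_norm_edge_profile[OF p \<omega> t1 u] S_def a_def by simp
    have s2: "sup_norm (\<lambda>x. of_real s * edge_profile p \<omega> u t2 x) = S * (s * b)"
      unfolding sup_norm_scale[OF r2 s0] sup_norm_edge_profile[OF p \<omega> t2 u] S_def b_def by simp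
    have l1: "sup_norm (\<lambda>x. of_real s * edge_profile p \<omega> u t1 x) \<le> S" and l2: "sup_norm (\<lambda>x. of_real s * edge_profile p \<omega> u t2 x) \<le> S"
      unfolding s1 s2 using sa S by (simp_all add: mult_left_le)
    from pair_energy_lower_bound(1)[OF H1_rep_scale[OF r1 s0] H1_rep_scale[OF r2 s0] p \<omega> \<tau>
       l1[unfolded S_def] l2[unfolded S_def]]
    have "k * pair_energy p \<tau> (s * a) (s * b) \<le> s\<^sup>2 * Q - 2 / (p + 1) * (s powr (p + 1) * B)"
      unfolding pair_form_scale[OF s0] Lq_mass_scale[OF s0] s1 s2 S_def[symmetric] k_def Q_def B_def
      using S by (simp add: distrib_left)
    then show ?thesis by (simp add: h_def)
  qed
  have "(h has_real_derivative 2 * Q - 2 * B) (at 1)"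
  proof -
    have da: "((\<lambda>s. decay_int p (s * c)) has_real_derivative decay p c * c) (at 1)" if "0 < c" for c
    proof -
      have m: "((\<lambda>s. s * c) has_real_derivative c) (at 1)" by (auto intro!: derivative_eq_intros)
      have "(decay_int p has_real_derivative decay p c) (at (1 * c))"
        using has_real_derivative_decay_int[OF p that] by simp
      from DERIV_chain2[OF this m] show ?thesis .
    qed
    have dp: "((\<lambda>x. x powr (p + 1)) has_real_derivative (p + 1)) (at 1)"
    proof -
      have "((\<lambda>x. x powr (p + 1)) has_real_derivative (p + 1) * 1 powr (p + 1 - of_nat 1) * 1) (at 1)"
        by (rule DERIV_fun_powr[OF DERIV_ident]) simp
      then show ?thesis by simp
    qed
    have dq: "((\<lambda>s. (s * a + s * b)\<^sup>2) has_real_derivative 2 * (a + b) * (a + b)) (at 1)"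
      by (auto intro!: derivative_eq_intros simp: algebra_simps)
    have ds: "((\<lambda>s. s\<^sup>2 * Q) has_real_derivative 2 * Q) (at 1)"
      by (auto intro!: derivative_eq_intros)
    have "((\<lambda>s. pair_energy p \<tau> (s * a) (s * b)) has_real_derivative
       2 * (decay p a * a) + 2 * (decay p b * b) - \<tau> * (2 * (a + b) * (a + b))) (at 1)"
      unfolding pair_energy_def by (intro DERIV_diff DERIV_add DERIV_cmult da dq ab)
    moreover have "2 * (decay p a * a) + 2 * (decay p b * b) - \<tau> * (2 * (a + b) * (a + b)) = 0"
    proof -
      have "decay p a = \<tau> * (a + b)" "decay p b = \<tau> * (a + b)"
        using crit decay_vertex_value[OF p t1] decay_vertex_value[OF p t2] by (simp_all add: a_def b_def)
      then show ?thesis by (simp add: algebra_simps)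
    qed
    ultimately have de: "((\<lambda>s. pair_energy p \<tau> (s * a) (s * b)) has_real_derivative 0) (at 1)" by simp
    have "(h has_real_derivative 2 * Q - 2 / (p + 1) * ((p + 1) * B) - k * 0) (at 1)"
      unfolding h_def by (intro DERIV_diff DERIV_cmult DERIV_cmult_right ds dp de)
    moreover have "2 / (p + 1) * ((p + 1) * B) = 2 * B" using p by simp
    ultimately show ?thesis by simp
  qed
  then have "2 * Q - 2 * B = 0"
    by (rule DERIV_local_min[OF _ d]) (use hpos h1 in auto)
  then show ?thesis by (simp add: Q_def B_def)
qed

end

section \<open>Reduction of the graph to pairs\<close>

text \<open>
  One representative for each of the two blocks of edges.
\<close>

definition block_rep :: "nat \<Rightarrow> (nat \<Rightarrow> real \<Rightarrow> complex) \<Rightarrow> (real \<Rightarrow> complex) \<Rightarrow> (real \<Rightarrow> complex) \<Rightarrow> (real \<Rightarrow> complex) \<Rightarrow> (real \<Rightarrow> complex) \<Rightarrow> bool" where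
  "block_rep N v w1 g1 w2 g2 \<longleftrightarrow> H1_rep w1 g1 \<and> H1_rep w2 g2 \<and>
     (\<forall>j\<in>{1..N div 2}. eq_ae (v j) w1) \<and> (\<forall>j\<in>{N div 2 + 1..N}. eq_ae (v j) w2)"

lemma sum_two_blocks:
  fixes f :: "nat \<Rightarrow> 'a::real_normed_field"
  assumes "even N" "\<And>j. j \<in> {1..N div 2} \<Longrightarrow> f j = x" "\<And>j. j \<in> {N div 2 + 1..N} \<Longrightarrow> f j = y"
  shows "(\<Sum>j=1..N. f j) = of_nat (N div 2) * (x + y)"
proof -
  have "{1..N} = {1..N div 2} \<union> {N div 2 + 1..N}" by auto
  then have "(\<Sum>j=1..N. f j) = (\<Sum>j\<in>{1..N div 2}. f j) + (\<Sum>j\<in>{N div 2 + 1..N}. f j)"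
    by (simp only:) (rule sum.union_disjoint; auto)
  also have "\<dots> = (\<Sum>j\<in>{1..N div 2}. x) + (\<Sum>j\<in>{N div 2 + 1..N}. y)"
    using assms(2,3) by (intro arg_cong2[of _ _ _ _ "(+)"] sum.cong) auto
  also have "\<dots> = of_nat (N div 2) * x + of_nat (N - N div 2) * y" by simp
  also have "N - N div 2 = N div 2" using assms(1) by auto
  finally show ?thesis by (simp add: distrib_left)
qed

lemma block_rep_edges:
  assumes "block_rep N v w1 g1 w2 g2"
  shows "j \<in> {1..N div 2} \<Longrightarrow> in_H1 (v j) \<and> eq_ae (v j) w1 \<and> eq_ae (weak_deriv (v j)) g1 \<and> trace0 (v j) = w1 0"
    and "j \<in> {N div 2 + 1..N} \<Longrightarrow> in_H1 (v j) \<and> eq_ae (v j) w2 \<and> eq_ae (weak_deriv (v j)) g2 \<and> trace0 (v j) = w2 0"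
  using assms in_H1_of_H1_rep unfolding block_rep_def by blast+

lemma block_rep_of_H1_half_graph:
  assumes "v \<in> H1_half_graph N" "2 \<le> N" "even N"
  shows "\<exists>w1 g1 w2 g2. block_rep N v w1 g1 w2 g2"
proof -
  have m: "1 \<in> {1..N}" "N \<in> {1..N}" "1 \<in> {1..N div 2}" "N \<in> {N div 2 + 1..N}" using assms by auto
  have h: "in_H1 (v 1)" "in_H1 (v N)" using assms(1) m unfolding H1_half_graph_def H1_graph_def by blast+
  obtain w1 where w1: "H1_rep w1 (weak_deriv (v 1))" "eq_ae (v 1) w1" using H1_rep_of_in_H1[OF h(1)] by blast
  obtain w2 where w2: "H1_rep w2 (weak_deriv (v N))" "eq_ae (v N) w2" using H1_rep_of_in_H1[OF h(2)] by blast
  have b: "\<forall>i\<in>{1..N div 2}. \<forall>j\<in>{1..N div 2}. eq_ae (v i) (v j)"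
    "\<forall>i\<in>{N div 2 + 1..N}. \<forall>j\<in>{N div 2 + 1..N}. eq_ae (v i) (v j)"
    using assms(1) unfolding H1_half_graph_def by blast+
  have "\<forall>j\<in>{1..N div 2}. eq_ae (v j) w1" using b(1) m(3) w1(2) eq_ae_trans by blast
  moreover have "\<forall>j\<in>{N div 2 + 1..N}. eq_ae (v j) w2" using b(2) m(4) w2(2) eq_ae_trans by blast
  ultimately show ?thesis using w1(1) w2(1) unfolding block_rep_def by blast
qed

lemma H1_half_graph_of_block_rep:
  assumes "block_rep N v w1 g1 w2 g2"
  shows "v \<in> H1_half_graph N"
proof -
  have e1: "eq_ae (v j) w1" if "j \<in> {1..N div 2}" for j using block_rep_edges(1)[OF assms that] by blast
  have e2: "eq_ae (v j) w2" if "j \<in> {N div 2 + 1..N}" for j using block_rep_edges(2)[OF assms that] by blast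
  have "in_H1 (v j)" if "j \<in> {1..N}" for j
  proof (cases "j \<le> N div 2")
    case True then show ?thesis using block_rep_edges(1)[OF assms, of j] that by auto
  next
    case False then show ?thesis using block_rep_edges(2)[OF assms, of j] that by auto
  qed
  moreover have "eq_ae (v i) (v j)" if "i \<in> {1..N div 2}" "j \<in> {1..N div 2}" for i j
    by (rule eq_ae_trans[OF e1[OF that(1)] eq_ae_sym[OF e1[OF that(2)]]])
  moreover have "eq_ae (v i) (v j)" if "i \<in> {N div 2 + 1..N}" "j \<in> {N div 2 + 1..N}" for i j
    by (rule eq_ae_trans[OF e2[OF that(1)] eq_ae_sym[OF e2[OF that(2)]]])
  ultimately show ?thesis unfolding H1_half_graph_def H1_graph_def by blast
qed

lemma graph_norm_powr:
  assumes "even N" "0 < q" "\<And>j. j \<in> {1..N div 2} \<Longrightarrow> Lq_mass q (v j) = x" "\<And>j. j \<in> {N div 2 + 1..N} \<Longrightarrow> Lq_mass q (v j) = y"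
    and "0 \<le> x" "0 \<le> y"
  shows "graph_norm N q v powr q = real (N div 2) * (x + y)"
proof -
  have "graph_norm N q v = (\<Sum>j=1..N. Lq_mass q (v j)) powr (1 / q)"
    by (simp add: graph_norm_def Lq_mass_def)
  also have "(\<Sum>j=1..N. Lq_mass q (v j)) = real (N div 2) * (x + y)"
    by (rule sum_two_blocks[OF assms(1,3,4)])
  finally show ?thesis using assms(2,5,6) by (simp add: powr_powr)
qed

text \<open>
  Summation over the edges gives a factor \<open>N div 2\<close> in each norm and its square in the vertex term; one
  of the two factors there is absorbed by \<open>\<tau> * sqrt \<omega> = - (N div 2) / \<beta>\<close>.
\<close>

lemma graph_functionals_block_rep:
  assumes rep: "block_rep N v w1 g1 w2 g2" and "even N" "1 < p" "0 < \<omega>" "\<beta> < 0"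
    and \<tau>: "\<tau> = real N / (2 * \<bar>\<beta>\<bar> * sqrt \<omega>)"
  defines "Q \<equiv> pair_form \<omega> \<tau> w1 g1 w2 g2" and "B \<equiv> Lq_mass (p + 1) w1 + Lq_mass (p + 1) w2"
  shows "I_nehari N p \<beta> \<omega> v = real (N div 2) * (Q - B)"
    and "S_action N p \<beta> \<omega> v = real (N div 2) / 2 * (Q - 2 / (p + 1) * B)"
proof -
  define n where "n = real (N div 2)"
  have r: "H1_rep w1 g1" "H1_rep w2 g2" using rep by (auto simp: block_rep_def)
  have L2: "in_Lq 2 w1" "in_Lq 2 w2" "in_Lq 2 g1" "in_Lq 2 g2" using r by (auto simp: H1_rep_def)
  have Lp: "in_Lq (p + 1) w1" "in_Lq (p + 1) w2" using H1_rep_in_Lq r assms(3) by blast+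
  have m: "Lq_mass q u = Lq_mass q w" if "eq_ae u w" "in_Lq q w" for q u w
    using in_Lq_cong(2)[OF that] by (simp add: Lq_mass_def)
  have sq: "(graph_norm N 2 u)\<^sup>2 = graph_norm N 2 u powr 2" for u
    by (simp add: graph_norm_def)
  have "graph_norm N 2 v powr 2 = n * (Lq_mass 2 w1 + Lq_mass 2 w2)"
    unfolding n_def by (rule graph_norm_powr[OF assms(2)])
      (use block_rep_edges[OF rep] m L2 Lq_mass_nonneg in auto)
  then have 1: "(graph_norm N 2 v)\<^sup>2 = n * (Lq_mass 2 w1 + Lq_mass 2 w2)" unfolding sq .
  have "graph_norm N 2 (\<lambda>j. weak_deriv (v j)) powr 2 = n * (Lq_mass 2 g1 + Lq_mass 2 g2)"
    unfolding n_def by (rule graph_norm_powr[OF assms(2)])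
      (use block_rep_edges[OF rep] m L2 Lq_mass_nonneg in auto)
  then have 2: "(graph_norm N 2 (\<lambda>j. weak_deriv (v j)))\<^sup>2 = n * (Lq_mass 2 g1 + Lq_mass 2 g2)" unfolding sq .
  have 3: "graph_norm N (p + 1) v powr (p + 1) = n * B"
    unfolding n_def B_def by (rule graph_norm_powr[OF assms(2)])
      (use block_rep_edges[OF rep] m Lp Lq_mass_nonneg assms(3) in auto)
  have "(\<Sum>j=1..N. trace0 (v j)) = of_nat (N div 2) * (w1 0 + w2 0)"
    by (rule sum_two_blocks[OF assms(2)]) (use block_rep_edges[OF rep] in auto)
  then have 4: "(cmod (\<Sum>j=1..N. trace0 (v j)))\<^sup>2 = n\<^sup>2 * (cmod (w1 0 + w2 0))\<^sup>2"
    by (simp add: norm_mult power_mult_distrib n_def)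
  have N: "real N = 2 * n" using assms(2) by (auto simp: n_def)
  have "\<tau> * sqrt \<omega> = real N / (2 * \<bar>\<beta>\<bar>)" unfolding \<tau> using assms(4) by simp
  also have "\<dots> = - (n / \<beta>)" unfolding N using assms(5) by simp
  finally have ts: "\<tau> * sqrt \<omega> = - (n / \<beta>)" .
  have F: "F_form N \<beta> v + \<omega> * (graph_norm N 2 v)\<^sup>2 = n * Q"
    unfolding F_form_def 1 2 4 Q_def pair_form_def quad_form_def ts by (simp add: algebra_simps power2_eq_square)
  show "I_nehari N p \<beta> \<omega> v = real (N div 2) * (Q - B)"
    unfolding I_nehari_def F 3 n_def by (simp add: right_diff_distrib)
  have "S_action N p \<beta> \<omega> v = 1 / 2 * (F_form N \<beta> v + \<omega> * (graph_norm N 2 v)\<^sup>2) - 1 / (p + 1) * (graph_norm N (p + 1) v powr (p + 1))"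
    by (simp add: S_action_def algebra_simps)
  then show "S_action N p \<beta> \<omega> v = real (N div 2) / 2 * (Q - 2 / (p + 1) * B)"
    unfolding F 3 n_def by (simp add: right_diff_distrib)
qed

lemma block_rep_nonzero:
  assumes rep: "block_rep N v w1 g1 w2 g2"
  shows "\<not> graph_eq N v (\<lambda>j x. 0) \<Longrightarrow> \<exists>x\<ge>0. w1 x \<noteq> 0 \<or> w2 x \<noteq> 0"
    and "2 \<le> N \<Longrightarrow> w1 0 \<noteq> 0 \<Longrightarrow> \<not> graph_eq N v (\<lambda>j x. 0)"
proof -
  show "\<exists>x\<ge>0. w1 x \<noteq> 0 \<or> w2 x \<noteq> 0" if nz: "\<not> graph_eq N v (\<lambda>j x. 0)"
  proof (rule ccontr)
    assume "\<not> ?thesis"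
    then have z: "eq_ae w1 (\<lambda>x. 0)" "eq_ae w2 (\<lambda>x. 0)" by (auto intro: eq_ae_on_half_line)
    have "eq_ae (v j) (\<lambda>x. 0)" if "j \<in> {1..N}" for j
    proof (cases "j \<le> N div 2")
      case True
      then have "eq_ae (v j) w1" using block_rep_edges(1)[OF rep, of j] that by auto
      then show ?thesis using z(1) by (rule eq_ae_trans)
    next
      case False
      then have "eq_ae (v j) w2" using block_rep_edges(2)[OF rep, of j] that by auto
      then show ?thesis using z(2) by (rule eq_ae_trans)
    qed
    then show False using nz unfolding graph_eq_def by blast
  qed
  show "\<not> graph_eq N v (\<lambda>j x. 0)" if "2 \<le> N" "w1 0 \<noteq> 0"
  proof
    assume z: "graph_eq N v (\<lambda>j x. 0)"
    have m: "1 \<in> {1..N}" "1 \<in> {1..N div 2}" using that by auto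
    have "eq_ae (v 1) (\<lambda>x. 0)" using z m(1) unfolding graph_eq_def by blast
    moreover have "eq_ae (v 1) w1" using block_rep_edges(1)[OF rep m(2)] by blast
    ultimately have "eq_ae w1 (\<lambda>x. 0)" using eq_ae_sym eq_ae_trans by blast
    moreover have "continuous_on {0..} w1" using rep H1_rep_continuous unfolding block_rep_def by blast
    ultimately have "w1 0 = 0" using continuous_eq_ae_imp_eq[of w1 "\<lambda>x. 0" 0] by auto
    then show False using that by simp
  qed
qed

lemma norm_add_eq_imp_sgn_eq:
  fixes z1 z2 :: complex
  assumes "cmod (z1 + z2) = cmod z1 + cmod z2" "z1 \<noteq> 0" "z2 \<noteq> 0"
  shows "sgn z1 = sgn z2"
proof -
  have "cmod z1 *\<^sub>R z2 = cmod z2 *\<^sub>R z1" using assms(1) norm_triangle_eq[of z1 z2] by blast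
  then show ?thesis using assms(2,3) by (simp add: sgn_eq scaleR_conv_of_real divide_simps mult.commute)
qed

text \<open>
  The bound \<open>nehari_lower_bound\<close> is attained on the orbit by \<open>profile_pair_energy\<close> and
  \<open>profile_nehari\<close>. Conversely, a function attaining it has components that follow the flow, have the right
  moduli at the vertex in one of the two orders, and share their phase there since the triangle inequality is sharp.
\<close>

theorem minimizers_eq_orbit:
  assumes p: "1 < p" and \<beta>: "\<beta> < 0" and N: "2 \<le> N" "even N" and \<omega>: "0 < \<omega>"
    and \<tau>: "\<tau> = real N / (2 * \<bar>\<beta>\<bar> * sqrt \<omega>)"
    and t1: "0 < t1" "t1 < 1" and t2: "0 < t2" "t2 < 1"
    and crit: "t1 * vertex_value p t1 = \<tau> * (vertex_value p t1 + vertex_value p t2)"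
      "t2 * vertex_value p t2 = \<tau> * (vertex_value p t1 + vertex_value p t2)"
    and mm: "minmax_pair p \<tau> (vertex_value p t1) (vertex_value p t2)"
  shows "minimizers N p \<beta> \<omega> = symmetry_orbit N (phi_asym p \<omega> N t1 t2)"
proof -
  define n where "n = real (N div 2)"
  have n: "0 < n" using N by (auto simp: n_def)
  have \<tau>0: "0 < \<tau>" unfolding \<tau> using N \<beta> \<omega> by (intro divide_pos_pos mult_pos_pos) auto
  define a b where "a = vertex_value p t1" and "b = vertex_value p t2"
  define E where "E = sqrt \<omega> * (peak p \<omega>)\<^sup>2 * pair_energy p \<tau> a b"
  define prof where "prof = phi_asym p \<omega> N t1 t2"
  have S: "0 < peak p \<omega>" by (rule peak_pos[OF p \<omega>])
  have prof: "prof j x = of_real (profile p \<omega> (if j \<le> N div 2 then t1 else t2) x)" for j x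
    by (simp add: prof_def phi_asym_def profile_def)

  have profile_pair: "v \<in> admissible N p \<beta> \<omega> \<and> S_action N p \<beta> \<omega> v = n / 2 * E"
    if s: "(s1, s2) = (t1, t2) \<or> (s1, s2) = (t2, t1)" and u: "cmod u = 1"
      and v1: "\<And>j. j \<in> {1..N div 2} \<Longrightarrow> eq_ae (v j) (\<lambda>x. u * of_real (profile p \<omega> s1 x))"
      and v2: "\<And>j. j \<in> {N div 2 + 1..N} \<Longrightarrow> eq_ae (v j) (\<lambda>x. u * of_real (profile p \<omega> s2 x))"
    for v u s1 s2
  proof -
    have s1: "0 < s1" "s1 < 1" and s2: "0 < s2" "s2 < 1" using s t1 t2 by auto
    have c: "s1 * vertex_value p s1 = \<tau> * (vertex_value p s1 + vertex_value p s2)"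
      "s2 * vertex_value p s2 = \<tau> * (vertex_value p s1 + vertex_value p s2)"
      using s crit by (auto simp: add.commute)
    define w1 where "w1 = edge_profile p \<omega> u s1"
    define w2 where "w2 = edge_profile p \<omega> u s2"
    define g1 where "g1 = edge_slope p \<omega> u s1"
    define g2 where "g2 = edge_slope p \<omega> u s2"
    note defs = w1_def w2_def g1_def g2_def
    note facts = p \<omega> s1 s2 u \<tau>0 c
    have r: "H1_rep w1 g1" "H1_rep w2 g2"
      unfolding defs by (rule H1_rep_edge_profile[OF p \<omega> s1 u], rule H1_rep_edge_profile[OF p \<omega> s2 u])
    have neh: "pair_form \<omega> \<tau> w1 g1 w2 g2 = Lq_mass (p + 1) w1 + Lq_mass (p + 1) w2"
      unfolding defs by (rule profile_nehari[OF facts])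
    have "pair_form \<omega> \<tau> w1 g1 w2 g2 - 2 / (p + 1) * (Lq_mass (p + 1) w1 + Lq_mass (p + 1) w2)
      = sqrt \<omega> * (peak p \<omega>)\<^sup>2 * pair_energy p \<tau> (vertex_value p s1) (vertex_value p s2)"
      unfolding defs by (rule profile_pair_energy[OF facts])
    moreover have "pair_energy p \<tau> (vertex_value p s1) (vertex_value p s2) = pair_energy p \<tau> a b"
      using s pair_energy_commute by (auto simp: a_def b_def)
    ultimately have en: "pair_form \<omega> \<tau> w1 g1 w2 g2 - 2 / (p + 1) * (Lq_mass (p + 1) w1 + Lq_mass (p + 1) w2) = E"
      by (simp only: E_def)
    have br: "block_rep N v w1 g1 w2 g2"
      unfolding block_rep_def using r v1 v2 by (auto simp: w1_def w2_def edge_profile_def[abs_def])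
    have "cmod (w1 0) = profile p \<omega> s1 0" unfolding w1_def by (rule norm_edge_profile[OF p \<omega> u])
    moreover have "0 < profile p \<omega> s1 0" unfolding profile_def by (rule phi_pos[OF p \<omega>])
    ultimately have "w1 0 \<noteq> 0" by auto
    then have "\<not> graph_eq N v (\<lambda>j x. 0)" by (rule block_rep_nonzero(2)[OF br N(1)])
    moreover have "I_nehari N p \<beta> \<omega> v = 0"
      using graph_functionals_block_rep(1)[OF br N(2) p \<omega> \<beta> \<tau>] neh by simp
    moreover have "S_action N p \<beta> \<omega> v = n / 2 * E"
      using graph_functionals_block_rep(2)[OF br N(2) p \<omega> \<beta> \<tau>] en by (simp add: n_def)
    ultimately show ?thesis using H1_half_graph_of_block_rep[OF br] by (simp add: admissible_def)
  qed

  have orbit_imp: "v \<in> admissible N p \<beta> \<omega> \<and> S_action N p \<beta> \<omega> v = n / 2 * E" if orb: "v \<in> symmetry_orbit N prof" for v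
  proof -
    obtain \<theta> where alt: "graph_eq N v (\<lambda>j x. cis \<theta> * prof j x) \<or> graph_eq N v (\<lambda>j x. cis \<theta> * swap_blocks N prof j x)"
      using orb unfolding symmetry_orbit_def by blast
    then show ?thesis
    proof
      assume "graph_eq N v (\<lambda>j x. cis \<theta> * prof j x)"
      then have e: "eq_ae (v j) (\<lambda>x. cis \<theta> * prof j x)" if "j \<in> {1..N}" for j using that unfolding graph_eq_def by blast
      show ?thesis
      proof (rule profile_pair[of t1 t2 "cis \<theta>"])
        show "eq_ae (v j) (\<lambda>x. cis \<theta> * of_real (profile p \<omega> t1 x))" if "j \<in> {1..N div 2}" for j
        proof -
          have "j \<in> {1..N}" "j \<le> N div 2" using that by auto
          then show ?thesis using e[of j] by (simp add: prof)
        qed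
        show "eq_ae (v j) (\<lambda>x. cis \<theta> * of_real (profile p \<omega> t2 x))" if "j \<in> {N div 2 + 1..N}" for j
          using e[of j] that by (simp add: prof)
      qed auto
    next
      assume "graph_eq N v (\<lambda>j x. cis \<theta> * swap_blocks N prof j x)"
      then have e: "eq_ae (v j) (\<lambda>x. cis \<theta> * swap_blocks N prof j x)" if "j \<in> {1..N}" for j using that unfolding graph_eq_def by blast
      have sw: "swap_blocks N prof j x = of_real (profile p \<omega> t2 x)" if "j \<in> {1..N div 2}" for j x
        using that by (auto simp: swap_blocks_def prof)
      have sw': "swap_blocks N prof j x = of_real (profile p \<omega> t1 x)" if "j \<in> {N div 2 + 1..N}" for j x
        using that N(2) by (auto simp: swap_blocks_def prof elim!: evenE)
      show ?thesis
      proof (rule profile_pair[of t2 t1 "cis \<theta>"])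
        show "eq_ae (v j) (\<lambda>x. cis \<theta> * of_real (profile p \<omega> t2 x))" if "j \<in> {1..N div 2}" for j
          using e[of j] that unfolding sw[OF that] by auto
        show "eq_ae (v j) (\<lambda>x. cis \<theta> * of_real (profile p \<omega> t1 x))" if "j \<in> {N div 2 + 1..N}" for j
          using e[of j] that unfolding sw'[OF that] by auto
      qed auto
    qed
  qed

  have lower: "n / 2 * E \<le> S_action N p \<beta> \<omega> v"
    and eq_imp: "S_action N p \<beta> \<omega> v = n / 2 * E \<Longrightarrow> v \<in> symmetry_orbit N prof"
    if v: "v \<in> admissible N p \<beta> \<omega>" for v
  proof -
    have vH: "v \<in> H1_half_graph N" and nz: "\<not> graph_eq N v (\<lambda>j x. 0)" and I: "I_nehari N p \<beta> \<omega> v = 0"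
      using v by (auto simp: admissible_def)
    obtain w1 g1 w2 g2 where br: "block_rep N v w1 g1 w2 g2"
      using block_rep_of_H1_half_graph[OF vH N] by blast
    have r: "H1_rep w1 g1" "H1_rep w2 g2" using br by (auto simp: block_rep_def)
    obtain x0 where x0: "0 \<le> x0" "w1 x0 \<noteq> 0 \<or> w2 x0 \<noteq> 0" using block_rep_nonzero(1)[OF br nz] by blast
    define B where "B = Lq_mass (p + 1) w1 + Lq_mass (p + 1) w2"
    have neh: "pair_form \<omega> \<tau> w1 g1 w2 g2 = Lq_mass (p + 1) w1 + Lq_mass (p + 1) w2"
      using graph_functionals_block_rep(1)[OF br N(2) p \<omega> \<beta> \<tau>] I n unfolding n_def by simp
    have Sv: "S_action N p \<beta> \<omega> v = n / 2 * ((1 - 2 / (p + 1)) * B)"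
      unfolding graph_functionals_block_rep(2)[OF br N(2) p \<omega> \<beta> \<tau>] neh B_def n_def by (simp add: algebra_simps)
    note lb = nehari_lower_bound[OF r p \<omega> \<tau>0 mm neh x0, folded a_def b_def, folded E_def B_def]
    show "n / 2 * E \<le> S_action N p \<beta> \<omega> v" unfolding Sv using lb(1) n by (intro mult_left_mono) auto
    assume "S_action N p \<beta> \<omega> v = n / 2 * E"
    then have eq: "(1 - 2 / (p + 1)) * B = E" unfolding Sv using n by simp
    note ext = lb(2)[OF eq]
    define u where "u = sgn (w1 0)"
    have pos: "0 < a" "0 < b" unfolding a_def b_def using vertex_value_bounds p t1 t2 by blast+
    have w0: "w1 0 \<noteq> 0" "w2 0 \<noteq> 0" using ext pos S by auto
    have u2: "sgn (w2 0) = u" unfolding u_def using norm_add_eq_imp_sgn_eq[OF _ w0] ext by simp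
    have "cmod u = 1" unfolding u_def using w0 by (simp add: norm_sgn)
    then obtain \<theta> where th: "u = cis \<theta>" by (metis cis_Arg complex_norm_eq_1_exp cis_conv_exp)
    have flow1: "eq_ae g1 (\<lambda>x. - flow p \<omega> (w1 x))"
      by (rule energy_equality_imp_flow[OF r(1) p \<omega>]) (use ext le_sup_norm[OF r(1)] in \<open>auto intro: order_trans\<close>)
    have flow2: "eq_ae g2 (\<lambda>x. - flow p \<omega> (w2 x))"
      by (rule energy_equality_imp_flow[OF r(2) p \<omega>]) (use ext le_sup_norm[OF r(2)] in \<open>auto intro: order_trans\<close>)
    have sol: "eq_ae w (\<lambda>x. cis \<theta> * of_real (profile p \<omega> t x))"
      if "H1_rep w g" "eq_ae g (\<lambda>x. - flow p \<omega> (w x))" "0 < t" "t < 1"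
        "cmod (w 0) = peak p \<omega> * vertex_value p t" "sgn (w 0) = u" for w g t
      using flow_solution_unique[OF that(1) p \<omega> that(2,3,4) that(5)[unfolded vertex_value_def]] that(6)
      unfolding th profile_def by (intro eq_ae_on_half_line) simp
    have e1: "eq_ae (v j) w1" if "j \<in> {1..N div 2}" for j using block_rep_edges(1)[OF br that] by blast
    have e2: "eq_ae (v j) w2" if "j \<in> {N div 2 + 1..N}" for j using block_rep_edges(2)[OF br that] by blast
    from ext have "cmod (w1 0) = peak p \<omega> * a \<and> cmod (w2 0) = peak p \<omega> * b \<or> cmod (w1 0) = peak p \<omega> * b \<and> cmod (w2 0) = peak p \<omega> * a"
      by blast
    then show "v \<in> symmetry_orbit N prof"
    proof
      assume ab: "cmod (w1 0) = peak p \<omega> * a \<and> cmod (w2 0) = peak p \<omega> * b"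
      have s1: "eq_ae w1 (\<lambda>x. cis \<theta> * of_real (profile p \<omega> t1 x))"
        by (rule sol[OF r(1) flow1 t1]) (use ab in \<open>auto simp: a_def u_def\<close>)
      have s2: "eq_ae w2 (\<lambda>x. cis \<theta> * of_real (profile p \<omega> t2 x))"
        by (rule sol[OF r(2) flow2 t2]) (use ab u2 in \<open>auto simp: b_def\<close>)
      have "eq_ae (v j) (\<lambda>x. cis \<theta> * prof j x)" if j: "j \<in> {1..N}" for j
      proof (cases "j \<le> N div 2")
        case True
        then show ?thesis using eq_ae_trans[OF e1 s1, of j] j by (simp add: prof)
      next
        case False
        then show ?thesis using eq_ae_trans[OF e2 s2, of j] j by (simp add: prof)
      qed
      then show ?thesis unfolding symmetry_orbit_def graph_eq_def by blast
    next
      assume ab: "cmod (w1 0) = peak p \<omega> * b \<and> cmod (w2 0) = peak p \<omega> * a"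
      have s1: "eq_ae w1 (\<lambda>x. cis \<theta> * of_real (profile p \<omega> t2 x))"
        by (rule sol[OF r(1) flow1 t2]) (use ab in \<open>auto simp: b_def u_def\<close>)
      have s2: "eq_ae w2 (\<lambda>x. cis \<theta> * of_real (profile p \<omega> t1 x))"
        by (rule sol[OF r(2) flow2 t1]) (use ab u2 in \<open>auto simp: a_def\<close>)
      have "eq_ae (v j) (\<lambda>x. cis \<theta> * swap_blocks N prof j x)" if j: "j \<in> {1..N}" for j
      proof (cases "j \<le> N div 2")
        case True
        then show ?thesis using eq_ae_trans[OF e1 s1, of j] j by (simp add: prof swap_blocks_def)
      next
        case False
        moreover have "j - N div 2 \<le> N div 2" using j N(2) by (auto elim!: evenE)
        ultimately show ?thesis using eq_ae_trans[OF e2 s2, of j] j by (simp add: prof swap_blocks_def)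
      qed
      then show ?thesis unfolding symmetry_orbit_def graph_eq_def by blast
    qed
  qed

  have in_orbit: "(\<lambda>j x. cis 0 * prof j x) \<in> symmetry_orbit N prof"
    unfolding symmetry_orbit_def graph_eq_def eq_ae_def by (auto intro!: exI[of _ 0])
  have d: "d_half N p \<beta> \<omega> = ereal (n / 2 * E)"
    unfolding d_half_def
  proof (rule antisym)
    show "(INF v\<in>admissible N p \<beta> \<omega>. ereal (S_action N p \<beta> \<omega> v)) \<le> ereal (n / 2 * E)"
      by (rule INF_lower2[of "\<lambda>j x. cis 0 * prof j x"]) (use orbit_imp[OF in_orbit] in auto)
    show "ereal (n / 2 * E) \<le> (INF v\<in>admissible N p \<beta> \<omega>. ereal (S_action N p \<beta> \<omega> v))"
      by (rule INF_greatest) (use lower in auto)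
  qed
  show ?thesis
    unfolding minimizers_def d prof_def[symmetric] using orbit_imp eq_imp by auto
qed

section \<open>The two regimes\<close>

lemma vertex_value_curve:
  assumes "1 < p" "0 < y" "e \<in> {-1, 1}"
  shows "vertex_value p (curve_slope p y * exp (- (e * y))) = curve_radius p y * exp (e * y)"
proof -
  have r: "0 < curve_radius p y * exp (e * y)" using curve_radius_pos[of p y] assms by simp
  have "vertex_value p (curve_slope p y * exp (- (e * y))) = ((curve_radius p y * exp (e * y)) powr (p - 1)) powr (1 / (p - 1))"
    unfolding vertex_value_def curve_height[OF assms] by (simp add: mult.commute)
  also have "\<dots> = curve_radius p y * exp (e * y)" using r assms(1) by (simp add: powr_powr)
  finally show ?thesis .
qed

text \<open>
  The bounds on \<open>\<omega>\<close> are \<open>(p - 1) / (p + 1) \<le> 4 * \<tau>^2 < 1\<close>, and \<open>2 * \<tau>\<close> is the hyperbolic tangent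
  of the common soliton phase at the vertex.
\<close>

lemma symmetric_regime:
  fixes N :: nat
  assumes p: "1 < p" and \<beta>: "\<beta> < 0" and N: "2 \<le> N" "even N"
    and \<omega>: "(real N)\<^sup>2 / \<beta>\<^sup>2 < \<omega>" "\<omega> \<le> (p + 1) / (p - 1) * ((real N)\<^sup>2 / \<beta>\<^sup>2)"
  shows "minimizers N p \<beta> \<omega> = symmetry_orbit N (phi_sym p \<beta> \<omega> N)"
proof -
  have \<omega>0: "0 < \<omega>" using \<omega>(1) by (rule le_less_trans[rotated]) simp
  define \<tau> where "\<tau> = real N / (2 * \<bar>\<beta>\<bar> * sqrt \<omega>)"
  have \<tau>: "0 < \<tau>" unfolding \<tau>_def using N \<beta> \<omega>0 by (intro divide_pos_pos mult_pos_pos) auto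
  define q where "q = (real N)\<^sup>2 / \<beta>\<^sup>2"
  have t4: "4 * \<tau>\<^sup>2 = q / \<omega>"
    unfolding \<tau>_def q_def using \<omega>0 by (simp add: power_divide power_mult_distrib)
  have "4 * \<tau>\<^sup>2 < 1" unfolding t4 using \<omega>(1)[folded q_def] \<omega>0 by simp
  then have "(2 * \<tau>)\<^sup>2 < 1\<^sup>2" by (simp add: power_mult_distrib)
  then have t1: "2 * \<tau> < 1" by (rule power2_less_imp_less) simp
  have "(p - 1) / (p + 1) \<le> 4 * \<tau>\<^sup>2"
  proof -
    have "\<omega> * (p - 1) \<le> (p + 1) / (p - 1) * q * (p - 1)"
      using \<omega>(2)[folded q_def] p by (intro mult_right_mono) auto
    also have "\<dots> = (p + 1) * q" using p by simp
    finally show ?thesis unfolding t4 using p \<omega>0 by (simp add: pos_divide_le_eq pos_le_divide_eq mult_ac)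
  qed
  note mm = symmetric_minmax[OF p \<tau> _ this]
  have v: "vertex_value p (2 * \<tau>) = (1 - 4 * \<tau>\<^sup>2) powr (1 / (p - 1))"
    by (simp add: vertex_value_def power_mult_distrib)
  have "minmax_pair p \<tau> (vertex_value p (2 * \<tau>)) (vertex_value p (2 * \<tau>))"
    unfolding minmax_pair_def v using mm t1 by auto
  then have "minimizers N p \<beta> \<omega> = symmetry_orbit N (phi_asym p \<omega> N (2 * \<tau>) (2 * \<tau>))"
    using \<tau> t1 by (intro minimizers_eq_orbit[OF p \<beta> N \<omega>0 \<tau>_def]) auto
  also have "phi_asym p \<omega> N (2 * \<tau>) (2 * \<tau>) = phi_sym p \<beta> \<omega> N"
  proof -
    have "real N / (\<beta> * sqrt \<omega>) = - (2 * \<tau>)" unfolding \<tau>_def using \<beta> by (simp add: field_simps)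
    then have "artanh (real N / (\<beta> * sqrt \<omega>)) = - artanh (2 * \<tau>)" using artanh_minus_real[of "2 * \<tau>"] \<tau> t1 by simp
    then show ?thesis by (simp add: phi_asym_def phi_sym_def)
  qed
  finally show ?thesis .
qed

text \<open>
  The bound on \<open>\<omega>\<close> is \<open>4 * \<tau>^2 < (p - 1) / (p + 1)\<close>.
\<close>

lemma asymmetric_regime:
  fixes N :: nat
  assumes p: "1 < p" and \<beta>: "\<beta> < 0" and N: "2 \<le> N" "even N"
    and \<omega>: "(p + 1) / (p - 1) * ((real N)\<^sup>2 / \<beta>\<^sup>2) < \<omega>"
  shows "\<exists>!t. asym_system p \<beta> \<omega> N (fst t) (snd t)"
    and "asym_system p \<beta> \<omega> N t1 tN \<Longrightarrow> minimizers N p \<beta> \<omega> = symmetry_orbit N (phi_asym p \<omega> N t1 tN)"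
proof -
  have "0 \<le> (p + 1) / (p - 1) * ((real N)\<^sup>2 / \<beta>\<^sup>2)" using p by (intro mult_nonneg_nonneg) auto
  then have \<omega>0: "0 < \<omega>" using \<omega> by (rule le_less_trans)
  define \<tau> where "\<tau> = real N / (2 * \<bar>\<beta>\<bar> * sqrt \<omega>)"
  have \<tau>: "0 < \<tau>" unfolding \<tau>_def using N \<beta> \<omega>0 by (intro divide_pos_pos mult_pos_pos) auto
  define q where "q = (real N)\<^sup>2 / \<beta>\<^sup>2"
  have t4: "4 * \<tau>\<^sup>2 = q / \<omega>"
    unfolding \<tau>_def q_def using \<omega>0 by (simp add: power_divide power_mult_distrib)
  have "4 * \<tau>\<^sup>2 < (p - 1) / (p + 1)"
  proof -
    have "(p + 1) / (p - 1) * q * (p - 1) < \<omega> * (p - 1)"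
      using \<omega>[folded q_def] p by (intro mult_strict_right_mono) auto
    moreover have "(p + 1) / (p - 1) * q * (p - 1) = (p + 1) * q" using p by simp
    ultimately have "(p + 1) * q < \<omega> * (p - 1)" by simp
    then show ?thesis unfolding t4 using p \<omega>0 by (simp add: pos_divide_less_eq pos_less_divide_eq mult_ac)
  qed
  from bifurcation_parameter_ex1[OF p \<tau> this] obtain y0 where
    y0: "0 < y0" "curve_slope p y0 = 2 * \<tau> * cosh y0"
    and uniq: "\<And>y. 0 < y \<Longrightarrow> curve_slope p y = 2 * \<tau> * cosh y \<Longrightarrow> y = y0" by blast
  have N0: "0 < N" and b0: "\<beta> \<noteq> 0" using N \<beta> by auto
  define s1 where "s1 = curve_slope p y0 * exp (- y0)"
  define sN where "sN = curve_slope p y0 * exp y0"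
  have sys: "asym_system p \<beta> \<omega> N t1 tN \<longleftrightarrow> t1 = s1 \<and> tN = sN" for t1 tN
    unfolding asym_system_iff[OF p N0 b0 \<omega>0 \<tau>_def] s1_def sN_def using y0 uniq by metis
  show "\<exists>!t. asym_system p \<beta> \<omega> N (fst t) (snd t)"
    unfolding sys by (rule ex1I[of _ "(s1, sN)"]) auto
  assume "asym_system p \<beta> \<omega> N t1 tN"
  then have t: "t1 = s1" "tN = sN" using sys by auto
  have "asym_system p \<beta> \<omega> N s1 sN" using sys by simp
  then have rng: "0 < s1" "s1 < 1" "0 < sN" "sN < 1" by (auto simp: asym_system_def)
  have v1: "vertex_value p s1 = curve_radius p y0 * exp y0"
    using vertex_value_curve[OF p y0(1), of 1] by (simp add: s1_def)
  have vN: "vertex_value p sN = curve_radius p y0 * exp (- y0)"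
    using vertex_value_curve[OF p y0(1), of "-1"] by (simp add: sN_def)
  have "minmax_pair p \<tau> (vertex_value p s1) (vertex_value p sN)"
    unfolding minmax_pair_def v1 vN using asymmetric_minmax[OF p \<tau> y0]
    by (subst pair_energy_commute) blast
  moreover have "\<tau> * (vertex_value p s1 + vertex_value p sN) = curve_radius p y0 * curve_slope p y0"
    using curve_sum_eq[of p y0] y0(2) unfolding v1 vN by (simp add: curve_sum_def add.commute)
  moreover have "s1 * vertex_value p s1 = curve_radius p y0 * curve_slope p y0"
    "sN * vertex_value p sN = curve_radius p y0 * curve_slope p y0"
    unfolding v1 vN unfolding s1_def sN_def by (simp_all add: exp_minus)
  ultimately show "minimizers N p \<beta> \<omega> = symmetry_orbit N (phi_asym p \<omega> N t1 tN)"
    unfolding t using rng by (intro minimizers_eq_orbit[OF p \<beta> N \<omega>0 \<tau>_def]) auto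
qed

theorem lemma3p4:
  fixes p \<beta> \<omega> :: real and N :: nat
  assumes "p > 1" and "\<beta> < 0" and "N \<ge> 2" and "even N"
  shows "((real N)\<^sup>2 / \<beta>\<^sup>2 < \<omega> \<and> \<omega> \<le> (p + 1) / (p - 1) * ((real N)\<^sup>2 / \<beta>\<^sup>2) \<longrightarrow>
            minimizers N p \<beta> \<omega> = symmetry_orbit N (phi_sym p \<beta> \<omega> N)) \<and>
         (\<omega> > (p + 1) / (p - 1) * ((real N)\<^sup>2 / \<beta>\<^sup>2) \<longrightarrow>
            (\<exists>!t. asym_system p \<beta> \<omega> N (fst t) (snd t)) \<and>
            (\<forall>t1 tN. asym_system p \<beta> \<omega> N t1 tN \<longrightarrow>
               minimizers N p \<beta> \<omega> = symmetry_orbit N (phi_asym p \<omega> N t1 tN)))"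
  using symmetric_regime[OF assms] asymmetric_regime[OF assms] by blast

end
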